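(* Let $c > 0$ be a constant. The WSAT$^+[t]$ ($t \geq 2$) problem on circuits of genus $g(n) =\Omega(n^c)$, where $n$ is the number of variables in the circuit, is $W[t]$-complete for even $t$ and $W[t-1]$-complete for odd $t$.
   Context: A $\Pi_t$ circuit is a Boolean circuit in normalized form of depth at most $t$: the output gate is an AND-gate, every non-variable gate has outdegree at most 1, and starting from the output gate the gates alternate between AND-gates and OR-gates (no NOT-gates; input vertices are literals). A circuit is monotone if all its input literals are positive. WSAT$^+[t]$ (weighted monotone $\Pi_t$-circuit satisfiability) is the problem: given a monotone $\Pi_t$ circuit $C$ and a parameter $k$, decide whether $C$ has a satisfying assignment of weight (number of variables set to 1) exactly $k$. The genus of a circuit is the genus of its underlying undirected graph after the output gate is removed. It is known that WSAT$^+[t]$ (without genus restriction) is $W[t]$-complete for even $t$ and $W[t-1]$-complete for odd $t$. *)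

theory Defs
  imports "HOL-Analysis.Analysis" "HOL-Library.Landau_Symbols"
begin

subsection \<open>Algorithms and parameterized problems\<close>

text \<open>
  The machine model is a random access machine with addition and truncated subtraction under
  uniform cost: finitely many registers (those named in the program) and an array of natural
  numbers. Since there is no multiplication, numbers have at most \<open>O(T)\<close> more bits after \<open>T\<close>
  steps than initially, so polynomial time agrees with that of Turing machines.
\<close>

datatype aexp = Const nat | Reg nat | Cell aexp | Plus aexp aexp | Minus aexp aexp

datatype prog =
    Assign nat aexp
  | Store aexp aexp
  | Seq prog prog
  | If aexp prog prog
  | While aexp prog

type_synonym state = "(nat \<Rightarrow> nat) \<times> (nat \<Rightarrow> nat)"

fun aval :: "aexp \<Rightarrow> state \<Rightarrow> nat" where
  "aval (Const n) s = n"
| "aval (Reg i) s = fst s i"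
| "aval (Cell a) s = snd s (aval a s)"
| "aval (Plus a b) s = aval a s + aval b s"
| "aval (Minus a b) s = aval a s - aval b s"

text \<open>\<open>exec p s n s'\<close>: started in \<open>s\<close>, the program \<open>p\<close> halts in \<open>s'\<close> after \<open>n\<close> steps.
  A test succeeds iff its value is nonzero.\<close>

inductive exec :: "prog \<Rightarrow> state \<Rightarrow> nat \<Rightarrow> state \<Rightarrow> bool" where
  "exec (Assign i a) s 1 ((fst s)(i := aval a s), snd s)"
| "exec (Store a b) s 1 (fst s, (snd s)(aval a s := aval b s))"
| "exec p s m s' \<Longrightarrow> exec q s' n s'' \<Longrightarrow> exec (Seq p q) s (m + n) s''"
| "aval a s \<noteq> 0 \<Longrightarrow> exec p s n s' \<Longrightarrow> exec (If a p q) s (n + 1) s'"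
| "aval a s = 0 \<Longrightarrow> exec q s n s' \<Longrightarrow> exec (If a p q) s (n + 1) s'"
| "aval a s = 0 \<Longrightarrow> exec (While a p) s 1 s"
| "aval a s \<noteq> 0 \<Longrightarrow> exec p s m s' \<Longrightarrow> exec (While a p) s' n s'' \<Longrightarrow>
     exec (While a p) s (m + n + 1) s''"

definition computable :: "(nat \<Rightarrow> nat) \<Rightarrow> bool" where
  "computable f \<longleftrightarrow>
     (\<exists>p. \<forall>k. \<exists>n s. exec p ((\<lambda>_. 0)(0 := k), \<lambda>_. 0) n s \<and> fst s 0 = f k)"

text \<open>A string occupies an initial segment of the array; \<open>0\<close> is the blank that ends it.\<close>

definition string_cells :: "bool list \<Rightarrow> nat \<Rightarrow> nat" where
  "string_cells x i = (if i < length x then (if x ! i then 2 else 1) else 0)"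

definition initial_state :: "bool list \<Rightarrow> nat \<Rightarrow> state" where
  "initial_state x k = ((\<lambda>_. 0)(0 := k), string_cells x)"

definition outputs :: "state \<Rightarrow> bool list \<Rightarrow> nat \<Rightarrow> bool" where
  "outputs s x k \<longleftrightarrow> fst s 0 = k \<and> (\<forall>i\<le>length x. snd s i = string_cells x i)"

text \<open>
  A parameterized problem consists of its admissible instances (string, parameter) and the
  yes-instances among them. An algorithm for a problem restricted to a class of inputs is only
  ever run on inputs of that class and need not recognize the class: deciding whether the genus
  of a graph is at most a given bound is itself NP-hard. A language is the case
  \<open>instances = UNIV\<close>.
\<close>

record param_problem =
  instances :: "(bool list \<times> nat) set"
  yes_instances :: "(bool list \<times> nat) set"

definition fpt_reducible :: "param_problem \<Rightarrow> param_problem \<Rightarrow> bool" where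
  "fpt_reducible P Q \<longleftrightarrow>
     (\<exists>p f g d. computable f \<and> computable g \<and>
        (\<forall>(x, k) \<in> instances P. \<exists>n s x' k'.
           exec p (initial_state x k) n s \<and> outputs s x' k' \<and>
           n \<le> f k * (length x + 1) ^ d \<and>
           k' \<le> g k \<and>
           (x', k') \<in> instances Q \<and>
           ((x, k) \<in> yes_instances P \<longleftrightarrow> (x', k') \<in> yes_instances Q)))"

subsection \<open>Circuits\<close>

text \<open>
  A circuit is a directed acyclic graph listed in topological order. Its vertices are the list
  positions, gates refer to the positions of their inputs, and the last position is the output.
  \<open>LIT True v\<close> is the literal \<open>v\<close>, \<open>LIT False v\<close> its negation.
\<close>

datatype gate =
    is_LIT: LIT bool nat
  | is_NOT: NOT nat
  | is_AND: AND "nat list"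
  | is_OR: OR "nat list"

type_synonym circuit = "gate list"

fun fan_in :: "gate \<Rightarrow> nat list" where
  "fan_in (LIT b v) = []"
| "fan_in (NOT j) = [j]"
| "fan_in (AND js) = js"
| "fan_in (OR js) = js"

definition wf_circuit :: "circuit \<Rightarrow> bool" where
  "wf_circuit C \<longleftrightarrow>
     C \<noteq> [] \<and>
     (\<forall>i<length C. \<forall>j\<in>set (fan_in (C ! i)). j < i) \<and>
     (\<forall>G\<in>set C. distinct (fan_in G) \<and> (fan_in G = [] \<longrightarrow> is_LIT G)) \<and>
     distinct (filter is_LIT C)"

definition vars :: "circuit \<Rightarrow> nat set" where
  "vars C = {v. \<exists>b. LIT b v \<in> set C}"

text \<open>Computes a value for every vertex from the list of values of the preceding ones.\<close>

definition vertex_values :: "('a list \<Rightarrow> gate \<Rightarrow> 'a) \<Rightarrow> circuit \<Rightarrow> 'a list" where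
  "vertex_values f C = foldl (\<lambda>vs G. vs @ [f vs G]) [] C"

text \<open>An assignment is given by the set \<open>S\<close> of variables set to 1; its weight is \<open>card S\<close>.\<close>

fun gate_eval :: "nat set \<Rightarrow> bool list \<Rightarrow> gate \<Rightarrow> bool" where
  "gate_eval S vs (LIT b v) \<longleftrightarrow> (v \<in> S) = b"
| "gate_eval S vs (NOT j) \<longleftrightarrow> \<not> vs ! j"
| "gate_eval S vs (AND js) \<longleftrightarrow> (\<forall>j\<in>set js. vs ! j)"
| "gate_eval S vs (OR js) \<longleftrightarrow> (\<exists>j\<in>set js. vs ! j)"

definition satisfies :: "nat set \<Rightarrow> circuit \<Rightarrow> bool" where
  "satisfies S C \<longleftrightarrow> last (vertex_values (gate_eval S) C)"

definition weight_satisfiable :: "circuit \<Rightarrow> nat \<Rightarrow> bool" where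
  "weight_satisfiable C k \<longleftrightarrow> (\<exists>S. S \<subseteq> vars C \<and> card S = k \<and> satisfies S C)"

text \<open>The largest number of gates with property \<open>P\<close> on a path to the output.\<close>

definition max_on_path :: "(gate \<Rightarrow> bool) \<Rightarrow> circuit \<Rightarrow> nat" where
  "max_on_path P C =
     last (vertex_values
       (\<lambda>vs G. of_bool (P G) + Max (insert 0 ((\<lambda>j. vs ! j) ` set (fan_in G)))) C)"

definition depth :: "circuit \<Rightarrow> nat" where
  "depth = max_on_path (\<lambda>G. \<not> is_LIT G)"

definition weft :: "circuit \<Rightarrow> nat" where
  "weft = max_on_path (\<lambda>G. length (fan_in G) > 2)"

definition outdegree :: "circuit \<Rightarrow> nat \<Rightarrow> nat" where
  "outdegree C j = card {i. i < length C \<and> j \<in> set (fan_in (C ! i))}"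

definition Pi_circuit :: "nat \<Rightarrow> circuit \<Rightarrow> bool" where
  "Pi_circuit t C \<longleftrightarrow>
     wf_circuit C \<and> depth C \<le> t \<and> is_AND (last C) \<and>
     (\<forall>G\<in>set C. \<not> is_NOT G) \<and>
     (\<forall>j<length C. \<not> is_LIT (C ! j) \<longrightarrow> outdegree C j \<le> 1) \<and>
     (\<forall>i<length C. \<forall>j\<in>set (fan_in (C ! i)).
        \<not> (is_AND (C ! i) \<and> is_AND (C ! j)) \<and> \<not> (is_OR (C ! i) \<and> is_OR (C ! j)))"

definition monotone_circuit :: "circuit \<Rightarrow> bool" where
  "monotone_circuit C \<longleftrightarrow> (\<forall>b v. LIT b v \<in> set C \<longrightarrow> b)"

text \<open>
  Numbers are written in unary. For circuits whose variables are numbered consecutively the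
  length of the code is polynomial in the number of vertices.
\<close>

definition encode_nat :: "nat \<Rightarrow> bool list" where
  "encode_nat n = replicate n True @ [False]"

definition encode_nats :: "nat list \<Rightarrow> bool list" where
  "encode_nats ns = encode_nat (length ns) @ concat (map encode_nat ns)"

fun gate_code :: "gate \<Rightarrow> nat list" where
  "gate_code (LIT b v) = [of_bool b, v]"
| "gate_code (NOT j) = [2, j]"
| "gate_code (AND js) = 3 # js"
| "gate_code (OR js) = 4 # js"

definition encode :: "circuit \<Rightarrow> bool list" where
  "encode C = concat (map (\<lambda>G. encode_nats (gate_code G)) C)"

lemma encode_nat_append_eq:
  "encode_nat m @ xs = encode_nat n @ ys \<longleftrightarrow> m = n \<and> xs = ys"
proof (induction m arbitrary: n)
  case 0
  show ?case by (cases n) (auto simp: encode_nat_def)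
next
  case (Suc m)
  then show ?case by (cases n) (auto simp: encode_nat_def)
qed

lemma concat_encode_nat_append_eq:
  "length ms = length ns \<Longrightarrow>
   concat (map encode_nat ms) @ xs = concat (map encode_nat ns) @ ys \<longleftrightarrow> ms = ns \<and> xs = ys"
  by (induction ms ns rule: list_induct2) (auto simp: encode_nat_append_eq)

lemma encode_nats_append_eq:
  "encode_nats ms @ xs = encode_nats ns @ ys \<longleftrightarrow> ms = ns \<and> xs = ys"
  unfolding encode_nats_def
  by (cases "length ms = length ns")
     (auto simp: encode_nat_append_eq concat_encode_nat_append_eq)

lemma gate_code_eq_iff: "gate_code G = gate_code H \<longleftrightarrow> G = H"
  by (cases G; cases H) (auto simp: of_bool_def)

lemma encode_eq_iff: "encode C = encode D \<longleftrightarrow> C = D"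
proof (induction C arbitrary: D)
  case Nil
  show ?case by (cases D) (auto simp: encode_def encode_nats_def encode_nat_def)
next
  case (Cons G C)
  show ?case
  proof (cases D)
    case Nil
    then show ?thesis by (auto simp: encode_def encode_nats_def encode_nat_def)
  next
    case (Cons H D')
    then show ?thesis
      using Cons.IH[of D'] by (auto simp: encode_def encode_nats_append_eq gate_code_eq_iff)
  qed
qed

definition weighted_sat :: "(circuit \<Rightarrow> bool) \<Rightarrow> param_problem" where
  "weighted_sat \<C> =
     \<lparr>instances = {(encode C, k) | C k. \<C> C},
      yes_instances = {(encode C, k) | C k. \<C> C \<and> weight_satisfiable C k}\<rparr>"

subsection \<open>The W-hierarchy\<close>

definition W :: "nat \<Rightarrow> param_problem set" where
  "W t = {Q. \<exists>h. fpt_reducible Q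
                   (weighted_sat (\<lambda>C. wf_circuit C \<and> weft C \<le> t \<and> depth C \<le> h))}"

definition W_complete :: "nat \<Rightarrow> param_problem \<Rightarrow> bool" where
  "W_complete t Q \<longleftrightarrow> Q \<in> W t \<and> (\<forall>P\<in>W t. fpt_reducible P Q)"

subsection \<open>Genus\<close>

definition disc_with_holes :: "nat \<Rightarrow> complex set \<Rightarrow> bool" where
  "disc_with_holes h D \<longleftrightarrow>
     (\<exists>a r. (\<forall>i<h. r i > 0 \<and> cball (a i) (r i) \<subseteq> ball 0 1) \<and>
            disjoint_family_on (\<lambda>i. cball (a i) (r i)) {..<h} \<and>
            D = cball 0 1 - (\<Union>i<h. ball (a i) (r i)))"

text \<open>
  Two copies of \<open>D\<close>, one above and one below the plane, glued along the boundary of \<open>D\<close>.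
  For a disc with \<open>h\<close> holes (any positions and radii) this is the sphere with \<open>h\<close> handles.
\<close>

definition double :: "complex set \<Rightarrow> (complex \<times> real) set" where
  "double D = {(z, s). z \<in> D \<and> \<bar>s\<bar> = infdist z (frontier D)}"

definition orientable_surface :: "nat \<Rightarrow> (complex \<times> real) set \<Rightarrow> bool" where
  "orientable_surface h S \<longleftrightarrow> (\<exists>D. disc_with_holes h D \<and> S = double D)"

definition embeds_in :: "'v set \<Rightarrow> 'v set set \<Rightarrow> 'a::topological_space set \<Rightarrow> bool" where
  "embeds_in V E S \<longleftrightarrow>
     (\<exists>p \<gamma>. inj_on p V \<and> p ` V \<subseteq> S \<and>
        (\<forall>e\<in>E. arc (\<gamma> e) \<and> path_image (\<gamma> e) \<subseteq> S \<and>
               {pathstart (\<gamma> e), pathfinish (\<gamma> e)} = p ` e \<and>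
               path_image (\<gamma> e) \<inter> p ` V = p ` e) \<and>
        (\<forall>e\<in>E. \<forall>e'\<in>E. e \<noteq> e' \<longrightarrow>
               path_image (\<gamma> e) \<inter> path_image (\<gamma> e') = p ` (e \<inter> e')))"

definition graph_genus :: "'v set \<Rightarrow> 'v set set \<Rightarrow> nat" where
  "graph_genus V E = (LEAST h. \<exists>S. orientable_surface h S \<and> embeds_in V E S)"

text \<open>The graph of the circuit without the output, which is the last vertex.\<close>

definition circuit_genus :: "circuit \<Rightarrow> nat" where
  "circuit_genus C =
     graph_genus {..<length C - 1} {{i, j} | i j. i < length C - 1 \<and> j \<in> set (fan_in (C ! i))}"

definition WSAT_mono :: "nat \<Rightarrow> (nat \<Rightarrow> nat) \<Rightarrow> param_problem" where
  "WSAT_mono t g =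
     weighted_sat (\<lambda>C. Pi_circuit t C \<and> monotone_circuit C \<and> circuit_genus C \<le> g (card (vars C)))"

end

theory Submission
  imports Defs
begin

text \<open>
  A circuit of weft \<open>t\<close> and bounded depth is equivalent to a prenex formula with \<open>t + 1\<close>
  alternating quantifiers over polynomially many indices, the first one existential, whose matrix
  depends on boundedly many literals. The leading index is guessed by a variable. A chosen set \<open>S\<close>
  of size \<open>k\<close> is represented by its \<open>k + 1\<close> gaps, the pairs of consecutive elements: both
  \<open>v \<in> S\<close> and \<open>v \<notin> S\<close> then say that one of the gaps has a certain form, so negation disappears, and
  variables for tuples of gaps make the matrix a disjunction of variables. The variables form groups;
  clauses asking for one true variable in every group, with weight equal to the number of groups,
  force exactly one per group.

  The genus is no obstacle: a graph embeds in the sphere with two handles per edge, because an edge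
  can cross the others on the back of the surface, which it enters and leaves through a hole. Since
  \<open>g\<close> grows like a power of the number of variables, isolated dummy variables make \<open>g\<close> exceed
  this bound at polynomial cost.

  For membership with odd \<open>t\<close>, the bottom conjunctions of a monotone circuit have positive literals,
  so only those with at most \<open>k\<close> distinct inputs can hold in an assignment of weight \<open>k\<close>; for
  each of the \<open>2 ^ k\<close> subsets of \<open>S\<close> a gate with this set of inputs is guessed and checked against
  the gaps, so that the bottom level becomes a disjunction of variables.
\<close>

subsection \<open>Total correctness with time bounds\<close>

definition reaches :: "prog \<Rightarrow> state \<Rightarrow> nat \<Rightarrow> (state \<Rightarrow> bool) \<Rightarrow> bool" where
  "reaches p s n Q \<longleftrightarrow> (\<exists>m s'. exec p s m s' \<and> m \<le> n \<and> Q s')"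

lemma reaches_exec: "exec p s n s' \<Longrightarrow> Q s' \<Longrightarrow> reaches p s n Q"
  unfolding reaches_def by blast

lemma reaches_weaken:
  "reaches p s m Q \<Longrightarrow> m \<le> n \<Longrightarrow> (\<And>s'. Q s' \<Longrightarrow> Q' s') \<Longrightarrow> reaches p s n Q'"
  unfolding reaches_def by (meson order_trans)

lemma reaches_Assign: "Q ((fst s)(i := aval a s), snd s) \<Longrightarrow> reaches (Assign i a) s 1 Q"
  by (rule reaches_exec[OF exec.intros(1)])

lemma reaches_Store: "Q (fst s, (snd s)(aval a s := aval b s)) \<Longrightarrow> reaches (Store a b) s 1 Q"
  by (rule reaches_exec[OF exec.intros(2)])

lemma reaches_Seq:
  assumes "reaches p s m Q" "\<And>s'. Q s' \<Longrightarrow> reaches q s' n Q'"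
  shows "reaches (Seq p q) s (m + n) Q'"
proof -
  obtain m' s' where p: "exec p s m' s'" "m' \<le> m" "Q s'"
    using assms(1) unfolding reaches_def by blast
  obtain n' s'' where q: "exec q s' n' s''" "n' \<le> n" "Q' s''"
    using assms(2)[OF p(3)] unfolding reaches_def by blast
  have "exec (Seq p q) s (m' + n') s''" using p(1) q(1) by (rule exec.intros(3))
  then show ?thesis
    unfolding reaches_def using p(2) q(2,3) add_mono by blast
qed

lemma reaches_If:
  assumes "aval a s \<noteq> 0 \<Longrightarrow> reaches p s n Q" "aval a s = 0 \<Longrightarrow> reaches q s n Q"
  shows "reaches (If a p q) s (n + 1) Q"
  using assms exec.intros(4,5)[of a s] unfolding reaches_def by (metis add_le_mono1)

lemma reaches_While:
  assumes test: "\<And>i s. i < n \<Longrightarrow> Inv i s \<Longrightarrow> aval c s \<noteq> 0" "\<And>s. Inv n s \<Longrightarrow> aval c s = 0"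
    and body: "\<And>i s. i < n \<Longrightarrow> Inv i s \<Longrightarrow> reaches p s T (Inv (Suc i))"
    and init: "Inv 0 s"
  shows "reaches (While c p) s (n * (T + 1) + 1) (Inv n)"
proof -
  have "reaches (While c p) s (j * (T + 1) + 1) (Inv n)" if "Inv (n - j) s" "j \<le> n" for j s
    using that
  proof (induction j arbitrary: s)
    case 0
    then have "exec (While c p) s 1 s" using test(2) by (intro exec.intros(6)) simp
    then show ?case using 0 by (simp add: reaches_exec)
  next
    case (Suc j)
    then have less: "n - Suc j < n" by simp
    obtain m s' where m: "exec p s m s'" "m \<le> T" "Inv (Suc (n - Suc j)) s'"
      using body[OF less Suc.prems(1)] unfolding reaches_def by blast
    then have "Inv (n - j) s'" using Suc.prems by (simp add: Suc_diff_Suc)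
    then obtain m' s'' where m': "exec (While c p) s' m' s''" "m' \<le> j * (T + 1) + 1" "Inv n s''"
      using Suc.IH[of s'] Suc.prems(2) unfolding reaches_def by auto
    have "exec (While c p) s (m + m' + 1) s''"
      using test(1)[OF less Suc.prems(1)] m(1) m'(1) by (rule exec.intros(7))
    moreover have "m + m' + 1 \<le> Suc j * (T + 1) + 1" using m(2) m'(2) by simp
    ultimately show ?case unfolding reaches_def using m'(3) by blast
  qed
  from this[of n s] init show ?thesis by simp
qed

definition count_loop :: "nat \<Rightarrow> nat \<Rightarrow> prog \<Rightarrow> prog" where
  "count_loop i n p = Seq (Assign i (Const 0))
     (While (Minus (Reg n) (Reg i)) (Seq p (Assign i (Plus (Reg i) (Const 1)))))"

lemma reaches_count_loop:
  assumes init: "Inv 0 ((fst s)(i := 0), snd s)"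
    and count: "\<And>j s. Inv j s \<Longrightarrow> fst s i = j \<and> fst s n = N"
    and body: "\<And>j s. j < N \<Longrightarrow> Inv j s \<Longrightarrow>
      reaches p s T (\<lambda>s'. fst s' i = j \<and> Inv (Suc j) ((fst s')(i := Suc j), snd s'))"
  shows "reaches (count_loop i n p) s (N * (T + 2) + 2) (Inv N)"
proof -
  have loop: "reaches (While (Minus (Reg n) (Reg i)) (Seq p (Assign i (Plus (Reg i) (Const 1))))) s'
      (N * ((T + 1) + 1) + 1) (Inv N)" if "Inv 0 s'" for s'
  proof (rule reaches_While)
    fix j s' assume j: "j < N" "Inv j s'"
    show "aval (Minus (Reg n) (Reg i)) s' \<noteq> 0" using count[OF j(2)] j(1) by simp
    show "reaches (Seq p (Assign i (Plus (Reg i) (Const 1)))) s' (T + 1) (Inv (Suc j))"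
      by (rule reaches_Seq[OF body[OF j]], rule reaches_Assign) simp
  qed (use count that in auto)
  have "reaches (count_loop i n p) s (1 + (N * ((T + 1) + 1) + 1)) (Inv N)"
    unfolding count_loop_def
  proof (rule reaches_Seq)
    show "reaches (Assign i (Const 0)) s 1 (Inv 0)" using init by (intro reaches_Assign) simp
  qed (rule loop)
  then show ?thesis by (rule reaches_weaken) simp_all
qed

subsection \<open>Feasible functions\<close>

text \<open>
  Register 0 holds the parameter, register 1 the length of the input and register 2 the next output
  cell. The other registers are local variables; a program that computes a function of the first
  \<open>b\<close> of them leaves its result in the local variable \<open>b\<close> and uses those above \<open>b\<close> as scratch
  space.
\<close>

type_synonym input = "bool list \<times> nat"
type_synonym 'a input_fun = "input \<Rightarrow> (nat \<Rightarrow> nat) \<Rightarrow> 'a"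

definition local_reg :: "nat \<Rightarrow> nat" where
  "local_reg i = i + 3"

definition locals :: "state \<Rightarrow> nat \<Rightarrow> nat" where
  "locals s i = fst s (local_reg i)"

lemma local_reg_simps [simp]:
  "local_reg i = local_reg j \<longleftrightarrow> i = j" "local_reg i < local_reg j \<longleftrightarrow> i < j"
  "0 < local_reg i" "Suc 0 < local_reg i" "2 < local_reg i"
  "local_reg i \<noteq> 0" "local_reg i \<noteq> Suc 0" "local_reg i \<noteq> 2"
  "0 \<noteq> local_reg i" "Suc 0 \<noteq> local_reg i" "2 \<noteq> local_reg i"
  by (simp_all add: local_reg_def)

definition loaded :: "input \<Rightarrow> state \<Rightarrow> bool" where
  "loaded I s \<longleftrightarrow> fst s 0 = snd I \<and> fst s 1 = length (fst I) \<and>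
     (\<forall>i\<le>length (fst I). snd s i = string_cells (fst I) i)"

definition unchanged_below :: "nat \<Rightarrow> state \<Rightarrow> state \<Rightarrow> bool" where
  "unchanged_below b s s' \<longleftrightarrow> (\<forall>i<local_reg b. fst s' i = fst s i) \<and> snd s' = snd s"

lemma unchanged_below_locals: "unchanged_below b s s' \<Longrightarrow> i < b \<Longrightarrow> locals s' i = locals s i"
  by (simp add: unchanged_below_def locals_def)

lemma unchanged_below_loaded: "unchanged_below b s s' \<Longrightarrow> loaded I s \<Longrightarrow> loaded I s'"
  by (auto simp: unchanged_below_def loaded_def)

lemma unchanged_below_trans:
  "unchanged_below b s s' \<Longrightarrow> unchanged_below c s' s'' \<Longrightarrow> b \<le> c \<Longrightarrow> unchanged_below b s s''"
  by (auto simp: unchanged_below_def local_reg_def)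

lemma unchanged_below_update: "b \<le> i \<Longrightarrow> unchanged_below b s ((fst s)(local_reg i := v), snd s)"
  by (auto simp: unchanged_below_def local_reg_def)

definition env_size :: "nat \<Rightarrow> input \<Rightarrow> (nat \<Rightarrow> nat) \<Rightarrow> nat" where
  "env_size a I \<rho> = 2 ^ snd I * (2 + snd I + length (fst I) + (\<Sum>i<a. \<rho> i))"

definition fpt_bounded :: "nat \<Rightarrow> nat input_fun \<Rightarrow> bool" where
  "fpt_bounded a F \<longleftrightarrow> (\<exists>D. \<forall>I \<rho>. F I \<rho> \<le> env_size a I \<rho> ^ D)"

lemma fpt_boundedI: "(\<And>I \<rho>. F I \<rho> \<le> env_size a I \<rho> ^ D) \<Longrightarrow> fpt_bounded a F"
  unfolding fpt_bounded_def by blast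

lemma summand_le_env_size: "n \<le> 2 + snd I + length (fst I) + (\<Sum>i<a. \<rho> i) \<Longrightarrow> n \<le> env_size a I \<rho>"
  unfolding env_size_def using mult_le_mono[of 1 "2 ^ snd I" n]
  by (simp only: mult_1 one_le_power one_le_numeral)

lemma env_size_ge_2: "2 \<le> env_size a I \<rho>"
  by (rule summand_le_env_size) simp

lemma env_size_mono: "a \<le> b \<Longrightarrow> env_size a I \<rho> \<le> env_size b I \<rho>"
  unfolding env_size_def by (intro mult_le_mono2 add_left_mono sum_mono2) auto

lemma env_size_add:
  "env_size (a + n) I \<rho> = env_size a I \<rho> + 2 ^ snd I * (\<Sum>i<n. \<rho> (a + i))"
  unfolding env_size_def distrib_left[symmetric] by (induction n) (simp_all add: ac_simps)

lemma fpt_bounded_mono: "fpt_bounded a F \<Longrightarrow> a \<le> b \<Longrightarrow> (\<And>I \<rho>. G I \<rho> \<le> F I \<rho>) \<Longrightarrow> fpt_bounded b G"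
  unfolding fpt_bounded_def by (meson env_size_mono order_trans power_mono zero_le)

lemma fpt_bounded_const: "fpt_bounded a (\<lambda>_ _. c)"
proof (rule fpt_boundedI)
  fix I \<rho>
  have "c \<le> 2 ^ c" by (simp add: less_imp_le)
  also have "\<dots> \<le> env_size a I \<rho> ^ c" using env_size_ge_2 by (simp add: power_mono)
  finally show "c \<le> env_size a I \<rho> ^ c" .
qed

lemma fpt_bounded_mult: "fpt_bounded a F \<Longrightarrow> fpt_bounded a G \<Longrightarrow> fpt_bounded a (\<lambda>I \<rho>. F I \<rho> * G I \<rho>)"
  unfolding fpt_bounded_def by (metis mult_le_mono power_add)

lemma fpt_bounded_add:
  assumes "fpt_bounded a F" "fpt_bounded a G"
  shows "fpt_bounded a (\<lambda>I \<rho>. F I \<rho> + G I \<rho>)"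
proof (rule fpt_bounded_mono)
  show "fpt_bounded a (\<lambda>I \<rho>. (F I \<rho> + 1) * (G I \<rho> + 1))"
  proof (intro fpt_bounded_mult)
    have succ: "fpt_bounded a (\<lambda>I \<rho>. H I \<rho> + 1)" if "fpt_bounded a H" for H
    proof -
      from that obtain D where D: "\<forall>I \<rho>. H I \<rho> \<le> env_size a I \<rho> ^ D"
        unfolding fpt_bounded_def by blast
      show ?thesis
      proof (rule fpt_boundedI)
        fix I \<rho>
        have "H I \<rho> + 1 \<le> 2 * env_size a I \<rho> ^ D"
          using D[rule_format, of I \<rho>] env_size_ge_2[of a I \<rho>] one_le_power[of "env_size a I \<rho>" D]
          by linarith
        also have "\<dots> \<le> env_size a I \<rho> ^ Suc D"
          using env_size_ge_2[of a I \<rho>] by simp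
        finally show "H I \<rho> + 1 \<le> env_size a I \<rho> ^ Suc D" .
      qed
    qed
    show "fpt_bounded a (\<lambda>I \<rho>. F I \<rho> + 1)" "fpt_bounded a (\<lambda>I \<rho>. G I \<rho> + 1)"
      by (intro succ assms)+
  qed
qed simp_all

lemma fpt_bounded_power: "fpt_bounded a F \<Longrightarrow> fpt_bounded a (\<lambda>I \<rho>. F I \<rho> ^ n)"
  by (induction n) (auto intro: fpt_bounded_const fpt_bounded_mult)

lemma fpt_bounded_env_size: "fpt_bounded a (env_size a)"
  by (rule fpt_boundedI[where D=1]) simp

lemma fpt_bounded_two_power: "fpt_bounded a (\<lambda>I _. 2 ^ snd I)"
  by (rule fpt_boundedI[where D=1]) (simp add: env_size_def)

lemmas fpt_bounded_intros = fpt_bounded_const fpt_bounded_add fpt_bounded_mult fpt_bounded_power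
  fpt_bounded_env_size fpt_bounded_two_power

lemma fpt_bounded_scratch:
  assumes "fpt_bounded (a + n) F" "fpt_bounded a G"
  obtains T where "fpt_bounded a T"
    "\<And>I \<rho> \<rho>'. (\<And>i. i < a \<Longrightarrow> \<rho>' i = \<rho> i) \<Longrightarrow> (\<And>i. i < n \<Longrightarrow> \<rho>' (a + i) \<le> G I \<rho>) \<Longrightarrow> F I \<rho>' \<le> T I \<rho>"
proof -
  obtain D where D: "\<And>I \<rho>. F I \<rho> \<le> env_size (a + n) I \<rho> ^ D"
    using assms(1) unfolding fpt_bounded_def by blast
  show ?thesis
  proof (rule that)
    show "fpt_bounded a (\<lambda>I \<rho>. (env_size a I \<rho> + 2 ^ snd I * (n * G I \<rho>)) ^ D)"
      by (intro fpt_bounded_intros assms(2))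
    fix I \<rho> \<rho>'
    assume eq: "\<And>i. i < a \<Longrightarrow> \<rho>' i = \<rho> i" and le: "\<And>i. i < n \<Longrightarrow> \<rho>' (a + i) \<le> G I \<rho>"
    have "F I \<rho>' \<le> env_size (a + n) I \<rho>' ^ D" by (rule D)
    also have "env_size (a + n) I \<rho>' \<le> env_size a I \<rho> + 2 ^ snd I * (n * G I \<rho>)"
      unfolding env_size_add
    proof (intro add_mono mult_le_mono2)
      show "env_size a I \<rho>' \<le> env_size a I \<rho>" using eq by (simp add: env_size_def)
      show "(\<Sum>i<n. \<rho>' (a + i)) \<le> n * G I \<rho>"
        using sum_mono[of "{..<n}" "\<lambda>i. \<rho>' (a + i)" "\<lambda>_. G I \<rho>"] le by simp
    qed
    finally show "F I \<rho>' \<le> (env_size a I \<rho> + 2 ^ snd I * (n * G I \<rho>)) ^ D"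
      by (simp add: power_mono)
  qed
qed

definition local_to :: "nat \<Rightarrow> 'a input_fun \<Rightarrow> bool" where
  "local_to a f \<longleftrightarrow> (\<forall>I \<rho> \<rho>'. (\<forall>i<a. \<rho> i = \<rho>' i) \<longrightarrow> f I \<rho> = f I \<rho>')"

lemma local_toI: "(\<And>I \<rho> \<rho>'. (\<And>i. i < a \<Longrightarrow> \<rho> i = \<rho>' i) \<Longrightarrow> f I \<rho> = f I \<rho>') \<Longrightarrow> local_to a f"
  unfolding local_to_def by blast

lemma local_toD: "local_to a f \<Longrightarrow> (\<And>i. i < a \<Longrightarrow> \<rho> i = \<rho>' i) \<Longrightarrow> f I \<rho> = f I \<rho>'"
  unfolding local_to_def by blast

lemma local_to_mono: "local_to a f \<Longrightarrow> a \<le> b \<Longrightarrow> local_to b f"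
  by (simp add: local_to_def)

definition computes :: "prog \<Rightarrow> nat \<Rightarrow> nat input_fun \<Rightarrow> nat input_fun \<Rightarrow> bool" where
  "computes p b f c \<longleftrightarrow> (\<forall>I s. loaded I s \<longrightarrow>
     reaches p s (c I (locals s)) (\<lambda>s'. locals s' b = f I (locals s) \<and> unchanged_below b s s'))"

definition feasible :: "nat \<Rightarrow> nat input_fun \<Rightarrow> bool" where
  "feasible a f \<longleftrightarrow> local_to a f \<and> fpt_bounded a f \<and>
     (\<forall>b\<ge>a. \<exists>p c. fpt_bounded b c \<and> computes p b f c)"

definition feasible_pred :: "nat \<Rightarrow> bool input_fun \<Rightarrow> bool" where
  "feasible_pred a P \<longleftrightarrow> feasible a (\<lambda>I \<rho>. of_bool (P I \<rho>))"

lemma feasible_local: "feasible a f \<Longrightarrow> (\<And>i. i < a \<Longrightarrow> \<rho> i = \<rho>' i) \<Longrightarrow> f I \<rho> = f I \<rho>'"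
  using local_toD[of a f \<rho> \<rho>' I] by (simp add: feasible_def)

lemma feasible_fpt_bounded: "feasible a f \<Longrightarrow> a \<le> b \<Longrightarrow> fpt_bounded b f"
  using fpt_bounded_mono[of a f b f] by (simp add: feasible_def)

lemma computesD: "computes p b f c \<Longrightarrow> loaded I s \<Longrightarrow>
    reaches p s (c I (locals s)) (\<lambda>s'. locals s' b = f I (locals s) \<and> unchanged_below b s s')"
  unfolding computes_def by blast

text \<open>In the following, the local variables from \<open>b\<close> to \<open>b + n - 1\<close> hold values bounded by \<open>G\<close>, and
  \<open>T\<close> bounds the time in terms of the state \<open>s\<close> in which these variables had not been set.\<close>

definition computes_above ::
  "prog \<Rightarrow> nat \<Rightarrow> nat \<Rightarrow> nat input_fun \<Rightarrow> nat input_fun \<Rightarrow> nat input_fun \<Rightarrow> bool" where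
  "computes_above p b n f G T \<longleftrightarrow> (\<forall>I s s'. loaded I s \<longrightarrow> unchanged_below b s s' \<longrightarrow>
     (\<forall>i<n. locals s' (b + i) \<le> G I (locals s)) \<longrightarrow>
     reaches p s' (T I (locals s))
       (\<lambda>s''. locals s'' (b + n) = f I (locals s') \<and> unchanged_below (b + n) s' s''))"

lemma computes_aboveD:
  "computes_above p b n f G T \<Longrightarrow> loaded I s \<Longrightarrow> unchanged_below b s s' \<Longrightarrow>
   (\<And>i. i < n \<Longrightarrow> locals s' (b + i) \<le> G I (locals s)) \<Longrightarrow>
   reaches p s' (T I (locals s))
     (\<lambda>s''. locals s'' (b + n) = f I (locals s') \<and> unchanged_below (b + n) s' s'')"
  unfolding computes_above_def by blast

lemma feasible_computes:
  assumes "feasible a f" "a \<le> b"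
  obtains p c where "fpt_bounded b c" "computes p b f c"
  using assms unfolding feasible_def by blast

lemma feasible_computes_above:
  assumes f: "feasible a f" and a: "a \<le> b + n" and G: "fpt_bounded b G"
  obtains p T where "fpt_bounded b T" "computes_above p b n f G T"
proof -
  obtain p c where c: "fpt_bounded (b + n) c" and p: "computes p (b + n) f c"
    using f a by (rule feasible_computes)
  obtain T where T: "fpt_bounded b T"
    "\<And>I \<rho> \<rho>'. (\<And>i. i < b \<Longrightarrow> \<rho>' i = \<rho> i) \<Longrightarrow> (\<And>i. i < n \<Longrightarrow> \<rho>' (b + i) \<le> G I \<rho>) \<Longrightarrow> c I \<rho>' \<le> T I \<rho>"
    using fpt_bounded_scratch[OF c G] by blast
  have "computes_above p b n f G T"
    unfolding computes_above_def
  proof (intro allI impI)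
    fix I s s'
    assume s: "loaded I s" "unchanged_below b s s'"
      and le: "\<forall>i<n. locals s' (b + i) \<le> G I (locals s)"
    have "c I (locals s') \<le> T I (locals s)"
      using unchanged_below_locals[OF s(2)] le by (intro T(2)) auto
    with computesD[OF p unchanged_below_loaded[OF s(2,1)]]
    show "reaches p s' (T I (locals s))
        (\<lambda>s''. locals s'' (b + n) = f I (locals s') \<and> unchanged_below (b + n) s' s'')"
      by (rule reaches_weaken)
  qed
  then show ?thesis using T(1) that by blast
qed

lemma local_to_unchanged_below:
  "local_to a f \<Longrightarrow> a \<le> b \<Longrightarrow> unchanged_below b s s' \<Longrightarrow> f I (locals s') = f I (locals s)"
  using local_toD[of a f "locals s'" "locals s" I] unchanged_below_locals[of b s s'] by simp

lemma feasible_computes_pair: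
  assumes f: "feasible a f" and g: "feasible a g" and ab: "a \<le> b"
  obtains p T where "fpt_bounded b T" "\<And>I s. loaded I s \<Longrightarrow> reaches p s (T I (locals s))
    (\<lambda>s'. unchanged_below b s s' \<and> locals s' b = f I (locals s) \<and>
      locals s' (b + 1) = g I (locals s))"
proof -
  obtain p T where p: "fpt_bounded b T" "computes p b f T"
    using f ab by (rule feasible_computes)
  obtain q T' where q: "fpt_bounded b T'" "computes_above q b 1 g f T'"
    using g trans_le_add1[OF ab] feasible_fpt_bounded[OF f ab] by (rule feasible_computes_above)
  have "reaches (Seq p q) s (T I (locals s) + T' I (locals s))
      (\<lambda>s'. unchanged_below b s s' \<and> locals s' b = f I (locals s) \<and>
        locals s' (b + 1) = g I (locals s))"
    if s: "loaded I s" for I s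
  proof (rule reaches_Seq[OF computesD[OF p(2) s]])
    fix s1 assume s1: "locals s1 b = f I (locals s) \<and> unchanged_below b s s1"
    have g1: "g I (locals s1) = g I (locals s)"
      using g s1 by (intro local_to_unchanged_below[OF _ ab]) (simp_all add: feasible_def)
    have "reaches q s1 (T' I (locals s))
        (\<lambda>s2. locals s2 (b + 1) = g I (locals s1) \<and> unchanged_below (b + 1) s1 s2)"
      using s1 by (intro computes_aboveD[OF q(2) s]) auto
    then show "reaches q s1 (T' I (locals s))
        (\<lambda>s2. unchanged_below b s s2 \<and> locals s2 b = f I (locals s) \<and>
          locals s2 (b + 1) = g I (locals s))"
      by (rule reaches_weaken)
        (use s1 g1 unchanged_below_trans[of b s s1 "b + 1"] unchanged_below_locals[of "b + 1" s1]
          in auto)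
  qed
  moreover have "fpt_bounded b (\<lambda>I \<rho>. T I \<rho> + T' I \<rho>)" by (intro fpt_bounded_intros p(1) q(1))
  ultimately show ?thesis using that by blast
qed

lemma feasible_mono: "feasible a f \<Longrightarrow> a \<le> b \<Longrightarrow> feasible b f"
  using fpt_bounded_mono[of a f b f] local_to_mono[of a f b] by (auto simp: feasible_def)

lemma feasible_aexp:
  assumes "local_to a f" "fpt_bounded a f" "\<And>I s. loaded I s \<Longrightarrow> aval e s = f I (locals s)"
  shows "feasible a f"
proof -
  have "computes (Assign (local_reg b) e) b f (\<lambda>_ _. 1)" for b
    unfolding computes_def
  proof (intro allI impI)
    fix I s assume "loaded I s"
    then show "reaches (Assign (local_reg b) e) s 1
        (\<lambda>s'. locals s' b = f I (locals s) \<and> unchanged_below b s s')"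
      using assms(3) by (intro reaches_Assign conjI unchanged_below_update)
        (simp_all add: locals_def)
  qed
  then show ?thesis
    unfolding feasible_def using assms(1,2) fpt_bounded_const by blast
qed

named_theorems feasible_intros

lemma feasible_const [feasible_intros]: "feasible a (\<lambda>_ _. c)"
  by (rule feasible_aexp[where e="Const c"]) (auto simp: local_to_def fpt_bounded_const)

lemma feasible_local_var: "i < a \<Longrightarrow> feasible a (\<lambda>_ \<rho>. \<rho> i)"
proof (rule feasible_aexp[where e="Reg (local_reg i)"])
  assume "i < a"
  then have "\<rho> i \<le> (\<Sum>i<a. \<rho> i)" for \<rho> :: "nat \<Rightarrow> nat" by (intro member_le_sum) auto
  then show "fpt_bounded a (\<lambda>_ \<rho>. \<rho> i)"
    by (intro fpt_boundedI[where D=1]) (auto intro!: summand_le_env_size trans_le_add2)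
qed (auto simp: local_to_def locals_def)

lemma feasible_param [feasible_intros]: "feasible a (\<lambda>I _. snd I)"
  by (rule feasible_aexp[where e="Reg 0"])
     (auto simp: local_to_def loaded_def intro!: fpt_boundedI[where D=1] summand_le_env_size)

lemma feasible_length [feasible_intros]: "feasible a (\<lambda>I _. length (fst I))"
  by (rule feasible_aexp[where e="Reg 1"])
     (auto simp: local_to_def loaded_def intro!: fpt_boundedI[where D=1] summand_le_env_size)

lemma feasible_aexp2:
  assumes f: "feasible a f" and g: "feasible a g"
    and e: "\<And>I s b. loaded I s \<Longrightarrow> aval (e b) s = H I (locals s b) (locals s (Suc b))"
    and H: "\<And>I y z. H I y z \<le> y + z + d"
  shows "feasible a (\<lambda>I \<rho>. H I (f I \<rho>) (g I \<rho>))" (is "feasible a ?h")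
  unfolding feasible_def
proof (intro conjI allI impI)
  show "local_to a ?h"
  proof (rule local_toI)
    fix I and \<rho> \<rho>' :: "nat \<Rightarrow> nat" assume "\<And>i. i < a \<Longrightarrow> \<rho> i = \<rho>' i"
    then show "?h I \<rho> = ?h I \<rho>'" using feasible_local[OF f, of \<rho> \<rho>'] feasible_local[OF g, of \<rho> \<rho>']
      by simp
  qed
  have "fpt_bounded a (\<lambda>I \<rho>. f I \<rho> + g I \<rho> + d)"
    by (intro fpt_bounded_intros feasible_fpt_bounded[OF f order_refl]
      feasible_fpt_bounded[OF g order_refl])
  then show "fpt_bounded a ?h"
    using H by (rule fpt_bounded_mono[OF _ order_refl])
  fix b assume ab: "a \<le> b"
  obtain p T where p: "fpt_bounded b T" "\<And>I s. loaded I s \<Longrightarrow> reaches p s (T I (locals s))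
      (\<lambda>s'. unchanged_below b s s' \<and> locals s' b = f I (locals s) \<and>
        locals s' (b + 1) = g I (locals s))"
    using f g ab by (rule feasible_computes_pair) blast
  have "computes (Seq p (Assign (local_reg b) (e b))) b ?h (\<lambda>I \<rho>. T I \<rho> + 1)"
    unfolding computes_def
  proof (intro allI impI reaches_Seq[OF p(2)])
    fix I s s1 assume s: "loaded I s"
      and s1: "unchanged_below b s s1 \<and> locals s1 b = f I (locals s) \<and>
          locals s1 (b + 1) = g I (locals s)"
    then show "reaches (Assign (local_reg b) (e b)) s1 1
        (\<lambda>s'. locals s' b = ?h I (locals s) \<and> unchanged_below b s s')"
      using e[of I s1 b] unchanged_below_loaded[of b s s1 I]
        unchanged_below_trans[OF _ unchanged_below_update[of b b], of b s s1]
      by (intro reaches_Assign) (simp add: locals_def)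
  qed
  moreover have "fpt_bounded b (\<lambda>I \<rho>. T I \<rho> + 1)" by (intro fpt_bounded_intros p(1))
  ultimately show "\<exists>p c. fpt_bounded b c \<and> computes p b ?h c" by blast
qed

lemma feasible_binop:
  assumes "feasible a f" "feasible a g"
    "\<And>b s. aval (e b) s = H (locals s b) (locals s (Suc b))" "\<And>y z. H y z \<le> y + z + d"
  shows "feasible a (\<lambda>I \<rho>. H (f I \<rho>) (g I \<rho>))"
  using feasible_aexp2[of a f g e "\<lambda>_. H" d] assms by simp

definition rec_loop :: "nat \<Rightarrow> prog \<Rightarrow> prog" where
  "rec_loop b r = count_loop (local_reg (b + 2)) (local_reg b)
     (Seq r (Assign (local_reg (b + 1)) (Reg (local_reg (b + 3)))))"

lemma reaches_rec_loop:
  assumes start: "unchanged_below b s s'" "locals s' b = n" "locals s' (b + 1) = z"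
    and body: "\<And>j s'. j < n \<Longrightarrow> unchanged_below b s s' \<Longrightarrow> locals s' b = n \<Longrightarrow>
      locals s' (b + 1) = rec_nat z st j \<Longrightarrow> locals s' (b + 2) = j \<Longrightarrow>
      reaches r s' T (\<lambda>s''. locals s'' (b + 3) = st j (rec_nat z st j) \<and>
        unchanged_below (b + 3) s' s'')"
  shows "reaches (rec_loop b r) s' (n * ((T + 1) + 2) + 2)
    (\<lambda>s''. locals s'' (b + 1) = rec_nat z st n \<and> unchanged_below b s s'')"
proof -
  define Inv where "Inv j s' \<longleftrightarrow> unchanged_below b s s' \<and> locals s' b = n \<and>
    locals s' (b + 1) = rec_nat z st j \<and> locals s' (b + 2) = j" for j s'
  have "reaches (rec_loop b r) s' (n * ((T + 1) + 2) + 2) (Inv n)"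
    unfolding rec_loop_def
  proof (rule reaches_count_loop)
    show "Inv 0 ((fst s')(local_reg (b + 2) := 0), snd s')"
      using start unchanged_below_trans[OF start(1) unchanged_below_update[of b "b + 2"]]
      by (simp add: Inv_def locals_def)
    show "fst s'' (local_reg (b + 2)) = j \<and> fst s'' (local_reg b) = n" if "Inv j s''" for j s''
      using that by (simp add: Inv_def locals_def)
    fix j s1 assume "j < n" and s1: "Inv j s1"
    then have "reaches r s1 T
        (\<lambda>s''. locals s'' (b + 3) = st j (rec_nat z st j) \<and> unchanged_below (b + 3) s1 s'')"
      by (intro body) (simp_all add: Inv_def)
    then show "reaches (Seq r (Assign (local_reg (b + 1)) (Reg (local_reg (b + 3))))) s1 (T + 1)
        (\<lambda>s''. fst s'' (local_reg (b + 2)) = j \<and>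
          Inv (Suc j) ((fst s'')(local_reg (b + 2) := Suc j), snd s''))"
    proof (rule reaches_Seq, intro reaches_Assign)
      fix s2 assume s2: "locals s2 (b + 3) = st j (rec_nat z st j) \<and> unchanged_below (b + 3) s1 s2"
      have "unchanged_below b s ((fst s2)(local_reg (b + 1) := v, local_reg (b + 2) := w), snd s2)"
        for v w
        using s1 s2 by (auto simp: Inv_def unchanged_below_def local_reg_def)
      moreover have "locals s2 b = n" "locals s2 (b + 2) = j"
        using unchanged_below_locals[of "b + 3" s1 s2] s1 s2 by (auto simp: Inv_def)
      ultimately show "fst ((fst s2)(local_reg (b + 1) := aval (Reg (local_reg (b + 3))) s2), snd s2)
          (local_reg (b + 2)) = j \<and>
        Inv (Suc j)
          ((fst ((fst s2)(local_reg (b + 1) := aval (Reg (local_reg (b + 3))) s2), snd s2))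
             (local_reg (b + 2) := Suc j),
           snd ((fst s2)(local_reg (b + 1) := aval (Reg (local_reg (b + 3))) s2), snd s2))"
        using s2 by (simp add: Inv_def locals_def)
    qed
  qed
  then show ?thesis by (rule reaches_weaken) (simp_all add: Inv_def)
qed

lemma computes_above_rec_loop:
  assumes r: "computes_above r b 3 (\<lambda>I \<rho>. st I \<rho> (\<rho> (b + 2)) (\<rho> (b + 1))) (\<lambda>I \<rho>. u I \<rho> + M I \<rho>) T"
    and st: "local_to a st" "a \<le> b"
    and M: "\<And>i. i \<le> u I (locals s) \<Longrightarrow> rec_nat z (st I (locals s)) i \<le> M I (locals s)"
    and s: "loaded I s"
    and s': "unchanged_below b s s'" "locals s' b = u I (locals s)" "locals s' (b + 1) = z"
  shows "reaches (rec_loop b r) s' (u I (locals s) * ((T I (locals s) + 1) + 2) + 2)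
    (\<lambda>s''. locals s'' (b + 1) = rec_nat z (st I (locals s)) (u I (locals s)) \<and>
      unchanged_below b s s'')"
  using s'
proof (rule reaches_rec_loop)
  let ?u = "u I (locals s)" and ?st = "st I (locals s)"
  fix j s1 assume j: "j < ?u" and s1: "unchanged_below b s s1" "locals s1 b = ?u"
    "locals s1 (b + 1) = rec_nat z ?st j" "locals s1 (b + 2) = j"
  have "locals s1 (b + i) \<le> ?u + M I (locals s)" if "i < 3" for i
  proof -
    have "i = 0 \<or> i = 1 \<or> i = 2" using that by linarith
    then show ?thesis using j s1 M[of j] by auto
  qed
  moreover have "st I (locals s1) = ?st" using st s1(1) by (rule local_to_unchanged_below)
  ultimately show "reaches r s1 (T I (locals s))
      (\<lambda>s2. locals s2 (b + 3) = ?st j (rec_nat z ?st j) \<and> unchanged_below (b + 3) s1 s2)"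
    using computes_aboveD[OF r s s1(1)] s1(3,4) by simp
qed

lemma feasible_rec:
  assumes u: "feasible a u" and z: "feasible a z"
    and step: "\<And>v w b. a \<le> b \<Longrightarrow> feasible b v \<Longrightarrow> feasible b w \<Longrightarrow>
        feasible b (\<lambda>I \<rho>. st I \<rho> (v I \<rho>) (w I \<rho>))"
    and M: "fpt_bounded a M" "\<And>I \<rho> i. i \<le> u I \<rho> \<Longrightarrow> rec_nat (z I \<rho>) (st I \<rho>) i \<le> M I \<rho>"
  shows "feasible a (\<lambda>I \<rho>. rec_nat (z I \<rho>) (st I \<rho>) (u I \<rho>))" (is "feasible a ?f")
  unfolding feasible_def
proof (intro conjI allI impI)
  have st: "local_to a st"
    by (intro local_toI ext feasible_local[OF step[OF order_refl feasible_const feasible_const]])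
  then show "local_to a ?f"
    using u z unfolding feasible_def local_to_def by metis
  show "fpt_bounded a ?f" using M by (intro fpt_bounded_mono[OF M(1)]) auto
  fix b assume ab: "a \<le> b"
  obtain p T where p: "fpt_bounded b T" "\<And>I s. loaded I s \<Longrightarrow> reaches p s (T I (locals s))
      (\<lambda>s'. unchanged_below b s s' \<and> locals s' b = u I (locals s) \<and>
        locals s' (b + 1) = z I (locals s))"
    using u z ab by (rule feasible_computes_pair) blast
  have "feasible (b + 3) (\<lambda>I \<rho>. st I \<rho> (\<rho> (b + 2)) (\<rho> (b + 1)))"
    using ab by (intro step feasible_local_var) auto
  moreover have "fpt_bounded b (\<lambda>I \<rho>. u I \<rho> + M I \<rho>)"
    by (intro fpt_bounded_intros feasible_fpt_bounded[OF u ab] fpt_bounded_mono[OF M(1) ab]) simp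
  ultimately obtain r T' where r: "fpt_bounded b T'"
    "computes_above r b 3 (\<lambda>I \<rho>. st I \<rho> (\<rho> (b + 2)) (\<rho> (b + 1))) (\<lambda>I \<rho>. u I \<rho> + M I \<rho>) T'"
    by (rule feasible_computes_above[OF _ order_refl])
  let ?result = "Assign (local_reg b) (Reg (local_reg (b + 1)))"
  have "computes (Seq p (Seq (rec_loop b r) ?result)) b ?f
      (\<lambda>I \<rho>. T I \<rho> + ((u I \<rho> * ((T' I \<rho> + 1) + 2) + 2) + 1))"
    unfolding computes_def
  proof (intro allI impI reaches_Seq[OF p(2)]
    reaches_Seq[OF computes_above_rec_loop[OF r(2) st ab M(2)]]; (elim conjE)?)
    show "reaches ?result s1 1 (\<lambda>s'. locals s' b = ?f I (locals s) \<and> unchanged_below b s s')"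
      if "locals s1 (b + 1) = ?f I (locals s)" "unchanged_below b s s1" for I s s1
      using that unchanged_below_trans[OF _ unchanged_below_update[of b b], of b s s1]
      by (intro reaches_Assign) (simp add: locals_def)
  qed
  moreover have "fpt_bounded b (\<lambda>I \<rho>. T I \<rho> + ((u I \<rho> * ((T' I \<rho> + 1) + 2) + 2) + 1))"
    by (intro fpt_bounded_intros p(1) r(1) feasible_fpt_bounded[OF u ab])
  ultimately show "\<exists>p c. fpt_bounded b c \<and> computes p b ?f c" by blast
qed

lemma feasible_add [feasible_intros]:
  "feasible a f \<Longrightarrow> feasible a g \<Longrightarrow> feasible a (\<lambda>I \<rho>. f I \<rho> + g I \<rho>)"
  by (rule feasible_binop[where H="(+)" and d=0
        and e="\<lambda>b. Plus (Reg (local_reg b)) (Reg (local_reg (Suc b)))"]) (auto simp: locals_def)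

lemma feasible_diff [feasible_intros]:
  "feasible a f \<Longrightarrow> feasible a g \<Longrightarrow> feasible a (\<lambda>I \<rho>. f I \<rho> - g I \<rho>)"
  by (rule feasible_binop[where H="(-)" and d=0
        and e="\<lambda>b. Minus (Reg (local_reg b)) (Reg (local_reg (Suc b)))"]) (auto simp: locals_def)

lemma feasible_pred_less [feasible_intros]:
  "feasible a f \<Longrightarrow> feasible a g \<Longrightarrow> feasible_pred a (\<lambda>I \<rho>. f I \<rho> < g I \<rho>)"
  unfolding feasible_pred_def
  by (rule feasible_binop[where H="\<lambda>x y. of_bool (x < y)" and d=1 and e="\<lambda>b.
        Minus (Const 1) (Minus (Const 1) (Minus (Reg (local_reg (Suc b))) (Reg (local_reg b))))"])
     (auto simp: locals_def)

lemma feasible_pred_const [feasible_intros]: "feasible_pred a (\<lambda>_ _. P)"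
  unfolding feasible_pred_def by (rule feasible_const)

lemma feasible_pred_not [feasible_intros]: "feasible_pred a P \<Longrightarrow> feasible_pred a (\<lambda>I \<rho>. \<not> P I \<rho>)"
proof -
  have "of_bool (\<not> P I \<rho>) = (1 - of_bool (P I \<rho>) :: nat)" for I \<rho> by auto
  then show "feasible_pred a P \<Longrightarrow> ?thesis"
    unfolding feasible_pred_def by (simp only:) (intro feasible_diff feasible_const)
qed

lemma feasible_pred_conj [feasible_intros]:
  "feasible_pred a P \<Longrightarrow> feasible_pred a Q \<Longrightarrow> feasible_pred a (\<lambda>I \<rho>. P I \<rho> \<and> Q I \<rho>)"
proof -
  have "of_bool (P I \<rho> \<and> Q I \<rho>) = (of_bool (P I \<rho>) - (1 - of_bool (Q I \<rho>)) :: nat)" for I \<rho> by auto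
  then show "feasible_pred a P \<Longrightarrow> feasible_pred a Q \<Longrightarrow> ?thesis"
    unfolding feasible_pred_def by (simp only:) (intro feasible_diff feasible_const)
qed

lemma feasible_pred_disj [feasible_intros]:
  "feasible_pred a P \<Longrightarrow> feasible_pred a Q \<Longrightarrow> feasible_pred a (\<lambda>I \<rho>. P I \<rho> \<or> Q I \<rho>)"
  using feasible_pred_not[OF feasible_pred_conj[OF feasible_pred_not feasible_pred_not], of a P Q]
  by simp

lemma feasible_pred_imp [feasible_intros]:
  "feasible_pred a P \<Longrightarrow> feasible_pred a Q \<Longrightarrow> feasible_pred a (\<lambda>I \<rho>. P I \<rho> \<longrightarrow> Q I \<rho>)"
  unfolding imp_conv_disj by (intro feasible_pred_disj feasible_pred_not)

lemma feasible_pred_iff: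
  "feasible_pred a P \<Longrightarrow> feasible_pred a Q \<Longrightarrow> feasible_pred a (\<lambda>I \<rho>. P I \<rho> = Q I \<rho>)"
  unfolding iff_conv_conj_imp by (intro feasible_pred_conj feasible_pred_imp)

lemma feasible_pred_le [feasible_intros]:
  "feasible a f \<Longrightarrow> feasible a g \<Longrightarrow> feasible_pred a (\<lambda>I \<rho>. f I \<rho> \<le> g I \<rho>)"
  unfolding not_less[symmetric] by (intro feasible_pred_not feasible_pred_less)

lemma feasible_pred_eq [feasible_intros]:
  "feasible a f \<Longrightarrow> feasible a g \<Longrightarrow> feasible_pred a (\<lambda>I \<rho>. f I \<rho> = g I \<rho>)"
  unfolding order_eq_iff by (intro feasible_pred_conj feasible_pred_le)

lemma feasible_pred_if:
  "feasible_pred a P \<Longrightarrow> feasible_pred a Q \<Longrightarrow> feasible_pred a Q' \<Longrightarrow>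
   feasible_pred a (\<lambda>I \<rho>. if P I \<rho> then Q I \<rho> else Q' I \<rho>)"
  unfolding if_bool_eq_conj by (intro feasible_intros)

lemma fpt_bounded_sum:
  assumes t: "fpt_bounded (a + 1) (\<lambda>I \<rho>. t I \<rho> (\<rho> a))" and local: "\<And>i. local_to a (\<lambda>I \<rho>. t I \<rho> i)"
    and u: "fpt_bounded a u"
  shows "fpt_bounded a (\<lambda>I \<rho>. \<Sum>i<u I \<rho>. t I \<rho> i)"
proof -
  obtain T where T: "fpt_bounded a T"
    "\<And>I \<rho> \<rho>'. (\<And>i. i < a \<Longrightarrow> \<rho>' i = \<rho> i) \<Longrightarrow> (\<And>i. i < 1 \<Longrightarrow> \<rho>' (a + i) \<le> u I \<rho>) \<Longrightarrow> t I \<rho>' (\<rho>' a) \<le> T I \<rho>"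
    using fpt_bounded_scratch[OF t u] by blast
  have "t I \<rho> i \<le> T I \<rho>" if "i < u I \<rho>" for I \<rho> i
  proof -
    have "t I \<rho> i = t I (\<rho>(a := i)) i" by (rule local_toD[OF local]) simp
    also have "\<dots> \<le> T I \<rho>" using T(2)[of "\<rho>(a := i)" \<rho> I] that by simp
    finally show ?thesis .
  qed
  then have "(\<Sum>i<u I \<rho>. t I \<rho> i) \<le> u I \<rho> * T I \<rho>" for I \<rho>
    using sum_bounded_above[of "{..<u I \<rho>}" "t I \<rho>" "T I \<rho>"] by simp
  then show ?thesis
    by (rule fpt_bounded_mono[OF fpt_bounded_mult[OF u T(1)] order_refl])
qed

lemma feasible_sum:
  assumes u: "feasible a u"
    and t: "\<And>v b. a \<le> b \<Longrightarrow> feasible b v \<Longrightarrow> feasible b (\<lambda>I \<rho>. t I \<rho> (v I \<rho>))"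
  shows "feasible a (\<lambda>I \<rho>. \<Sum>i<u I \<rho>. t I \<rho> i)"
proof -
  have rec: "(\<Sum>i<n. t I \<rho> i) = rec_nat 0 (\<lambda>i r. r + t I \<rho> i) n" for I \<rho> n
    by (induction n) auto
  have "fpt_bounded a (\<lambda>I \<rho>. \<Sum>i<u I \<rho>. t I \<rho> i)"
  proof (rule fpt_bounded_sum)
    have "feasible (a + 1) (\<lambda>I \<rho>. t I \<rho> (\<rho> a))" by (intro t feasible_local_var) auto
    then show "fpt_bounded (a + 1) (\<lambda>I \<rho>. t I \<rho> (\<rho> a))" by (rule feasible_fpt_bounded) simp
    show "local_to a (\<lambda>I \<rho>. t I \<rho> i)" for i
      using t[OF order_refl feasible_const[of a i]] by (simp add: feasible_def)
  qed (rule feasible_fpt_bounded[OF u order_refl])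
  moreover have "(\<Sum>j<i. t I \<rho> j) \<le> (\<Sum>j<u I \<rho>. t I \<rho> j)" if "i \<le> u I \<rho>" for I \<rho> i
    using that by (intro sum_mono2) auto
  ultimately show ?thesis
    unfolding rec by (intro feasible_rec u feasible_const feasible_add t)
qed

lemma feasible_mult [feasible_intros]:
  "feasible a f \<Longrightarrow> feasible a g \<Longrightarrow> feasible a (\<lambda>I \<rho>. f I \<rho> * g I \<rho>)"
  using feasible_sum[of a f "\<lambda>I \<rho> _. g I \<rho>"] feasible_mono[of a g] by simp

lemma feasible_power [feasible_intros]: "feasible a f \<Longrightarrow> feasible a (\<lambda>I \<rho>. f I \<rho> ^ n)"
  by (induction n) (auto intro: feasible_mult feasible_const)

lemma feasible_two_power: "feasible a (\<lambda>I _. 2 ^ snd I)"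
proof -
  have rec: "(2::nat) ^ n = rec_nat 1 (\<lambda>_ r. r + r) n" for n by (induction n) auto
  have "(2::nat) ^ i \<le> 2 ^ snd I" if "i \<le> snd I" for i and I :: input
    using that by (rule power_increasing) simp
  then show ?thesis
    using fpt_bounded_two_power[of a]
    unfolding rec by (intro feasible_rec feasible_param feasible_const feasible_add)
qed

lemma feasible_if [feasible_intros]:
  assumes "feasible_pred a P" "feasible a f" "feasible a g"
  shows "feasible a (\<lambda>I \<rho>. if P I \<rho> then f I \<rho> else g I \<rho>)"
proof -
  have "feasible a (\<lambda>I \<rho>. of_bool (P I \<rho>) * f I \<rho> + (1 - of_bool (P I \<rho>)) * g I \<rho>)"
    using assms unfolding feasible_pred_def by (intro feasible_intros)
  then show ?thesis by (rule back_subst[of "feasible a"]) (auto simp: fun_eq_iff)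
qed

lemma feasible_pred_ex:
  assumes u: "feasible a u"
    and P: "\<And>v b. a \<le> b \<Longrightarrow> feasible b v \<Longrightarrow> feasible_pred b (\<lambda>I \<rho>. P I \<rho> (v I \<rho>))"
  shows "feasible_pred a (\<lambda>I \<rho>. \<exists>i<u I \<rho>. P I \<rho> i)"
proof -
  have pos: "(\<exists>i<n. P I \<rho> i) \<longleftrightarrow> 0 < (\<Sum>i<n. of_bool (P I \<rho> i) :: nat)" for I \<rho> n
    by (simp add: sum_eq_0_iff zero_less_iff_neq_zero) blast
  show ?thesis
    unfolding pos by (intro feasible_pred_less feasible_const feasible_sum u
      P[unfolded feasible_pred_def])
qed

lemma feasible_pred_all:
  assumes u: "feasible a u"
    and P: "\<And>v b. a \<le> b \<Longrightarrow> feasible b v \<Longrightarrow> feasible_pred b (\<lambda>I \<rho>. P I \<rho> (v I \<rho>))"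
  shows "feasible_pred a (\<lambda>I \<rho>. \<forall>i<u I \<rho>. P I \<rho> i)"
  using feasible_pred_not[OF feasible_pred_ex[OF u feasible_pred_not[OF P]]] by simp

lemma feasible_sum_const:
  fixes n :: nat
  shows "(\<And>d. d < n \<Longrightarrow> feasible a (f d)) \<Longrightarrow> feasible a (\<lambda>I \<rho>. \<Sum>d<n. f d I \<rho>)"
  by (induction n) (auto intro: feasible_const feasible_add)

lemma feasible_pred_all_const:
  fixes n :: nat
  shows "(\<And>d. d < n \<Longrightarrow> feasible_pred a (P d)) \<Longrightarrow> feasible_pred a (\<lambda>I \<rho>. \<forall>d<n. P d I \<rho>)"
  by (induction n) (auto simp: All_less_Suc intro: feasible_pred_const feasible_pred_conj)

lemma div_eq_sum: "x div y = (if y = 0 then 0 else \<Sum>i<x. of_bool ((i + 1) * y \<le> x))" for x y :: nat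
proof (cases "y = 0")
  case False
  then have "(i + 1) * y \<le> x \<longleftrightarrow> i < x div y" for i
    by (simp add: less_eq_div_iff_mult_less_eq Suc_le_eq[symmetric] del: mult_Suc)
  moreover have "{..<x} \<inter> {i. i < x div y} = {..<x div y}"
    by (auto intro: less_le_trans[OF _ div_le_dividend])
  ultimately show ?thesis
    using False by (simp add: of_bool_def sum.If_cases del: mult_Suc)
qed simp

lemma feasible_div [feasible_intros]:
  assumes "feasible a f" "feasible a g"
  shows "feasible a (\<lambda>I \<rho>. f I \<rho> div g I \<rho>)"
proof -
  have "feasible_pred b (\<lambda>I \<rho>. (v I \<rho> + 1) * g I \<rho> \<le> f I \<rho>)" if "a \<le> b" "feasible b v" for b v
    using that assms by (intro feasible_intros) (auto intro: feasible_mono)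
  then show ?thesis
    unfolding div_eq_sum using assms
    by (intro feasible_intros feasible_sum) (simp_all add: feasible_pred_def)
qed

lemma feasible_mod [feasible_intros]:
  "feasible a f \<Longrightarrow> feasible a g \<Longrightarrow> feasible a (\<lambda>I \<rho>. f I \<rho> mod g I \<rho>)"
  unfolding minus_div_mult_eq_mod[symmetric] by (intro feasible_intros)

lemma feasible_pred_input_bit:
  assumes f: "feasible a f"
  shows "feasible_pred a (\<lambda>I \<rho>. f I \<rho> < length (fst I) \<and> fst I ! f I \<rho>)"
proof -
  \<comment> \<open>The address is cut off at the length of the input, beyond which the array may have been
    overwritten.\<close>
  have "feasible a (\<lambda>I \<rho>. string_cells (fst I) (f I \<rho>))"
    by (rule feasible_aexp2[OF f f, where d=2 and H="\<lambda>I y _. string_cells (fst I) y" and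
          e="\<lambda>b. Cell (Minus (Reg (local_reg b)) (Minus (Reg (local_reg b)) (Reg 1)))"])
       (auto simp: loaded_def string_cells_def locals_def)
  then have "feasible_pred a (\<lambda>I \<rho>. string_cells (fst I) (f I \<rho>) = 2)"
    by (intro feasible_intros)
  then show ?thesis by (rule back_subst[of "feasible_pred a"])
    (auto simp: string_cells_def fun_eq_iff)
qed

subsection \<open>Output strings\<close>

definition put :: "nat \<Rightarrow> bool list \<Rightarrow> (nat \<Rightarrow> nat) \<Rightarrow> nat \<Rightarrow> nat" where
  "put p w A j = (if p \<le> j \<and> j < p + length w then (if w ! (j - p) then 2 else 1) else A j)"

lemma put_Nil: "put p [] A = A" by (auto simp: put_def)

lemma put_append: "put (p + length v) w (put p v A) = put p (v @ w) A"
  by (auto simp: put_def nth_append fun_eq_iff)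

definition appended :: "nat \<Rightarrow> bool list \<Rightarrow> state \<Rightarrow> state \<Rightarrow> bool" where
  "appended b w s s' \<longleftrightarrow> fst s' 2 = fst s 2 + length w \<and>
     (\<forall>i<local_reg b. i \<noteq> 2 \<longrightarrow> fst s' i = fst s i) \<and> snd s' = put (fst s 2) w (snd s)"

definition output_ready :: "input \<Rightarrow> state \<Rightarrow> bool" where
  "output_ready I s \<longleftrightarrow> loaded I s \<and> length (fst I) < fst s 2"

lemma appended_Nil: "unchanged_below b s s' \<Longrightarrow> appended b [] s s'"
  by (simp add: appended_def unchanged_below_def put_Nil)

lemma appended_append:
  "appended b v s s' \<Longrightarrow> appended c w s' s'' \<Longrightarrow> b \<le> c \<Longrightarrow> appended b (v @ w) s s''"
  by (auto simp: appended_def put_append local_reg_def)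

lemma appended_update:
  "appended b w s s' \<Longrightarrow> b \<le> i \<Longrightarrow> appended b w s ((fst s')(local_reg i := v), snd s')"
  by (auto simp: appended_def local_reg_def)

lemma appended_locals: "appended b w s s' \<Longrightarrow> i < b \<Longrightarrow> locals s' i = locals s i"
  by (simp add: appended_def locals_def)

lemma appended_output_ready: "appended b w s s' \<Longrightarrow> output_ready I s \<Longrightarrow> output_ready I s'"
  by (auto simp: appended_def output_ready_def loaded_def put_def local_reg_def)

definition writes :: "prog \<Rightarrow> nat \<Rightarrow> bool list input_fun \<Rightarrow> nat input_fun \<Rightarrow> bool" where
  "writes p b w c \<longleftrightarrow> (\<forall>I s. output_ready I s \<longrightarrow>
     reaches p s (c I (locals s)) (appended b (w I (locals s)) s))"

definition emits :: "nat \<Rightarrow> bool list input_fun \<Rightarrow> bool" where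
  "emits a w \<longleftrightarrow> local_to a w \<and> fpt_bounded a (\<lambda>I \<rho>. length (w I \<rho>)) \<and>
     (\<forall>b\<ge>a. \<exists>p c. fpt_bounded b c \<and> writes p b w c)"

lemma emits_local: "emits a w \<Longrightarrow> (\<And>i. i < a \<Longrightarrow> \<rho> i = \<rho>' i) \<Longrightarrow> w I \<rho> = w I \<rho>'"
  using local_toD[of a w \<rho> \<rho>' I] by (simp add: emits_def)

lemma emits_fpt_bounded: "emits a w \<Longrightarrow> fpt_bounded a (\<lambda>I \<rho>. length (w I \<rho>))"
  by (simp add: emits_def)

text \<open>As for \<open>computes_above\<close>, the time is measured by the values \<open>\<rho>\<close> of the variables below \<open>b\<close>.\<close>

definition writes_above ::
  "prog \<Rightarrow> nat \<Rightarrow> nat \<Rightarrow> bool list input_fun \<Rightarrow> nat input_fun \<Rightarrow> nat input_fun \<Rightarrow> bool" where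
  "writes_above p b n w G T \<longleftrightarrow> (\<forall>I \<rho> s. output_ready I s \<longrightarrow> (\<forall>i<b. locals s i = \<rho> i) \<longrightarrow>
     (\<forall>i<n. locals s (b + i) \<le> G I \<rho>) \<longrightarrow> reaches p s (T I \<rho>) (appended (b + n) (w I (locals s)) s))"

lemma writes_aboveD:
  "writes_above p b n w G T \<Longrightarrow> output_ready I s \<Longrightarrow> (\<And>i. i < b \<Longrightarrow> locals s i = \<rho> i) \<Longrightarrow>
   (\<And>i. i < n \<Longrightarrow> locals s (b + i) \<le> G I \<rho>) \<Longrightarrow>
     reaches p s (T I \<rho>) (appended (b + n) (w I (locals s)) s)"
  unfolding writes_above_def by blast

lemma emits_writes:
  assumes "emits a w" "a \<le> b"
  obtains p c where "fpt_bounded b c" "writes p b w c"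
  using assms unfolding emits_def by blast

lemma emits_writes_above:
  assumes w: "emits a w" and a: "a \<le> b + n" and G: "fpt_bounded b G"
  obtains p T where "fpt_bounded b T" "writes_above p b n w G T"
proof -
  obtain p c where c: "fpt_bounded (b + n) c" and p: "writes p (b + n) w c"
    using w a by (rule emits_writes)
  obtain T where T: "fpt_bounded b T"
    "\<And>I \<rho> \<rho>'. (\<And>i. i < b \<Longrightarrow> \<rho>' i = \<rho> i) \<Longrightarrow> (\<And>i. i < n \<Longrightarrow> \<rho>' (b + i) \<le> G I \<rho>) \<Longrightarrow> c I \<rho>' \<le> T I \<rho>"
    using fpt_bounded_scratch[OF c G] by blast
  have "writes_above p b n w G T"
    unfolding writes_above_def
  proof (intro allI impI)
    fix I \<rho> s
    assume s: "output_ready I s" "\<forall>i<b. locals s i = \<rho> i" "\<forall>i<n. locals s (b + i) \<le> G I \<rho>"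
    then have "c I (locals s) \<le> T I \<rho>" by (intro T(2)) auto
    moreover have "reaches p s (c I (locals s)) (appended (b + n) (w I (locals s)) s)"
      using p s(1) unfolding writes_def by blast
    ultimately show "reaches p s (T I \<rho>) (appended (b + n) (w I (locals s)) s)"
      by (blast intro: reaches_weaken)
  qed
  then show ?thesis using T(1) that by blast
qed

lemma emits_writes_after:
  assumes w: "emits a w" and ab: "a \<le> b"
  obtains p T where "fpt_bounded b T" "\<And>I v s s'. output_ready I s \<Longrightarrow> appended b v s s' \<Longrightarrow>
    reaches p s' (T I (locals s)) (appended b (v @ w I (locals s)) s)"
proof -
  obtain p T where p: "fpt_bounded b T" "writes_above p b 0 w (\<lambda>_ _. 0) T"
    using w trans_le_add1[OF ab] fpt_bounded_const by (rule emits_writes_above)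
  have "reaches p s' (T I (locals s)) (appended b (v @ w I (locals s)) s)"
    if s: "output_ready I s" and s': "appended b v s s'" for I v s s'
  proof -
    have "reaches p s' (T I (locals s)) (appended (b + 0) (w I (locals s')) s')"
      using s s' by (intro writes_aboveD[OF p(2)])
        (auto dest: appended_output_ready appended_locals)
    moreover have "w I (locals s') = w I (locals s)"
      using appended_locals[OF s'] ab by (intro emits_local[OF w]) auto
    ultimately show ?thesis using appended_append[OF s'] by (auto intro: reaches_weaken)
  qed
  then show ?thesis using p(1) that by blast
qed

lemma emits_Nil: "emits a (\<lambda>_ _. [])"
proof -
  have "writes (Assign 0 (Reg 0)) b (\<lambda>_ _. []) (\<lambda>_ _. 1)" for b
    unfolding writes_def by (intro allI impI reaches_Assign appended_Nil)
      (simp add: unchanged_below_def)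
  then show ?thesis
    unfolding emits_def local_to_def using fpt_bounded_const by (auto intro!: exI)
qed

lemma emits_single: "emits a (\<lambda>_ _. [y])"
proof -
  let ?store = "Store (Reg 2) (Const (if y then 2 else 1))"
    and ?next = "Assign 2 (Plus (Reg 2) (Const 1))"
  have "writes (Seq ?store ?next) b (\<lambda>_ _. [y]) (\<lambda>_ _. 1 + 1)" for b
    unfolding writes_def
  proof (intro allI impI reaches_Seq)
    fix I s
    show "reaches ?store s 1 (\<lambda>s'. s' = (fst s, (snd s)(fst s 2 := if y then 2 else 1)))"
      by (intro reaches_Store) simp
    fix s' assume "s' = (fst s, (snd s)(fst s 2 := if y then 2 else 1))"
    then show "reaches ?next s' 1 (appended b [y] s)"
      by (intro reaches_Assign) (auto simp: appended_def put_def fun_eq_iff)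
  qed
  moreover have "fpt_bounded a (\<lambda>_ _. length [y])" for a by (rule fpt_bounded_const)
  ultimately show ?thesis
    unfolding emits_def local_to_def using fpt_bounded_const by blast
qed

lemma emits_append:
  assumes v: "emits a v" and w: "emits a w"
  shows "emits a (\<lambda>I \<rho>. v I \<rho> @ w I \<rho>)"
  unfolding emits_def
proof (intro conjI allI impI)
  show "local_to a (\<lambda>I \<rho>. v I \<rho> @ w I \<rho>)"
  proof (rule local_toI)
    fix I and \<rho> \<rho>' :: "nat \<Rightarrow> nat" assume "\<And>i. i < a \<Longrightarrow> \<rho> i = \<rho>' i"
    then show "v I \<rho> @ w I \<rho> = v I \<rho>' @ w I \<rho>'"
      using emits_local[OF v, of \<rho> \<rho>'] emits_local[OF w, of \<rho> \<rho>'] by simp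
  qed
  show "fpt_bounded a (\<lambda>I \<rho>. length (v I \<rho> @ w I \<rho>))"
    unfolding length_append by (intro fpt_bounded_intros emits_fpt_bounded v w)
  fix b assume ab: "a \<le> b"
  obtain p c where p: "fpt_bounded b c" "writes p b v c"
    using v ab by (rule emits_writes)
  obtain q T where q: "fpt_bounded b T" "\<And>I v s s'. output_ready I s \<Longrightarrow> appended b v s s' \<Longrightarrow>
      reaches q s' (T I (locals s)) (appended b (v @ w I (locals s)) s)"
    using w ab by (rule emits_writes_after) blast
  have "writes (Seq p q) b (\<lambda>I \<rho>. v I \<rho> @ w I \<rho>) (\<lambda>I \<rho>. c I \<rho> + T I \<rho>)"
    using p(2) q(2) unfolding writes_def by (blast intro: reaches_Seq)
  moreover have "fpt_bounded b (\<lambda>I \<rho>. c I \<rho> + T I \<rho>)" by (intro fpt_bounded_intros p(1) q(1))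
  ultimately show "\<exists>p c. fpt_bounded b c \<and> writes p b (\<lambda>I \<rho>. v I \<rho> @ w I \<rho>) c" by blast
qed

lemma emits_if:
  assumes P: "feasible_pred a P" and v: "emits a v" and w: "emits a w"
  shows "emits a (\<lambda>I \<rho>. if P I \<rho> then v I \<rho> else w I \<rho>)" (is "emits a ?w")
  unfolding emits_def
proof (intro conjI allI impI)
  note P = P[unfolded feasible_pred_def]
  show "local_to a ?w"
  proof (rule local_toI)
    fix I and \<rho> \<rho>' :: "nat \<Rightarrow> nat" assume "\<And>i. i < a \<Longrightarrow> \<rho> i = \<rho>' i"
    then show "?w I \<rho> = ?w I \<rho>'"
      using emits_local[OF v, of \<rho> \<rho>'] emits_local[OF w, of \<rho> \<rho>'] feasible_local[OF P, of \<rho> \<rho>' I]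
      by (simp add: of_bool_eq_iff)
  qed
  have "fpt_bounded a (\<lambda>I \<rho>. length (v I \<rho>) + length (w I \<rho>))"
    by (intro fpt_bounded_intros emits_fpt_bounded v w)
  then show "fpt_bounded a (\<lambda>I \<rho>. length (?w I \<rho>))"
    by (rule fpt_bounded_mono) auto
  fix b assume ab: "a \<le> b"
  obtain r c where r: "fpt_bounded b c" "computes r b (\<lambda>I \<rho>. of_bool (P I \<rho>)) c"
    using P ab by (rule feasible_computes)
  obtain p T where p: "fpt_bounded b T" "\<And>I u s s'. output_ready I s \<Longrightarrow> appended b u s s' \<Longrightarrow>
      reaches p s' (T I (locals s)) (appended b (u @ v I (locals s)) s)"
    using v ab by (rule emits_writes_after) blast
  obtain q T' where q: "fpt_bounded b T'" "\<And>I u s s'. output_ready I s \<Longrightarrow> appended b u s s' \<Longrightarrow>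
      reaches q s' (T' I (locals s)) (appended b (u @ w I (locals s)) s)"
    using w ab by (rule emits_writes_after) blast
  have "writes (Seq r (If (Reg (local_reg b)) p q)) b ?w (\<lambda>I \<rho>. c I \<rho> + ((T I \<rho> + T' I \<rho>) + 1))"
    unfolding writes_def
  proof (intro allI impI, rule reaches_Seq, rule computesD[OF r(2)])
    fix I s assume s: "output_ready I s"
    then show "loaded I s" by (simp add: output_ready_def)
    fix s1 assume s1: "locals s1 b = of_bool (P I (locals s)) \<and> unchanged_below b s s1"
    then have "appended b [] s s1" by (intro appended_Nil) simp
    from p(2)[OF s this] q(2)[OF s this]
    show "reaches (If (Reg (local_reg b)) p q) s1 (T I (locals s) + T' I (locals s) + 1)
        (appended b (?w I (locals s)) s)"
      using s1 by (intro reaches_If) (auto simp: locals_def elim!: reaches_weaken split: if_splits)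
  qed
  moreover have "fpt_bounded b (\<lambda>I \<rho>. c I \<rho> + ((T I \<rho> + T' I \<rho>) + 1))"
    by (intro fpt_bounded_intros r(1) p(1) q(1))
  ultimately show "\<exists>p c. fpt_bounded b c \<and> writes p b ?w c" by blast
qed

lemma reaches_write_loop:
  assumes start: "unchanged_below b s s'" "locals s' b = n"
    and body: "\<And>j v s'. j < n \<Longrightarrow> appended b v s s' \<Longrightarrow> locals s' b = n \<Longrightarrow> locals s' (b + 1) = j \<Longrightarrow>
      reaches p s' T (appended (b + 2) (w j) s')"
  shows "reaches (count_loop (local_reg (b + 1)) (local_reg b) p) s' (n * (T + 2) + 2)
    (appended b (concat (map w [0..<n])) s)"
proof -
  define Inv where "Inv j s' \<longleftrightarrow>
      appended b (concat (map w [0..<j])) s s' \<and> locals s' b = n \<and> locals s' (b + 1) = j"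
    for j s'
  have "reaches (count_loop (local_reg (b + 1)) (local_reg b) p) s' (n * (T + 2) + 2) (Inv n)"
  proof (rule reaches_count_loop)
    show "Inv 0 ((fst s')(local_reg (b + 1) := 0), snd s')"
      using start appended_update[OF appended_Nil, of b s s' "b + 1"]
      by (simp add: Inv_def locals_def)
    show "fst s1 (local_reg (b + 1)) = j \<and> fst s1 (local_reg b) = n" if "Inv j s1" for j s1
      using that by (simp add: Inv_def locals_def)
    fix j s1 assume j: "j < n" "Inv j s1"
    then have "reaches p s1 T (appended (b + 2) (w j) s1)"
      using body[OF j(1)] unfolding Inv_def by blast
    then show "reaches p s1 T
        (\<lambda>s2. fst s2 (local_reg (b + 1)) = j \<and>
          Inv (Suc j) ((fst s2)(local_reg (b + 1) := Suc j), snd s2))"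
    proof (rule reaches_weaken[OF _ order_refl])
      fix s2 assume s2: "appended (b + 2) (w j) s1 s2"
      then have "appended b (concat (map w [0..<Suc j])) s s2"
        using j(2) appended_append[of b _ s s1 "b + 2"] by (simp add: Inv_def)
      then have "appended b (concat (map w [0..<Suc j])) s
          ((fst s2)(local_reg (b + 1) := Suc j), snd s2)"
        by (rule appended_update) simp
      then show "fst s2 (local_reg (b + 1)) = j \<and>
          Inv (Suc j) ((fst s2)(local_reg (b + 1) := Suc j), snd s2)"
        using j(2) appended_locals[OF s2, of b] appended_locals[OF s2, of "b + 1"]
        by (simp add: Inv_def locals_def)
    qed
  qed
  then show ?thesis by (rule reaches_weaken) (simp_all add: Inv_def)
qed

lemma writes_above_loop:
  assumes q: "writes_above q b 2 (\<lambda>I \<rho>. w I \<rho> (\<rho> (b + 1))) u T"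
    and w: "local_to a w" "a \<le> b" and s: "output_ready I s"
    and s': "unchanged_below b s s'" "locals s' b = u I (locals s)"
  shows "reaches (count_loop (local_reg (b + 1)) (local_reg b) q) s' (u I (locals s) * (T I (locals s) + 2) + 2)
    (appended b (concat (map (w I (locals s)) [0..<u I (locals s)])) s)"
  using s'
proof (rule reaches_write_loop)
  fix j v s1 assume j: "j < u I (locals s)" and app: "appended b v s s1"
    and s1: "locals s1 b = u I (locals s)" "locals s1 (b + 1) = j"
  have "locals s1 (b + i) \<le> u I (locals s)" if "i < 2" for i
    using that j s1 by (cases i) auto
  moreover have "w I (locals s1) = w I (locals s)"
    using w(2) appended_locals[OF app] by (intro local_toD[OF w(1)]) auto
  ultimately show "reaches q s1 (T I (locals s)) (appended (b + 2) (w I (locals s) j) s1)"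
    using writes_aboveD[OF q appended_output_ready[OF app s] appended_locals[OF app]] s1(2) by simp
qed

lemma emits_for:
  assumes u: "feasible a u"
    and w: "\<And>v b. a \<le> b \<Longrightarrow> feasible b v \<Longrightarrow> emits b (\<lambda>I \<rho>. w I \<rho> (v I \<rho>))"
  shows "emits a (\<lambda>I \<rho>. concat (map (w I \<rho>) [0..<u I \<rho>]))" (is "emits a ?w")
  unfolding emits_def
proof (intro conjI allI impI)
  have w_local: "local_to a w"
    by (intro local_toI ext emits_local[OF w[OF order_refl feasible_const]])
  then show "local_to a ?w"
    using u unfolding feasible_def local_to_def by metis
  have "fpt_bounded a (\<lambda>I \<rho>. \<Sum>i<u I \<rho>. length (w I \<rho> i))"
  proof (rule fpt_bounded_sum)
    show "fpt_bounded (a + 1) (\<lambda>I \<rho>. length (w I \<rho> (\<rho> a)))"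
      by (intro emits_fpt_bounded w feasible_local_var) auto
    show "local_to a (\<lambda>I \<rho>. length (w I \<rho> i))" for i
      using w_local unfolding local_to_def by metis
  qed (rule feasible_fpt_bounded[OF u order_refl])
  then show "fpt_bounded a (\<lambda>I \<rho>. length (?w I \<rho>))"
    by (simp add: length_concat comp_def interv_sum_list_conv_sum_set_nat atLeast0LessThan)
  fix b assume ab: "a \<le> b"
  obtain p c where p: "fpt_bounded b c" "computes p b u c"
    using u ab by (rule feasible_computes)
  have "emits (b + 2) (\<lambda>I \<rho>. w I \<rho> (\<rho> (b + 1)))"
    using ab by (intro w feasible_local_var) auto
  then obtain q T where q: "fpt_bounded b T" "writes_above q b 2 (\<lambda>I \<rho>. w I \<rho> (\<rho> (b + 1))) u T"
    using order_refl feasible_fpt_bounded[OF u ab] by (rule emits_writes_above)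
  have "writes (Seq p (count_loop (local_reg (b + 1)) (local_reg b) q)) b ?w
      (\<lambda>I \<rho>. c I \<rho> + (u I \<rho> * (T I \<rho> + 2) + 2))"
    unfolding writes_def
  proof (intro allI impI reaches_Seq[OF computesD[OF p(2)]] writes_above_loop[OF q(2) w_local ab])
    show "loaded I s" if "output_ready I s" for I s using that by (simp add: output_ready_def)
  qed auto
  moreover have "fpt_bounded b (\<lambda>I \<rho>. c I \<rho> + (u I \<rho> * (T I \<rho> + 2) + 2))"
    by (intro fpt_bounded_intros p(1) q(1) feasible_fpt_bounded[OF u ab])
  ultimately show "\<exists>p c. fpt_bounded b c \<and> writes p b ?w c" by blast
qed

lemma emits_concat_const:
  "(\<And>d. d < n \<Longrightarrow> emits a (w d)) \<Longrightarrow> emits a (\<lambda>I \<rho>. concat (map (\<lambda>d. w d I \<rho>) [0..<n]))"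
  by (induction n) (auto intro: emits_Nil emits_append)

lemma emits_encode_nat:
  assumes "feasible a u"
  shows "emits a (\<lambda>I \<rho>. encode_nat (u I \<rho>))"
proof -
  have "encode_nat n = concat (map (\<lambda>_. [True]) [0..<n]) @ [False]" for n
    by (simp add: encode_nat_def map_replicate_const flip: concat_replicate_trivial)
  then show ?thesis
    by (simp only:) (intro emits_append emits_for assms emits_single)
qed

definition measure_input :: prog where
  "measure_input = Seq (Assign 1 (Const 0)) (While (Cell (Reg 1)) (Assign 1 (Plus (Reg 1) (Const 1))))"

lemma reaches_measure_input:
  assumes "\<forall>i\<le>length x. snd s i = string_cells x i"
  shows "reaches measure_input s (length x * 2 + 2) (\<lambda>s'. s' = ((fst s)(1 := length x), snd s))"
proof -
  let ?scan = "While (Cell (Reg 1)) (Assign 1 (Plus (Reg 1) (Const 1)))"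
  define Inv where "Inv i s' \<longleftrightarrow> s' = ((fst s)(1 := i), snd s)" for i and s' :: state
  have "reaches ?scan s' (length x * (1 + 1) + 1) (Inv (length x))" if "Inv 0 s'" for s'
  proof (rule reaches_While)
    show "reaches (Assign 1 (Plus (Reg 1) (Const 1))) s1 1 (Inv (Suc i))" if "Inv i s1" for i s1
      using that by (intro reaches_Assign) (simp add: Inv_def)
  qed (use assms that in \<open>auto simp: Inv_def string_cells_def\<close>)
  moreover have "reaches (Assign 1 (Const 0)) s 1 (Inv 0)"
    by (rule reaches_Assign) (simp add: Inv_def)
  ultimately have "reaches measure_input s (1 + (length x * (1 + 1) + 1)) (Inv (length x))"
    unfolding measure_input_def by (rule reaches_Seq[rotated])
  then show ?thesis by (rule reaches_weaken) (simp_all add: Inv_def)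
qed

definition move_output :: prog where
  "move_output = Seq (Assign 4 (Minus (Reg 2) (Plus (Reg 1) (Const 1))))
     (Seq (count_loop 3 4 (Store (Reg 3) (Cell (Plus (Plus (Reg 1) (Const 1)) (Reg 3))))) (Store (Reg 3) (Const 0)))"

lemma reaches_move_output:
  assumes start: "fst s 2 = fst s 1 + 1 + length w"
    and written: "\<And>i. i < length w \<Longrightarrow> snd s (fst s 1 + 1 + i) = string_cells w i"
  shows "reaches move_output s (length w * 3 + 4) (\<lambda>s'. outputs s' w (fst s 0))"
proof -
  define l where "l = fst s 1"
  let ?copy = "Store (Reg 3) (Cell (Plus (Plus (Reg 1) (Const 1)) (Reg 3)))"
  define Inv where "Inv j s' \<longleftrightarrow>
      fst s' 0 = fst s 0 \<and> fst s' 1 = l \<and> fst s' 4 = length w \<and> fst s' 3 = j \<and>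
    (\<forall>i<j. snd s' i = string_cells w i) \<and>
      (\<forall>i. j \<le> i \<longrightarrow> i < length w \<longrightarrow> snd s' (l + 1 + i) = string_cells w i)"
    for j and s' :: state
  let ?init = "\<lambda>s'. s' = ((fst s)(4 := length w), snd s)"
  have loop: "reaches (count_loop 3 4 ?copy) s' (length w * (1 + 2) + 2) (Inv (length w))"
    if "?init s'" for s'
  proof (rule reaches_count_loop)
    show "Inv 0 ((fst s')(3 := 0), snd s')" using that written by (auto simp: Inv_def l_def)
    show "fst s1 3 = j \<and> fst s1 4 = length w" if "Inv j s1" for j s1 using that
      by (simp add: Inv_def)
    show "reaches ?copy s1 1 (\<lambda>s2. fst s2 3 = j \<and> Inv (Suc j) ((fst s2)(3 := Suc j), snd s2))"
      if "j < length w" "Inv j s1" for j s1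
      using that by (intro reaches_Store) (auto simp: Inv_def less_Suc_eq)
  qed
  have "reaches move_output s (1 + ((length w * (1 + 2) + 2) + 1)) (\<lambda>s'. outputs s' w (fst s 0))"
    unfolding move_output_def
  proof (intro reaches_Seq[OF _ reaches_Seq[OF loop]])
    show "reaches (Assign 4 (Minus (Reg 2) (Plus (Reg 1) (Const 1)))) s 1 ?init"
      using start by (intro reaches_Assign) simp
    show "reaches (Store (Reg 3) (Const 0)) s1 1 (\<lambda>s'. outputs s' w (fst s 0))"
      if "Inv (length w) s1" for s1
      using that by (intro reaches_Store) (auto simp: Inv_def outputs_def string_cells_def)
  qed
  then show ?thesis by (rule reaches_weaken) simp_all
qed

definition transducer :: "prog \<Rightarrow> prog \<Rightarrow> prog" where
  "transducer p q = Seq measure_input (Seq (Assign 2 (Plus (Reg 1) (Const 1))) (Seq p (Seq q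
     (Seq (Assign 0 (Reg 3)) move_output))))"

lemma reaches_transducer:
  assumes p: "\<And>s. output_ready (x, k) s \<Longrightarrow> reaches p s m (appended 0 w s)"
    and q: "\<And>s. loaded (x, k) s \<Longrightarrow> reaches q s n (\<lambda>s'. locals s' 0 = k' \<and> unchanged_below 0 s s')"
    and s: "outputs s x k"
  shows "reaches (transducer p q) s ((length x * 2 + 2) + (1 + (m + (n + (1 + (length w * 3 + 4))))))
    (\<lambda>s'. outputs s' w k')"
proof -
  define emitted where "emitted s' \<longleftrightarrow> loaded (x, k) s' \<and> fst s' 2 = length x + 1 + length w \<and>
    (\<forall>i<length w. snd s' (length x + 1 + i) = string_cells w i)" for s'
  have measure: "reaches measure_input s (length x * 2 + 2)
      (\<lambda>s1. s1 = ((fst s)(1 := length x), snd s))"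
    using s reaches_measure_input[of x s] by (simp add: outputs_def)
  have init: "reaches (Assign 2 (Plus (Reg 1) (Const 1))) s1 1
      (\<lambda>s2. output_ready (x, k) s2 \<and> fst s2 2 = length x + 1)"
    if "s1 = ((fst s)(1 := length x), snd s)" for s1
    using that s by (intro reaches_Assign) (auto simp: output_ready_def loaded_def outputs_def)
  have emit: "reaches p s2 m emitted" if s2: "output_ready (x, k) s2 \<and> fst s2 2 = length x + 1"
    for s2
  proof (rule reaches_weaken[OF p order_refl])
    show "emitted s3" if "appended 0 w s2 s3" for s3
      using that s2 appended_output_ready[OF that, of "(x, k)"]
      by (simp add: emitted_def output_ready_def appended_def put_def string_cells_def)
  qed (use s2 in simp)
  have compute: "reaches q s3 n (\<lambda>s4. emitted s4 \<and> fst s4 3 = k')" if s3: "emitted s3" for s3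
  proof (rule reaches_weaken[OF q order_refl])
    show "emitted s4 \<and> fst s4 3 = k'" if "locals s4 0 = k' \<and> unchanged_below 0 s3 s4" for s4
      using that s3 unchanged_below_loaded[of 0 s3 s4 "(x, k)"]
      by (simp add: emitted_def unchanged_below_def locals_def local_reg_def)
  qed (use s3 in \<open>simp add: emitted_def\<close>)
  have finish: "reaches (Seq (Assign 0 (Reg 3)) move_output) s4 (1 + (length w * 3 + 4))
      (\<lambda>s'. outputs s' w k')"
    if s4: "emitted s4 \<and> fst s4 3 = k'" for s4
  proof (rule reaches_Seq)
    show "reaches (Assign 0 (Reg 3)) s4 1 (\<lambda>s5. s5 = ((fst s4)(0 := k'), snd s4))"
      using s4 by (intro reaches_Assign) simp
    show "reaches move_output s5 (length w * 3 + 4) (\<lambda>s'. outputs s' w k')"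
      if "s5 = ((fst s4)(0 := k'), snd s4)" for s5
      using reaches_move_output[of s5 w] that s4 by (simp add: emitted_def loaded_def)
  qed
  show ?thesis
    unfolding transducer_def
    by (intro reaches_Seq[OF measure] reaches_Seq[OF init] reaches_Seq[OF emit]
      reaches_Seq[OF compute] finish)
qed

lemma emits_transducer:
  assumes w: "emits 0 (\<lambda>I _. w I)" and K: "feasible 0 (\<lambda>I _. K I)"
  obtains p D where "\<And>x k s. outputs s x k \<Longrightarrow>
    reaches p s ((2 ^ k * (k + 2) * (length x + 1)) ^ D) (\<lambda>s'. outputs s' (w (x, k)) (K (x, k)))"
proof -
  obtain p c where p: "fpt_bounded 0 c" "writes p 0 (\<lambda>I _. w I) c"
    using w order_refl by (rule emits_writes)
  obtain q d where q: "fpt_bounded 0 d" "computes q 0 (\<lambda>I _. K I) d"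
    using K order_refl by (rule feasible_computes)
  define N where "N I = env_size 0 I (\<lambda>_. 0)" for I
  have N: "env_size 0 I \<rho> = N I" for I \<rho> by (simp add: N_def env_size_def)
  obtain B where c: "c I \<rho> \<le> N I ^ B" for I \<rho>
    using p(1) unfolding fpt_bounded_def N by blast
  obtain B' where d: "d I \<rho> \<le> N I ^ B'" for I \<rho>
    using q(1) unfolding fpt_bounded_def N by blast
  let ?time = "\<lambda>I. (length (fst I) * 2 + 2) +
      (1 + (N I ^ B + (N I ^ B' + (1 + (length (w I) * 3 + 4)))))"
  have "fpt_bounded 0 (\<lambda>I _. ?time I)"
    using emits_fpt_bounded[OF w] feasible_fpt_bounded[OF feasible_length order_refl]
      fpt_bounded_env_size[of 0, unfolded N]
    by (intro fpt_bounded_intros)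
  then obtain D where D: "?time I \<le> N I ^ D" for I
    unfolding fpt_bounded_def N by blast
  have "reaches (transducer p q) s ((2 ^ k * (k + 2) * (length x + 1)) ^ D)
      (\<lambda>s'. outputs s' (w (x, k)) (K (x, k)))"
    if s: "outputs s x k" for x k s
  proof (rule reaches_weaken)
    show "reaches (transducer p q) s (?time (x, k)) (\<lambda>s'. outputs s' (w (x, k)) (K (x, k)))"
      unfolding fst_conv
    proof (rule reaches_transducer[OF _ _ s])
      show "reaches p s' (N (x, k) ^ B) (appended 0 (w (x, k)) s')" if "output_ready (x, k) s'"
        for s'
        using p(2) that c unfolding writes_def by (blast intro: reaches_weaken)
      show "reaches q s' (N (x, k) ^ B') (\<lambda>s''. locals s'' 0 = K (x, k) \<and> unchanged_below 0 s' s'')"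
        if "loaded (x, k) s'" for s'
        using computesD[OF q(2) that] d by (blast intro: reaches_weaken)
    qed
    have "N (x, k) \<le> 2 ^ k * (k + 2) * (length x + 1)"
      unfolding N_def env_size_def mult.assoc by (intro mult_le_mono) auto
    then have "N (x, k) ^ D \<le> (2 ^ k * (k + 2) * (length x + 1)) ^ D" by (rule power_mono) simp
    then show "?time (x, k) \<le> (2 ^ k * (k + 2) * (length x + 1)) ^ D" using D
      by (rule order_trans[rotated])
  qed
  then show ?thesis by (rule that)
qed

subsection \<open>Composition of reductions\<close>

definition number_state :: "nat \<Rightarrow> state" where
  "number_state k = ((\<lambda>_. 0)(0 := k), \<lambda>_. 0)"

lemma computable_iff_reaches:
  "computable f \<longleftrightarrow> (\<exists>p. \<forall>k. \<exists>n. reaches p (number_state k) n (\<lambda>s. fst s 0 = f k))"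
  unfolding computable_def number_state_def reaches_def by blast

lemma computableI:
  assumes "\<And>k. reaches p (number_state k) (n k) (\<lambda>s. fst s 0 = f k)"
  shows "computable f"
  unfolding computable_iff_reaches using assms by blast

lemma computable_const: "computable (\<lambda>_. c)"
  by (rule computableI[where p="Assign 0 (Const c)"]) (rule reaches_Assign, simp)

lemma computable_id: "computable (\<lambda>k. k)"
  by (rule computableI[where p="Assign 0 (Reg 0)"])
    (rule reaches_Assign, simp add: number_state_def)

fun relocate_aexp :: "nat \<Rightarrow> aexp \<Rightarrow> aexp" where
  "relocate_aexp m (Const n) = Const n"
| "relocate_aexp m (Reg i) = Reg (3 * i + m + 1)"
| "relocate_aexp m (Cell a) = Cell (Plus (Plus (relocate_aexp m a) (relocate_aexp m a)) (Const m))"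
| "relocate_aexp m (Plus a b) = Plus (relocate_aexp m a) (relocate_aexp m b)"
| "relocate_aexp m (Minus a b) = Minus (relocate_aexp m a) (relocate_aexp m b)"

text \<open>For \<open>m < 2\<close> the registers congruent to \<open>m + 1\<close> modulo 3 and the array cells congruent to \<open>m\<close>
  modulo 2 serve as a machine of their own, so that two programs can run one after the other
  without any cleanup.\<close>

fun relocate :: "nat \<Rightarrow> prog \<Rightarrow> prog" where
  "relocate m (Assign i a) = Assign (3 * i + m + 1) (relocate_aexp m a)"
| "relocate m (Store a b) =
     Store (Plus (Plus (relocate_aexp m a) (relocate_aexp m a)) (Const m)) (relocate_aexp m b)"
| "relocate m (Seq p q) = Seq (relocate m p) (relocate m q)"
| "relocate m (If a p q) = If (relocate_aexp m a) (relocate m p) (relocate m q)"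
| "relocate m (While a p) = While (relocate_aexp m a) (relocate m p)"

definition simulates :: "nat \<Rightarrow> state \<Rightarrow> state \<Rightarrow> bool" where
  "simulates m s S \<longleftrightarrow> (\<forall>i. fst S (3 * i + m + 1) = fst s i) \<and> (\<forall>j. snd S (j + j + m) = snd s j)"

definition equal_elsewhere :: "nat \<Rightarrow> state \<Rightarrow> state \<Rightarrow> bool" where
  "equal_elsewhere m S S' \<longleftrightarrow>
     (\<forall>i. i mod 3 \<noteq> m + 1 \<longrightarrow> fst S' i = fst S i) \<and> (\<forall>j. j mod 2 \<noteq> m \<longrightarrow> snd S' j = snd S j)"

lemma equal_elsewhere_refl: "equal_elsewhere m S S"
  by (simp add: equal_elsewhere_def)

lemma equal_elsewhere_trans:
  "equal_elsewhere m S S' \<Longrightarrow> equal_elsewhere m S' S'' \<Longrightarrow> equal_elsewhere m S S''"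
  by (simp add: equal_elsewhere_def)

lemma simulates_equal_elsewhere:
  assumes "simulates m s S" "equal_elsewhere m' S S'" "m < 2" "m' < 2" "m \<noteq> m'"
  shows "simulates m s S'"
proof -
  have "(3 * i + m + 1) mod 3 \<noteq> m' + 1" "(j + j + m) mod 2 \<noteq> m'" for i j :: nat
    using assms(3-5) by presburger+
  then show ?thesis using assms(1,2) by (simp add: simulates_def equal_elsewhere_def)
qed

lemma aval_relocate: "simulates m s S \<Longrightarrow> aval (relocate_aexp m a) S = aval a s"
  by (induction a) (auto simp: simulates_def)

lemma simulates_Assign:
  assumes "m < 2" "simulates m s S"
  shows "simulates m ((fst s)(i := v), snd s) ((fst S)(3 * i + m + 1 := v), snd S)"
    "equal_elsewhere m S ((fst S)(3 * i + m + 1 := v), snd S)"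
proof -
  have "(3 * i + m + 1) mod 3 = m + 1" using assms(1) by presburger
  then show "simulates m ((fst s)(i := v), snd s) ((fst S)(3 * i + m + 1 := v), snd S)"
    "equal_elsewhere m S ((fst S)(3 * i + m + 1 := v), snd S)"
    using assms(2) by (auto simp: simulates_def equal_elsewhere_def)
qed

lemma simulates_Store:
  assumes "m < 2" "simulates m s S"
  shows "simulates m (fst s, (snd s)(j := v)) (fst S, (snd S)(j + j + m := v))"
    "equal_elsewhere m S (fst S, (snd S)(j + j + m := v))"
proof -
  have "(j + j + m) mod 2 = m" "i + i + m = j + j + m \<longleftrightarrow> i = j" for i
    using assms(1) by presburger+
  then show "simulates m (fst s, (snd s)(j := v)) (fst S, (snd S)(j + j + m := v))"
    "equal_elsewhere m S (fst S, (snd S)(j + j + m := v))"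
    using assms(2) by (auto simp: simulates_def equal_elsewhere_def)
qed

lemma exec_relocate:
  assumes "exec p s n s'" "m < 2" "simulates m s S"
  shows "\<exists>S'. exec (relocate m p) S n S' \<and> simulates m s' S' \<and> equal_elsewhere m S S'"
  using assms(1,3)
proof (induction arbitrary: S rule: exec.induct)
  case (1 i a s)
  then show ?case
    using exec.intros(1)[of "3 * i + m + 1" "relocate_aexp m a" S, unfolded aval_relocate[OF 1]]
      simulates_Assign[OF assms(2) 1] unfolding relocate.simps by blast
next
  case (2 a b s)
  then show ?case
    using exec.intros(2)[of "Plus (Plus (relocate_aexp m a) (relocate_aexp m a)) (Const m)" "relocate_aexp m b" S,
        unfolded aval.simps aval_relocate[OF 2]]
      simulates_Store[OF assms(2) 2] unfolding relocate.simps by blast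
next
  case (3 p s n s' q n' s'')
  obtain S1 where S1: "exec (relocate m p) S n S1" "simulates m s' S1" "equal_elsewhere m S S1"
    using 3 by blast
  obtain S2 where S2: "exec (relocate m q) S1 n' S2" "simulates m s'' S2" "equal_elsewhere m S1 S2"
    using 3 S1(2) by blast
  show ?case
    using exec.intros(3)[OF S1(1) S2(1)] S2(2) equal_elsewhere_trans[OF S1(3) S2(3)]
    unfolding relocate.simps by blast
next
  case (4 a s p n s' q)
  then show ?case
    using exec.intros(4)[of "relocate_aexp m a" S] aval_relocate[OF 4(4)]
    by (metis relocate.simps(4))
next
  case (5 a s q n s' p)
  then show ?case
    using exec.intros(5)[of "relocate_aexp m a" S] aval_relocate[OF 5(4)]
    by (metis relocate.simps(4))
next
  case (6 a s p)
  then show ?case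
    using exec.intros(6)[of "relocate_aexp m a" S] aval_relocate[OF 6(2)] equal_elsewhere_refl
    by (metis relocate.simps(5))
next
  case (7 a s p n s' n' s'')
  obtain S1 where S1: "exec (relocate m p) S n S1" "simulates m s' S1" "equal_elsewhere m S S1"
    using 7 by blast
  obtain S2 where S2: "exec (relocate m (While a p)) S1 n' S2" "simulates m s'' S2"
    "equal_elsewhere m S1 S2"
    using 7 S1(2) by blast
  have "aval (relocate_aexp m a) S \<noteq> 0" using aval_relocate[OF 7(6)] 7(1) by simp
  from exec.intros(7)[OF this S1(1) S2(1)[unfolded relocate.simps]] show ?case
    using S2(2) equal_elsewhere_trans[OF S1(3) S2(3)] unfolding relocate.simps by blast
qed

lemma computable_relocated:
  assumes "computable f"
  obtains p n where "\<And>m k S. m < 2 \<Longrightarrow> simulates m (number_state k) S \<Longrightarrow>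
    reaches (relocate m p) S (n k) (\<lambda>S'. fst S' (m + 1) = f k \<and> equal_elsewhere m S S')"
proof -
  obtain p n where p: "reaches p (number_state k) (n k) (\<lambda>s. fst s 0 = f k)" for k
    using assms unfolding computable_iff_reaches by metis
  have "reaches (relocate m p) S (n k) (\<lambda>S'. fst S' (m + 1) = f k \<and> equal_elsewhere m S S')"
    if m: "m < 2" and S: "simulates m (number_state k) S" for m k S
  proof -
    obtain n' s' where s': "exec p (number_state k) n' s'" "n' \<le> n k" "fst s' 0 = f k"
      using p[of k] unfolding reaches_def by blast
    obtain S' where S': "exec (relocate m p) S n' S'" "simulates m s' S'" "equal_elsewhere m S S'"
      using exec_relocate[OF s'(1) m S] by blast
    have "fst S' (3 * 0 + m + 1) = fst s' 0" using S'(2) unfolding simulates_def by blast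
    then show ?thesis unfolding reaches_def using S'(1,3) s'(2,3)
      by (intro exI[of _ n'] exI[of _ S']) simp
  qed
  then show ?thesis by (rule that)
qed

lemma computable_add:
  assumes "computable f" "computable g"
  shows "computable (\<lambda>k. f k + g k)"
proof -
  obtain p n where p: "\<And>m k S. m < 2 \<Longrightarrow> simulates m (number_state k) S \<Longrightarrow>
    reaches (relocate m p) S (n k) (\<lambda>S'. fst S' (m + 1) = f k \<and> equal_elsewhere m S S')"
    using assms(1) by (rule computable_relocated) blast
  obtain q n' where q: "\<And>m k S. m < 2 \<Longrightarrow> simulates m (number_state k) S \<Longrightarrow>
    reaches (relocate m q) S (n' k) (\<lambda>S'. fst S' (m + 1) = g k \<and> equal_elsewhere m S S')"
    using assms(2) by (rule computable_relocated) blast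
  show ?thesis
  proof (rule computableI)
    fix k
    let ?s = "\<lambda>s. s = ((fst (number_state k))(1 := k, 2 := k), snd (number_state k))"
    have init: "reaches (Assign 1 (Reg 0)) (number_state k) 1
        (\<lambda>s. s = ((fst (number_state k))(1 := k), snd (number_state k)))"
      by (rule reaches_Assign) (simp add: number_state_def)
    have copy: "reaches (Assign 2 (Reg 0)) s 1 ?s"
      if "s = ((fst (number_state k))(1 := k), snd (number_state k))" for s
      using that by (intro reaches_Assign) (simp add: number_state_def)
    have run_p: "reaches (relocate 0 p) s (n k)
        (\<lambda>s. fst s 1 = f k \<and> simulates 1 (number_state k) s)" if s: "?s s" for s
    proof (rule reaches_weaken[OF p])
      show "simulates 0 (number_state k) s" using s by (auto simp: simulates_def number_state_def)
      have "simulates 1 (number_state k) s" using s by (auto simp: simulates_def number_state_def)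
      then show "fst s' 1 = f k \<and> simulates 1 (number_state k) s'"
        if "fst s' (0 + 1) = f k \<and> equal_elsewhere 0 s s'" for s'
        using that simulates_equal_elsewhere[of 1 _ s 0 s'] by simp
    qed simp_all
    have run_q: "reaches (relocate 1 q) s (n' k) (\<lambda>s. fst s 1 = f k \<and> fst s 2 = g k)"
      if "fst s 1 = f k \<and> simulates 1 (number_state k) s" for s
      using that by (intro reaches_weaken[OF q]) (auto simp: equal_elsewhere_def numeral_2_eq_2)
    have finish: "reaches (Assign 0 (Plus (Reg 1) (Reg 2))) s 1 (\<lambda>s. fst s 0 = f k + g k)"
      if "fst s 1 = f k \<and> fst s 2 = g k" for s
      using that by (intro reaches_Assign) simp
    show "reaches (Seq (Assign 1 (Reg 0)) (Seq (Assign 2 (Reg 0))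
        (Seq (relocate 0 p) (Seq (relocate 1 q) (Assign 0 (Plus (Reg 1) (Reg 2)))))))
        (number_state k) (1 + (1 + (n k + (n' k + 1)))) (\<lambda>s. fst s 0 = f k + g k)"
      by (intro reaches_Seq[OF init] reaches_Seq[OF copy] reaches_Seq[OF run_p]
        reaches_Seq[OF run_q] finish)
  qed
qed

lemma computable_compose:
  assumes "computable f" "computable g"
  shows "computable (\<lambda>k. f (g k))"
proof -
  obtain p n where p: "\<And>m k S. m < 2 \<Longrightarrow> simulates m (number_state k) S \<Longrightarrow>
    reaches (relocate m p) S (n k) (\<lambda>S'. fst S' (m + 1) = f k \<and> equal_elsewhere m S S')"
    using assms(1) by (rule computable_relocated) blast
  obtain q n' where q: "\<And>m k S. m < 2 \<Longrightarrow> simulates m (number_state k) S \<Longrightarrow>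
    reaches (relocate m q) S (n' k) (\<lambda>S'. fst S' (m + 1) = g k \<and> equal_elsewhere m S S')"
    using assms(2) by (rule computable_relocated) blast
  show ?thesis
  proof (rule computableI)
    fix k
    let ?s = "\<lambda>s. s = ((fst (number_state k))(1 := k), snd (number_state k))"
    have init: "reaches (Assign 1 (Reg 0)) (number_state k) 1 ?s"
      by (rule reaches_Assign) (simp add: number_state_def)
    have run_q: "reaches (relocate 0 q) s (n' k)
        (\<lambda>s. fst s 1 = g k \<and> simulates 1 (number_state 0) s)" if s: "?s s" for s
    proof (rule reaches_weaken[OF q])
      show "simulates 0 (number_state k) s" using s by (auto simp: simulates_def number_state_def)
      have "simulates 1 (number_state 0) s" using s by (auto simp: simulates_def number_state_def)
      then show "fst s' 1 = g k \<and> simulates 1 (number_state 0) s'"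
        if "fst s' (0 + 1) = g k \<and> equal_elsewhere 0 s s'" for s'
        using that simulates_equal_elsewhere[of 1 _ s 0 s'] by simp
    qed simp_all
    have copy: "reaches (Assign 2 (Reg 1)) s 1 (simulates 1 (number_state (g k)))"
      if "fst s 1 = g k \<and> simulates 1 (number_state 0) s" for s
      using that by (intro reaches_Assign) (auto simp: simulates_def number_state_def)
    have run_p: "reaches (relocate 1 p) s (n (g k)) (\<lambda>s. fst s 2 = f (g k))"
      if "simulates 1 (number_state (g k)) s" for s
      using that by (intro reaches_weaken[OF p]) (auto simp: numeral_2_eq_2)
    have finish: "reaches (Assign 0 (Reg 2)) s 1 (\<lambda>s. fst s 0 = f (g k))" if "fst s 2 = f (g k)"
      for s
      using that by (intro reaches_Assign) simp
    show "reaches (Seq (Assign 1 (Reg 0))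
        (Seq (relocate 0 q) (Seq (Assign 2 (Reg 1)) (Seq (relocate 1 p) (Assign 0 (Reg 2))))))
        (number_state k) (1 + (n' k + (1 + (n (g k) + 1)))) (\<lambda>s. fst s 0 = f (g k))"
      by (intro reaches_Seq[OF init] reaches_Seq[OF run_q] reaches_Seq[OF copy]
        reaches_Seq[OF run_p] finish)
  qed
qed

fun doubled :: "nat \<Rightarrow> aexp \<Rightarrow> aexp" where
  "doubled 0 a = a"
| "doubled (Suc c) a = Plus (doubled c a) (doubled c a)"

lemma aval_doubled: "aval (doubled c a) s = 2 ^ c * aval a s"
  by (induction c) simp_all

lemma computable_two_power: "computable (\<lambda>n. 2 ^ (c * n))"
proof (rule computableI)
  fix n
  define Inv :: "nat \<Rightarrow> state \<Rightarrow> bool"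
    where "Inv j s \<longleftrightarrow> fst s 0 = 2 ^ (c * j) \<and> fst s 1 = n \<and> fst s 2 = j" for j s
  let ?loop = "count_loop 2 1 (Assign 0 (doubled c (Reg 0)))"
  have copy: "reaches (Assign 1 (Reg 0)) (number_state n) 1 (\<lambda>s. fst s 1 = n)"
    by (rule reaches_Assign) (simp add: number_state_def)
  have init: "reaches (Assign 0 (Const 1)) s 1 (\<lambda>s. fst s 0 = 1 \<and> fst s 1 = n)" if "fst s 1 = n"
    for s
    using that by (intro reaches_Assign) simp
  have loop: "reaches ?loop s (n * (1 + 2) + 2) (\<lambda>s. fst s 0 = 2 ^ (c * n))"
    if "fst s 0 = 1 \<and> fst s 1 = n" for s
  proof (rule reaches_weaken)
    show "reaches ?loop s (n * (1 + 2) + 2) (Inv n)"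
    proof (rule reaches_count_loop)
      show "reaches (Assign 0 (doubled c (Reg 0))) s1 1
          (\<lambda>s2. fst s2 2 = j \<and> Inv (Suc j) ((fst s2)(2 := Suc j), snd s2))"
        if "Inv j s1" for j s1
        using that by (intro reaches_Assign) (simp add: Inv_def aval_doubled power_add)
    qed (use that in \<open>simp_all add: Inv_def\<close>)
  qed (simp_all add: Inv_def)
  show "reaches (Seq (Assign 1 (Reg 0)) (Seq (Assign 0 (Const 1)) ?loop)) (number_state n)
      (1 + (1 + (n * (1 + 2) + 2))) (\<lambda>s. fst s 0 = 2 ^ (c * n))"
    by (intro reaches_Seq[OF copy] reaches_Seq[OF init] loop)
qed

lemma fpt_reducibleI:
  assumes "computable f" "computable g"
    and "\<And>x k. (x, k) \<in> instances P \<Longrightarrow> \<exists>x' k'.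
      reaches p (initial_state x k) (f k * (length x + 1) ^ d) (\<lambda>s. outputs s x' k') \<and> k' \<le> g k \<and>
      (x', k') \<in> instances Q \<and> ((x, k) \<in> yes_instances P \<longleftrightarrow> (x', k') \<in> yes_instances Q)"
  shows "fpt_reducible P Q"
  unfolding fpt_reducible_def
proof (rule exI[of _ p], rule exI[of _ f], rule exI[of _ g], rule exI[of _ d],
    intro conjI assms(1,2) ballI)
  fix I assume "I \<in> instances P"
  then show "case I of (x, k) \<Rightarrow> \<exists>n s x' k'. exec p (initial_state x k) n s \<and> outputs s x' k' \<and>
      n \<le> f k * (length x + 1) ^ d \<and> k' \<le> g k \<and> (x', k') \<in> instances Q \<and>
      ((x, k) \<in> yes_instances P) = ((x', k') \<in> yes_instances Q)"
    using assms(3)[of "fst I" "snd I"] unfolding reaches_def case_prod_unfold prod.collapse by blast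
qed

lemma fpt_reducibleE:
  assumes "fpt_reducible P Q"
  obtains p f g d where "computable f" "computable g"
    "\<And>x k. (x, k) \<in> instances P \<Longrightarrow> \<exists>x' k'.
      reaches p (initial_state x k) (f k * (length x + 1) ^ d) (\<lambda>s. outputs s x' k') \<and> k' \<le> g k \<and>
      (x', k') \<in> instances Q \<and> ((x, k) \<in> yes_instances P \<longleftrightarrow> (x', k') \<in> yes_instances Q)"
proof -
  obtain p f g d where fg: "computable f" "computable g" and
    p: "\<forall>(x, k) \<in> instances P. \<exists>n s x' k'.
      exec p (initial_state x k) n s \<and> outputs s x' k' \<and>
      n \<le> f k * (length x + 1) ^ d \<and> k' \<le> g k \<and> (x', k') \<in> instances Q \<and>
      ((x, k) \<in> yes_instances P \<longleftrightarrow> (x', k') \<in> yes_instances Q)"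
    using assms unfolding fpt_reducible_def by (elim exE conjE)
  show ?thesis
  proof (rule that[OF fg])
    fix x k assume "(x, k) \<in> instances P"
    from bspec[OF p this] show "\<exists>x' k'.
      reaches p (initial_state x k) (f k * (length x + 1) ^ d) (\<lambda>s. outputs s x' k') \<and> k' \<le> g k \<and>
      (x', k') \<in> instances Q \<and> ((x, k) \<in> yes_instances P \<longleftrightarrow> (x', k') \<in> yes_instances Q)"
      unfolding reaches_def case_prod_conv by blast
  qed
qed

lemma fpt_reducible_refl: "fpt_reducible P P"
proof (rule fpt_reducibleI[OF computable_const computable_id])
  fix x k
  have "reaches (Assign 0 (Reg 0)) (initial_state x k) (1 * (length x + 1) ^ 0) (\<lambda>s. outputs s x k)"
    unfolding power_0 mult_1 by (rule reaches_Assign) (simp add: outputs_def initial_state_def)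
  then show "(x, k) \<in> instances P \<Longrightarrow> \<exists>x' k'.
      reaches (Assign 0 (Reg 0)) (initial_state x k) (1 * (length x + 1) ^ 0)
        (\<lambda>s. outputs s x' k') \<and>
      k' \<le> k \<and> (x', k') \<in> instances P \<and> ((x, k) \<in> yes_instances P \<longleftrightarrow> (x', k') \<in> yes_instances P)"
    by blast
qed

lemma fpt_reducible_extend:
  assumes "fpt_reducible P Q" "instances Q \<subseteq> instances R"
    and "\<And>x k. (x, k) \<in> instances Q \<Longrightarrow> (x, k) \<in> yes_instances Q \<longleftrightarrow> (x, k) \<in> yes_instances R"
  shows "fpt_reducible P R"
  using assms(1)
proof (rule fpt_reducibleE)
  fix p f g d assume "computable f" "computable g"
    "\<And>x k. (x, k) \<in> instances P \<Longrightarrow> \<exists>x' k'.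
      reaches p (initial_state x k) (f k * (length x + 1) ^ d) (\<lambda>s. outputs s x' k') \<and> k' \<le> g k \<and>
      (x', k') \<in> instances Q \<and> ((x, k) \<in> yes_instances P \<longleftrightarrow> (x', k') \<in> yes_instances Q)"
  then show ?thesis
    using assms(2,3) by (intro fpt_reducibleI) (assumption, assumption, blast)
qed

lemma exec_changed_cells:
  "exec p s n s' \<Longrightarrow> \<exists>A. finite A \<and> card A \<le> n \<and> (\<forall>j. j \<notin> A \<longrightarrow> snd s' j = snd s j)"
proof (induction rule: exec.induct)
  case (1 i a s)
  show ?case by (rule exI[of _ "{}"]) auto
next
  case (2 a b s)
  show ?case by (rule exI[of _ "{aval a s}"]) auto
next
  case (3 p s m s' q n s'')
  then obtain A B where "finite A" "card A \<le> m" "\<forall>j. j \<notin> A \<longrightarrow> snd s' j = snd s j"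
    "finite B" "card B \<le> n" "\<forall>j. j \<notin> B \<longrightarrow> snd s'' j = snd s' j" by blast
  then show ?case using card_Un_le[of A B] by (intro exI[of _ "A \<union> B"]) auto
next
  case (6 a s p)
  show ?case by (rule exI[of _ "{}"]) auto
next
  case (7 a s p m s' n s'')
  then obtain A B where "finite A" "card A \<le> m" "\<forall>j. j \<notin> A \<longrightarrow> snd s' j = snd s j"
    "finite B" "card B \<le> n" "\<forall>j. j \<notin> B \<longrightarrow> snd s'' j = snd s' j" by blast
  then show ?case using card_Un_le[of A B] by (intro exI[of _ "A \<union> B"]) auto
qed (auto intro: le_SucI)

lemma output_length_le:
  assumes "reaches p (initial_state x k) n (\<lambda>s. outputs s x' k')"
  shows "length x' \<le> length x + n"
proof -
  obtain m s where s: "exec p (initial_state x k) m s" "m \<le> n" "outputs s x' k'"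
    using assms unfolding reaches_def by blast
  obtain A where A: "finite A" "card A \<le> m" "\<forall>j. j \<notin> A \<longrightarrow> snd s j = string_cells x j"
    using exec_changed_cells[OF s(1)] by (auto simp: initial_state_def)
  have "j \<in> A" if "length x \<le> j" "j < length x'" for j
  proof (rule ccontr)
    assume "j \<notin> A"
    then have "string_cells x' j = string_cells x j"
      using A(3) s(3) that(2) unfolding outputs_def by (metis less_imp_le)
    then show False using that by (simp add: string_cells_def split: if_splits)
  qed
  then have "{length x..<length x'} \<subseteq> A" by auto
  from card_mono[OF A(1) this] show ?thesis using A(2) s(2) by simp
qed

lemma composed_time_le:
  fixes f g k l L :: nat
  assumes "1 \<le> L" "k \<le> g" "l \<le> L + f * L ^ d"
  shows "f * L ^ d + (2 ^ k * (k + 2) * l) ^ E \<le>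
      2 ^ ((3 * E + 2) * (f + g + 1)) * L ^ (d + (d + 1) * E)"
proof -
  define u where "u = f + g + 1"
  have u: "n \<le> 2 ^ u" if "n \<le> u" for n
    using that less_exp[of u] by linarith
  have "l \<le> L ^ (d + 1) + f * L ^ (d + 1)"
    using assms(1) by (intro order_trans[OF assms(3)] add_mono mult_le_mono2 power_increasing
      self_le_power) auto
  also have "\<dots> = (f + 1) * L ^ (d + 1)" by (simp add: algebra_simps)
  also have "\<dots> \<le> 2 ^ u * L ^ (d + 1)" by (intro mult_le_mono1 u) (simp add: u_def)
  finally have l: "l \<le> 2 ^ u * L ^ (d + 1)" .
  have "k + 2 \<le> 2 ^ u"
    using less_exp[of u] assms(2) by (simp add: u_def)
  moreover have "(2::nat) ^ k \<le> 2 ^ u" using assms(2) by (intro power_increasing) (auto simp: u_def)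
  ultimately have "2 ^ k * (k + 2) * l \<le> 2 ^ u * 2 ^ u * (2 ^ u * L ^ (d + 1))"
    using l by (intro mult_le_mono)
  also have "\<dots> = 2 ^ (3 * u) * L ^ (d + 1)"
    by (simp add: power_add[symmetric] mult.assoc[symmetric])
  finally have "(2 ^ k * (k + 2) * l) ^ E \<le> (2 ^ (3 * u) * L ^ (d + 1)) ^ E"
    by (rule power_mono) simp
  also have "\<dots> = 2 ^ (3 * E * u) * L ^ ((d + 1) * E)"
    by (simp only: power_mult_distrib power_mult[symmetric] ac_simps)
  also have "\<dots> \<le> 2 ^ (3 * E * u + u) * L ^ (d + (d + 1) * E)"
    using assms(1) by (intro mult_le_mono power_increasing) auto
  finally have second: "(2 ^ k * (k + 2) * l) ^ E \<le> 2 ^ (3 * E * u + u) * L ^ (d + (d + 1) * E)" .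
  have "f \<le> 2 ^ (3 * E * u + u)"
    by (rule order_trans[OF u power_increasing]) (auto simp: u_def)
  then have "f * L ^ d \<le> 2 ^ (3 * E * u + u) * L ^ (d + (d + 1) * E)"
    using assms(1) by (intro mult_le_mono power_increasing) auto
  with second have "f * L ^ d + (2 ^ k * (k + 2) * l) ^ E \<le>
      2 ^ (3 * E * u + u + 1) * L ^ (d + (d + 1) * E)"
    by simp
  also have "\<dots> \<le> 2 ^ ((3 * E + 2) * u) * L ^ (d + (d + 1) * E)"
    by (intro mult_le_mono1 power_increasing) (auto simp: u_def algebra_simps)
  finally show ?thesis by (simp add: u_def)
qed

lemma fpt_reducible_transduce:
  assumes PQ: "fpt_reducible P Q"
    and w: "emits 0 (\<lambda>I _. w I)" and K: "feasible 0 (\<lambda>I _. K I)"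
    and K_le: "\<And>x k. K (x, k) \<le> 2 ^ (D * (k + 1))"
    and Q: "\<And>x k. (x, k) \<in> instances Q \<Longrightarrow> (w (x, k), K (x, k)) \<in> instances R \<and>
       ((x, k) \<in> yes_instances Q \<longleftrightarrow> (w (x, k), K (x, k)) \<in> yes_instances R)"
  shows "fpt_reducible P R"
proof -
  obtain p f g d where f: "computable f" and g: "computable g"
    and p: "\<And>x k. (x, k) \<in> instances P \<Longrightarrow> \<exists>x' k'.
      reaches p (initial_state x k) (f k * (length x + 1) ^ d) (\<lambda>s. outputs s x' k') \<and> k' \<le> g k \<and>
      (x', k') \<in> instances Q \<and> ((x, k) \<in> yes_instances P \<longleftrightarrow> (x', k') \<in> yes_instances Q)"
    using PQ by (rule fpt_reducibleE) blast
  obtain q E where q: "\<And>x k s. outputs s x k \<Longrightarrow>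
      reaches q s ((2 ^ k * (k + 2) * (length x + 1)) ^ E) (\<lambda>s'. outputs s' (w (x, k)) (K (x, k)))"
    using w K by (rule emits_transducer) blast
  have bound: "computable (\<lambda>k. 2 ^ (c * (f k + g k + 1)))" for c
    by (intro computable_compose[OF computable_two_power] computable_add computable_const f g)
  show ?thesis
  proof (rule fpt_reducibleI[OF bound bound])
    fix x k assume "(x, k) \<in> instances P"
    from p[OF this] obtain x' k' where run_p:
      "reaches p (initial_state x k) (f k * (length x + 1) ^ d) (\<lambda>s. outputs s x' k')"
      and k': "k' \<le> g k" and Q': "(x', k') \<in> instances Q" "(x, k) \<in> yes_instances P \<longleftrightarrow>
          (x', k') \<in> yes_instances Q"
      by blast
    have "length x' + 1 \<le> (length x + 1) + f k * (length x + 1) ^ d"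
      using output_length_le[OF run_p] by simp
    from composed_time_le[OF _ k' this, of E]
    have time: "f k * (length x + 1) ^ d + (2 ^ k' * (k' + 2) * (length x' + 1)) ^ E \<le>
        2 ^ ((3 * E + 2) * (f k + g k + 1)) * (length x + 1) ^ (d + (d + 1) * E)" by simp
    have "K (x', k') \<le> 2 ^ (D * (k' + 1))" by (rule K_le)
    also have "\<dots> \<le> 2 ^ (D * (f k + g k + 1))" using k'
      by (intro power_increasing mult_le_mono2) auto
    finally have "K (x', k') \<le> 2 ^ (D * (f k + g k + 1))" .
    moreover have "reaches (Seq p q) (initial_state x k)
        (2 ^ ((3 * E + 2) * (f k + g k + 1)) * (length x + 1) ^ (d + (d + 1) * E))
          (\<lambda>s. outputs s (w (x', k')) (K (x', k')))"
      by (rule reaches_weaken[OF reaches_Seq[OF run_p q] time])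
    ultimately show "\<exists>x' k'. reaches (Seq p q) (initial_state x k)
        (2 ^ ((3 * E + 2) * (f k + g k + 1)) * (length x + 1) ^ (d + (d + 1) * E))
          (\<lambda>s. outputs s x' k') \<and>
      k' \<le> 2 ^ (D * (f k + g k + 1)) \<and> (x', k') \<in> instances R \<and>
      ((x, k) \<in> yes_instances P \<longleftrightarrow> (x', k') \<in> yes_instances R)"
      using Q[OF Q'(1)] Q'(2) by blast
  qed
qed

subsection \<open>Genus and number of edges\<close>

lemma arc_compose:
  assumes "arc g" "continuous_on (path_image g) f" "inj f"
  shows "arc (f \<circ> g)"
  using assms path_continuous_image[of g f] unfolding arc_def
  by (auto intro: comp_inj_on inj_on_subset)

text \<open>
  The vertex \<open>v\<close> lies at \<open>x v\<close> on the real axis. The edge \<open>e\<close> climbs from both of its ends along a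
  straight spoke to a portal at the height \<open>h e\<close>, and a horizontal bridge joins the two portals.
  The portals of a vertex lie on a parabola, which gives the spokes of this vertex different slopes.
  So only spokes and bridges of different edges cross, and the bridges will be moved to the lower side
  of the surface.
\<close>

locale graph_drawing =
  fixes V :: "'a set" and E :: "'a set set" and src tgt :: "'a set \<Rightarrow> 'a"
    and x :: "'a \<Rightarrow> real" and h :: "'a set \<Rightarrow> real" and \<delta> :: real
  assumes finite_edges: "finite E"
    and edge_subset: "e \<in> E \<Longrightarrow> e \<subseteq> V"
    and edge_ends: "e \<in> E \<Longrightarrow> e = {src e, tgt e}" "e \<in> E \<Longrightarrow> src e \<noteq> tgt e"
    and separation_pos: "\<delta> > 0"
    and x_bounds: "v \<in> V \<Longrightarrow> 0 \<le> x v" "v \<in> V \<Longrightarrow> x v + \<delta> \<le> 1 / 2"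
    and x_separated: "v \<in> V \<Longrightarrow> w \<in> V \<Longrightarrow> v \<noteq> w \<Longrightarrow> \<delta> \<le> \<bar>x v - x w\<bar>"
    and h_bounds: "e \<in> E \<Longrightarrow> 0 < h e" "e \<in> E \<Longrightarrow> h e < 1 / 2"
    and inj_on_h: "inj_on h E"
begin

definition vertex :: "'a \<Rightarrow> complex" where
  "vertex v = Complex (x v) 0"

definition portal :: "'a \<Rightarrow> 'a set \<Rightarrow> complex" where
  "portal v e = Complex (x v + \<delta> * (h e)\<^sup>2) (h e)"

definition spoke :: "'a \<Rightarrow> 'a set \<Rightarrow> complex set" where
  "spoke v e = closed_segment (vertex v) (portal v e)"

definition bridge :: "'a set \<Rightarrow> complex set" where
  "bridge e = closed_segment (portal (src e) e) (portal (tgt e) e)"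

lemma Im_portal [simp]: "Im (portal v e) = h e"
  by (simp add: portal_def)

lemma edge_ends_mem: "e \<in> E \<Longrightarrow> src e \<in> e" "e \<in> E \<Longrightarrow> tgt e \<in> e"
  using edge_ends(1) by blast+

lemma portal_in_spoke: "portal v e \<in> spoke v e"
  and vertex_in_spoke: "vertex v \<in> spoke v e"
  by (simp_all add: spoke_def)

lemma inj_on_vertex: "inj_on vertex V"
  using x_separated separation_pos by (fastforce simp: inj_on_def vertex_def)

lemma spokeE:
  assumes "p \<in> spoke v e"
  obtains u where "0 \<le> u" "u \<le> 1" "Re p = x v + \<delta> * (u * (h e)\<^sup>2)" "Im p = u * h e"
proof -
  obtain u where "0 \<le> u" "u \<le> 1" "p = (1 - u) *\<^sub>R vertex v + u *\<^sub>R portal v e"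
    using assms by (auto simp: spoke_def in_segment)
  moreover from this have "Re p = (1 - u) * Re (vertex v) + u * Re (portal v e)"
    "Im p = (1 - u) * Im (vertex v) + u * Im (portal v e)"
    by simp_all
  ultimately show ?thesis
    by (intro that[of u]) (simp_all add: vertex_def portal_def algebra_simps)
qed

lemma spoke_bounds:
  assumes "p \<in> spoke v e" "e \<in> E"
  shows "x v \<le> Re p" "Re p < x v + \<delta>" "0 \<le> Im p" "Im p \<le> h e"
proof -
  obtain u where u: "0 \<le> u" "u \<le> 1" "Re p = x v + \<delta> * (u * (h e)\<^sup>2)" "Im p = u * h e"
    using assms(1) by (rule spokeE)
  have "(h e)\<^sup>2 < 1"
    using h_bounds[OF assms(2)] by (simp add: power_less_one_iff)
  then have "u * (h e)\<^sup>2 < 1"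
    using mult_left_le_one_le[of "(h e)\<^sup>2" u] u(1,2) by simp
  then show "x v \<le> Re p" "Re p < x v + \<delta>"
    using u(1,3) separation_pos by simp_all
  show "0 \<le> Im p" "Im p \<le> h e"
    using u h_bounds[OF assms(2)] by (simp_all add: mult_left_le_one_le)
qed

lemma Im_bridge: "p \<in> bridge e \<Longrightarrow> Im p = h e"
proof -
  assume "p \<in> bridge e"
  then obtain u where "p = (1 - u) *\<^sub>R portal (src e) e + u *\<^sub>R portal (tgt e) e"
    by (auto simp: bridge_def in_segment)
  then have "Im p = (1 - u) * Im (portal (src e) e) + u * Im (portal (tgt e) e)"
    by simp
  then show ?thesis
    by (simp add: algebra_simps)
qed

lemma spokes_of_distinct_vertices_disjoint:
  assumes "p \<in> spoke v e" "p \<in> spoke w e'" "e \<in> E" "e' \<in> E" "v \<in> e" "w \<in> e'"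
  shows "v = w"
proof (rule ccontr)
  assume "v \<noteq> w"
  then have "\<delta> \<le> \<bar>x v - x w\<bar>"
    using assms edge_subset x_separated by blast
  then show False
    using spoke_bounds[OF assms(1,3)] spoke_bounds[OF assms(2,4)] by linarith
qed

lemma spokes_of_vertex_meet:
  assumes "p \<in> spoke v e" "p \<in> spoke v e'" "e \<in> E" "e' \<in> E" "e \<noteq> e'"
  shows "p = vertex v"
proof -
  obtain u where u: "Re p = x v + \<delta> * (u * (h e)\<^sup>2)" "Im p = u * h e"
    using assms(1) by (rule spokeE)
  obtain u' where u': "Re p = x v + \<delta> * (u' * (h e')\<^sup>2)" "Im p = u' * h e'"
    using assms(2) by (rule spokeE)
  have "u * h e * h e = u' * h e' * h e'"
    using u(1) u'(1) separation_pos by (simp add: power2_eq_square mult.assoc)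
  then have "u * h e * (h e - h e') = 0"
    using u(2) u'(2) by (simp add: algebra_simps)
  moreover have "h e \<noteq> h e'"
    using inj_on_h assms(3-5) by (auto dest: inj_onD)
  ultimately have "u * h e = 0" by simp
  then show ?thesis
    using u by (simp add: vertex_def complex_eq_iff power2_eq_square)
qed

lemma spoke_bridge_meet:
  assumes "p \<in> spoke v e" "p \<in> bridge e" "e \<in> E"
  shows "p = portal v e"
proof -
  obtain u where u: "Re p = x v + \<delta> * (u * (h e)\<^sup>2)" "Im p = u * h e"
    using assms(1) by (rule spokeE)
  then have "u = 1"
    using Im_bridge[OF assms(2)] h_bounds(1)[OF assms(3)] by simp
  then show ?thesis
    using u by (simp add: portal_def complex_eq_iff)
qed

lemma bridges_disjoint: "p \<in> bridge e \<Longrightarrow> p \<in> bridge e' \<Longrightarrow> e \<in> E \<Longrightarrow> e' \<in> E \<Longrightarrow> e = e'"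
  using inj_onD[OF inj_on_h] Im_bridge by metis

lemma vertex_notin_bridge: "e \<in> E \<Longrightarrow> vertex v \<notin> bridge e"
  using Im_bridge[of "vertex v" e] h_bounds(1)[of e] by (auto simp: vertex_def)

lemma vertex_neq_portal: "e \<in> E \<Longrightarrow> vertex v \<noteq> portal w e"
  using h_bounds(1)[of e] by (auto simp: vertex_def portal_def)

lemma vertex_in_disc: "v \<in> V \<Longrightarrow> vertex v \<in> ball 0 1"
  using x_bounds[of v] separation_pos by (simp add: vertex_def cmod_def)

lemma portal_in_disc:
  assumes "e \<in> E" "v \<in> e"
  shows "portal v e \<in> ball 0 1"
proof -
  have "v \<in> V" using assms edge_subset by blast
  then have "\<bar>Re (portal v e)\<bar> < 1 / 2"
    using spoke_bounds(1,2)[OF portal_in_spoke[of v e] assms(1)] x_bounds[of v] by linarith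
  moreover have "\<bar>Im (portal v e)\<bar> < 1 / 2" using h_bounds[OF assms(1)] by simp
  ultimately show ?thesis using cmod_le[of "portal v e"] by simp
qed

lemma spoke_subset_disc: "e \<in> E \<Longrightarrow> v \<in> e \<Longrightarrow> spoke v e \<subseteq> ball 0 1"
  unfolding spoke_def using edge_subset
  by (intro closed_segment_subset vertex_in_disc portal_in_disc) auto

lemma bridge_subset_disc: "e \<in> E \<Longrightarrow> bridge e \<subseteq> ball 0 1"
  unfolding bridge_def
  by (intro closed_segment_subset portal_in_disc edge_ends_mem) auto

definition obstacles :: "'a \<Rightarrow> 'a set \<Rightarrow> complex set" where
  "obstacles v e =
     (\<Union>(e', w)\<in>Sigma E id - {(e, v)}. spoke w e') \<union> (\<Union>e'\<in>E - {e}. bridge e') \<union> - ball 0 1"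

lemma finite_incidences: "finite (Sigma E id)"
proof (intro finite_SigmaI finite_edges)
  fix e assume "e \<in> E"
  then show "finite (id e)" by (subst edge_ends(1)) auto
qed

lemma card_incidences: "card (Sigma E id) = 2 * card E"
proof -
  have "card e = 2" if "e \<in> E" for e
    using edge_ends[OF that] by (metis card_2_iff)
  moreover from this have "finite e" if "e \<in> E" for e
    using that by (metis card.infinite zero_neq_numeral)
  ultimately show ?thesis
    using finite_edges by (simp add: card_SigmaI)
qed

lemma spoke_subset_obstacles:
  "e' \<in> E \<Longrightarrow> w \<in> e' \<Longrightarrow> (w, e') \<noteq> (v, e) \<Longrightarrow> spoke w e' \<subseteq> obstacles v e"
proof -
  assume "e' \<in> E" "w \<in> e'" "(w, e') \<noteq> (v, e)"
  then have "(e', w) \<in> Sigma E id - {(e, v)}" by auto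
  from UN_upper[OF this, of "\<lambda>(e', w). spoke w e'"] show "spoke w e' \<subseteq> obstacles v e"
    by (auto simp: obstacles_def)
qed

lemma bridge_subset_obstacles: "e' \<in> E \<Longrightarrow> e' \<noteq> e \<Longrightarrow> bridge e' \<subseteq> obstacles v e"
  by (auto simp: obstacles_def)

lemma portal_notin_obstacles:
  assumes "e \<in> E" "v \<in> e"
  shows "portal v e \<notin> obstacles v e"
proof -
  have "portal v e \<notin> spoke w e'" if w: "e' \<in> E" "w \<in> e'" "(w, e') \<noteq> (v, e)" for w e'
  proof
    assume meet: "portal v e \<in> spoke w e'"
    then have "w = v"
      using spokes_of_distinct_vertices_disjoint[OF _ portal_in_spoke] w assms by blast
    then show False
      using spokes_of_vertex_meet[OF portal_in_spoke, of v e e'] meet w assms vertex_neq_portal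
      by metis
  qed
  moreover have "portal v e \<notin> bridge e'" if "e' \<in> E" "e' \<noteq> e" for e'
    using Im_bridge[of "portal v e" e'] inj_on_h that assms(1) by (auto dest: inj_onD)
  ultimately show ?thesis
    using portal_in_disc[OF assms] unfolding obstacles_def by auto blast+
qed

lemma ex_clearance: "\<exists>r>0. \<forall>e\<in>E. \<forall>v\<in>e. cball (portal v e) (4 * r) \<inter> obstacles v e = {}"
proof -
  have "\<exists>d>0. \<forall>y\<in>obstacles v e. d \<le> dist (portal v e) y" if "e \<in> E" "v \<in> e" for e v
  proof (rule separate_point_closed)
    show "closed (obstacles v e)"
      unfolding obstacles_def spoke_def bridge_def
      using finite_incidences finite_edges by (intro closed_Un closed_UN) auto
  qed (use portal_notin_obstacles that in auto)
  then have "\<forall>i\<in>Sigma E id. \<exists>d>0. \<forall>y\<in>obstacles (snd i) (fst i). d \<le> dist (portal (snd i) (fst i)) y"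
    by auto
  then obtain d where d: "\<And>i. i \<in> Sigma E id \<Longrightarrow> d i > 0"
    "\<And>i y. i \<in> Sigma E id \<Longrightarrow> y \<in> obstacles (snd i) (fst i) \<Longrightarrow> d i \<le> dist (portal (snd i) (fst i)) y"
    by metis
  define m where "m = Min (insert 1 (d ` Sigma E id))"
  have "m > 0"
    unfolding m_def using finite_incidences d(1) by (subst Min_gr_iff) auto
  moreover have "m \<le> dist (portal v e) y" if "e \<in> E" "v \<in> e" "y \<in> obstacles v e" for e v y
  proof -
    have "m \<le> d (e, v)"
      unfolding m_def using finite_incidences that(1,2) by (intro Min_le) auto
    also have "\<dots> \<le> dist (portal v e) y" using d(2)[of "(e, v)" y] that by simp
    finally show ?thesis .
  qed
  ultimately show ?thesis
    by (intro exI[of _ "m / 8"]) fastforce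
qed

end

text \<open>Each portal lies on the bottom of a hole of radius \<open>r\<close>, where the two sides of the surface meet.\<close>

locale drilled_drawing = graph_drawing +
  fixes r :: real
  assumes radius_pos: "r > 0"
    and clearance: "e \<in> E \<Longrightarrow> v \<in> e \<Longrightarrow> cball (portal v e) (4 * r) \<inter> obstacles v e = {}"
begin

definition center :: "'a \<Rightarrow> 'a set \<Rightarrow> complex" where
  "center v e = portal v e + Complex 0 r"

definition plate :: "complex set" where
  "plate = cball 0 1 - (\<Union>(e, v)\<in>Sigma E id. ball (center v e) r)"

lemma dist_portal_center: "dist (portal v e) (center v e) = r"
  using radius_pos by (simp add: center_def dist_norm cmod_def)

lemma dist_portal_hole: "p \<in> cball (center v e) r \<Longrightarrow> dist (portal v e) p \<le> 2 * r"
  using dist_triangle[of "portal v e" p "center v e"] dist_portal_center[of v e] by simp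

lemma hole_disjoint_obstacles: "e \<in> E \<Longrightarrow> v \<in> e \<Longrightarrow> cball (center v e) r \<inter> obstacles v e = {}"
proof -
  assume "e \<in> E" "v \<in> e"
  moreover have "cball (center v e) r \<subseteq> cball (portal v e) (4 * r)"
    using dist_portal_hole[of _ v e] radius_pos by fastforce
  ultimately show ?thesis using clearance by blast
qed

lemma below_portal_notin_hole:
  assumes "Im p \<le> h e"
  shows "p \<notin> ball (center v e) r"
proof
  assume "p \<in> ball (center v e) r"
  then have "\<bar>Im (center v e - p)\<bar> < r"
    using abs_Im_le_cmod[of "center v e - p"] by (simp add: dist_norm)
  then show False using assms by (simp add: center_def)
qed

lemma holes_disjoint:
  assumes "e \<in> E" "v \<in> e" "e' \<in> E" "v' \<in> e'" "(v, e) \<noteq> (v', e')"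
  shows "cball (center v e) r \<inter> cball (center v' e') r = {}"
proof (rule ccontr)
  assume "cball (center v e) r \<inter> cball (center v' e') r \<noteq> {}"
  then obtain p where "p \<in> cball (center v e) r" "p \<in> cball (center v' e') r" by blast
  then have "portal v' e' \<in> cball (portal v e) (4 * r)"
    using dist_portal_hole[of p v e] dist_portal_hole[of p v' e']
      dist_triangle2[of "portal v e" "portal v' e'" p] by simp
  moreover have "portal v' e' \<in> obstacles v e"
    using spoke_subset_obstacles[of e' v' v e] portal_in_spoke assms by blast
  ultimately show False using clearance[OF assms(1,2)] by blast
qed

lemma disc_with_holes_plate: "disc_with_holes (2 * card E) plate"
proof -
  obtain en where en: "bij_betw en {..<2 * card E} (Sigma E id)"
    using ex_bij_betw_nat_finite[OF finite_incidences] card_incidences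
    by (auto simp: atLeast0LessThan)
  define a where "a i = center (snd (en i)) (fst (en i))" for i
  have en_mem: "fst (en i) \<in> E" "snd (en i) \<in> fst (en i)" if "i < 2 * card E" for i
    using bij_betwE[OF en] that by force+
  have "(\<Union>(e, v)\<in>Sigma E id. ball (center v e) r) = (\<Union>i<2 * card E. ball (a i) r)"
    unfolding a_def bij_betw_imp_surj_on[OF en, symmetric] by (simp add: case_prod_unfold)
  moreover have "cball (a i) r \<subseteq> ball 0 1" if "i < 2 * card E" for i
    using hole_disjoint_obstacles[OF en_mem[OF that]] by (auto simp: a_def obstacles_def)
  moreover have "disjoint_family_on (\<lambda>i. cball (a i) r) {..<2 * card E}"
    unfolding disjoint_family_on_def
  proof (intro ballI impI)
    fix i j assume ij: "i \<in> {..<2 * card E}" "j \<in> {..<2 * card E}" "i \<noteq> j"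
    then have "en i \<noteq> en j" using en by (auto simp: bij_betw_def dest: inj_onD)
    then show "cball (a i) r \<inter> cball (a j) r = {}"
      unfolding a_def using ij en_mem by (intro holes_disjoint) (auto simp: prod_eq_iff)
  qed
  ultimately show ?thesis
    unfolding disc_with_holes_def plate_def using radius_pos
    by (intro exI[of _ a] exI[of _ "\<lambda>_. r"]) simp
qed

lemma vertex_in_plate:
  assumes "v \<in> V"
  shows "vertex v \<in> plate"
proof -
  have "vertex v \<notin> ball (center w e) r" if "e \<in> E" for w e
    using h_bounds(1)[OF that] by (intro below_portal_notin_hole) (simp add: vertex_def)
  then show ?thesis
    using vertex_in_disc[OF assms] by (auto simp: plate_def)
qed

lemma spoke_subset_plate:
  assumes "e \<in> E" "v \<in> e"
  shows "spoke v e \<subseteq> plate"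
proof
  fix p assume p: "p \<in> spoke v e"
  have "p \<notin> ball (center w e') r" if w: "e' \<in> E" "w \<in> e'" for w e'
  proof (cases "(w, e') = (v, e)")
    case True
    then show ?thesis using below_portal_notin_hole spoke_bounds(4)[OF p assms(1)] by simp
  next
    case False
    then have "p \<in> obstacles w e'" using spoke_subset_obstacles[of e v w e'] assms p by auto
    then show ?thesis using hole_disjoint_obstacles[OF w]
      by (meson ball_subset_cball disjoint_iff subsetD)
  qed
  then show "p \<in> plate"
    using subsetD[OF spoke_subset_disc[OF assms] p] by (auto simp: plate_def)
qed

lemma bridge_subset_plate:
  assumes "e \<in> E"
  shows "bridge e \<subseteq> plate"
proof
  fix p assume p: "p \<in> bridge e"
  have "p \<notin> ball (center w e') r" if w: "e' \<in> E" "w \<in> e'" for w e'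
  proof (cases "e' = e")
    case True
    then show ?thesis using below_portal_notin_hole Im_bridge[OF p] by simp
  next
    case False
    then have "p \<in> obstacles w e'" using bridge_subset_obstacles[of e e' w] assms p by auto
    then show ?thesis using hole_disjoint_obstacles[OF w]
      by (meson ball_subset_cball disjoint_iff subsetD)
  qed
  then show "p \<in> plate"
    using subsetD[OF bridge_subset_disc[OF assms] p] by (auto simp: plate_def)
qed

lemma portal_in_frontier:
  assumes "e \<in> E" "v \<in> e"
  shows "portal v e \<in> frontier plate"
proof -
  have "portal v e \<in> closure (ball (center v e) r)"
    using dist_portal_center[of v e] radius_pos by (simp add: dist_commute)
  moreover have "ball (center v e) r \<subseteq> - plate" using assms by (auto simp: plate_def)
  ultimately have "portal v e \<in> closure (- plate)" using closure_mono by blast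
  moreover have "portal v e \<in> closure plate"
    using spoke_subset_plate[OF assms] portal_in_spoke closure_subset by blast
  ultimately show ?thesis by (simp add: frontier_closures)
qed

lemma frontier_plateE:
  assumes "p \<in> frontier plate" "p \<in> ball 0 1"
  obtains e v where "e \<in> E" "v \<in> e" "p \<in> cball (center v e) r"
proof -
  let ?C = "- ball 0 1 \<union> (\<Union>(e, v)\<in>Sigma E id. cball (center v e) r)"
  have "closed ?C" using finite_incidences by (intro closed_Un closed_UN) auto
  moreover have "- plate \<subseteq> ?C"
    using ball_subset_cball by (auto simp: plate_def)
  ultimately have "closure (- plate) \<subseteq> ?C" by (intro closure_minimal)
  then show ?thesis using assms that by (auto simp: frontier_closures)
qed

lemma frontier_spoke_bridge_disjoint:
  assumes "p \<in> frontier plate" "p \<in> spoke v e" "p \<in> bridge e'" "e \<in> E" "v \<in> e" "e' \<in> E" "e \<noteq> e'"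
  shows False
proof -
  have "p \<in> ball 0 1" using bridge_subset_disc assms by blast
  then obtain e0 v0 where hole: "e0 \<in> E" "v0 \<in> e0" "p \<in> cball (center v0 e0) r"
    using frontier_plateE[OF assms(1)] by blast
  then have "p \<notin> obstacles v0 e0" using hole_disjoint_obstacles by blast
  then have "(v, e) = (v0, e0)" using spoke_subset_obstacles assms by blast
  then show False using bridge_subset_obstacles \<open>p \<notin> obstacles v0 e0\<close> assms by blast
qed

definition upper :: "complex \<Rightarrow> complex \<times> real" where
  "upper p = (p, infdist p (frontier plate))"

definition lower :: "complex \<Rightarrow> complex \<times> real" where
  "lower p = (p, - infdist p (frontier plate))"

lemma inj_upper: "inj upper" and inj_lower: "inj lower"
  by (auto simp: upper_def lower_def inj_def)

lemma continuous_on_upper: "continuous_on A upper" and continuous_on_lower: "continuous_on A lower"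
  unfolding upper_def lower_def by (intro continuous_intros)+

lemma upper_in_double: "p \<in> plate \<Longrightarrow> upper p \<in> double plate"
  and lower_in_double: "p \<in> plate \<Longrightarrow> lower p \<in> double plate"
  using infdist_nonneg[of p "frontier plate"] by (simp_all add: upper_def lower_def double_def)

lemma upper_eq_lowerD:
  assumes "upper p = lower q" "e \<in> E"
  shows "p = q" "p \<in> frontier plate"
proof -
  show "p = q" using assms(1) by (simp add: upper_def lower_def)
  then have "infdist p (frontier plate) = 0"
    using assms(1) infdist_nonneg[of p "frontier plate"] by (simp add: upper_def lower_def)
  moreover have "frontier plate \<noteq> {}"
    using portal_in_frontier[OF assms(2) edge_ends_mem(1)[OF assms(2)]] by blast
  ultimately show "p \<in> frontier plate"
    using in_closed_iff_infdist_zero[OF frontier_closed] by blast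
qed

lemma upper_portal_eq_lower: "e \<in> E \<Longrightarrow> v \<in> e \<Longrightarrow> upper (portal v e) = lower (portal v e)"
  using portal_in_frontier[of e v] by (simp add: upper_def lower_def)

definition route :: "'a set \<Rightarrow> real \<Rightarrow> complex \<times> real" where
  "route e =
     (upper \<circ> linepath (vertex (src e)) (portal (src e) e)) +++
     (lower \<circ> linepath (portal (src e) e) (portal (tgt e) e)) +++
     (upper \<circ> linepath (portal (tgt e) e) (vertex (tgt e)))"

lemma pathstart_route: "pathstart (route e) = upper (vertex (src e))"
  and pathfinish_route: "pathfinish (route e) = upper (vertex (tgt e))"
  by (simp_all add: route_def pathstart_compose pathfinish_compose)

lemma route_join_points:
  assumes "e \<in> E"
  shows "pathfinish (upper \<circ> linepath (vertex (src e)) (portal (src e) e)) =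
      pathstart (lower \<circ> linepath (portal (src e) e) (portal (tgt e) e))"
    and "pathfinish (lower \<circ> linepath (portal (src e) e) (portal (tgt e) e)) =
      pathstart (upper \<circ> linepath (portal (tgt e) e) (vertex (tgt e)))"
  using upper_portal_eq_lower[OF assms] edge_ends_mem[OF assms]
  by (simp_all add: pathstart_compose pathfinish_compose)

lemma path_image_route:
  assumes "e \<in> E"
  shows "path_image (route e) = (\<Union>v\<in>e. upper ` spoke v e) \<union> lower ` bridge e"
proof -
  have "path_image (route e) =
      upper ` spoke (src e) e \<union> (lower ` bridge e \<union> upper ` spoke (tgt e) e)"
    unfolding route_def
    by (subst path_image_join, simp only: pathstart_join route_join_points(1)[OF assms],
        subst path_image_join[OF route_join_points(2)[OF assms]])
      (simp add: path_image_compose spoke_def bridge_def closed_segment_commute)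
  moreover have "v \<in> e \<longleftrightarrow> v = src e \<or> v = tgt e" for v
    using edge_ends(1)[OF assms] by blast
  ultimately show ?thesis by auto
qed

lemma path_image_routeE:
  assumes "y \<in> path_image (route e)" "e \<in> E"
  obtains (spoke) v p where "v \<in> e" "p \<in> spoke v e" "y = upper p"
  | (bridge) p where "p \<in> bridge e" "y = lower p"
  using assms unfolding path_image_route[OF assms(2)] by blast

lemma upper_spoke_lower_bridge_meet:
  assumes "y \<in> upper ` spoke v e" "y \<in> lower ` bridge e" "e \<in> E"
  shows "y = upper (portal v e)"
proof -
  obtain p q where "y = upper p" "p \<in> spoke v e" "y = lower q" "q \<in> bridge e"
    using assms(1,2) by blast
  then show ?thesis
    using upper_eq_lowerD(1)[of p q e] spoke_bridge_meet assms(3) by simp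
qed

lemma arc_route:
  assumes e: "e \<in> E"
  shows "arc (route e)"
proof -
  note ends = edge_ends_mem[OF e]
  let ?up = "upper \<circ> linepath (vertex (src e)) (portal (src e) e)"
  let ?across = "lower \<circ> linepath (portal (src e) e) (portal (tgt e) e)"
  let ?down = "upper \<circ> linepath (portal (tgt e) e) (vertex (tgt e))"
  have image: "path_image ?up = upper ` spoke (src e) e" "path_image ?across = lower ` bridge e"
    "path_image ?down = upper ` spoke (tgt e) e"
    by (simp_all add: path_image_compose spoke_def bridge_def closed_segment_commute)
  have spokes: "upper ` spoke (src e) e \<inter> upper ` spoke (tgt e) e = {}"
    using spokes_of_distinct_vertices_disjoint[OF _ _ e e ends] edge_ends(2)[OF e]
      injD[OF inj_upper] by blast
  have "portal (tgt e) e \<notin> spoke (src e) e"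
    using spokes_of_distinct_vertices_disjoint[OF _ portal_in_spoke e e ends] edge_ends(2)[OF e]
    by blast
  then have "portal (src e) e \<noteq> portal (tgt e) e"
    using portal_in_spoke[of "src e" e] by auto
  then have arcs: "arc ?up" "arc ?across" "arc ?down"
    using vertex_neq_portal[OF e] vertex_neq_portal[OF e, symmetric]
    by (auto intro!: arc_compose arc_linepath continuous_on_upper continuous_on_lower inj_upper
      inj_lower)
  have across_down: "arc (?across +++ ?down)"
    using upper_spoke_lower_bridge_meet[OF _ _ e] image
    by (intro arc_join arcs route_join_points(2)[OF e]) (auto simp: pathstart_compose)
  moreover have "path_image ?up \<inter> path_image (?across +++ ?down) \<subseteq> {pathstart ?across}"
    using upper_spoke_lower_bridge_meet[OF _ _ e] image spokes
    by (auto simp: path_image_join[OF route_join_points(2)[OF e]] pathstart_compose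
        simp flip: upper_portal_eq_lower[OF e ends(1)])
  ultimately show ?thesis
    unfolding route_def using route_join_points(1)[OF e]
    by (intro arc_join arcs across_down) simp_all
qed

lemma route_subset_double: "e \<in> E \<Longrightarrow> path_image (route e) \<subseteq> double plate"
  using spoke_subset_plate bridge_subset_plate upper_in_double lower_in_double
  by (simp add: path_image_route) blast

lemma route_vertices:
  assumes e: "e \<in> E"
  shows "path_image (route e) \<inter> (upper \<circ> vertex) ` V = (upper \<circ> vertex) ` e"
proof (intro equalityI subsetI)
  fix y assume "y \<in> path_image (route e) \<inter> (upper \<circ> vertex) ` V"
  then obtain v where v: "y = upper (vertex v)" and y: "y \<in> path_image (route e)" by auto
  from y e show "y \<in> (upper \<circ> vertex) ` e"
  proof (cases rule: path_image_routeE)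
    case (spoke w p)
    then have "vertex v \<in> spoke w e" using v inj_upper by (auto dest: injD)
    then have "vertex v = vertex w"
      using spokeE[of "vertex v" w e] h_bounds(1)[OF e] by (auto simp: vertex_def)
    then show ?thesis using spoke(1) v by auto
  next
    case (bridge p)
    then have "vertex v \<in> bridge e" using v upper_eq_lowerD(1)[OF _ e] by metis
    then show ?thesis using vertex_notin_bridge[OF e] by blast
  qed
next
  fix y assume "y \<in> (upper \<circ> vertex) ` e"
  then obtain v where "v \<in> e" "y = upper (vertex v)" by auto
  then show "y \<in> path_image (route e) \<inter> (upper \<circ> vertex) ` V"
    using path_image_route[OF e] vertex_in_spoke[of v e] edge_subset[OF e] by auto
qed

lemma routes_meet_subset:
  assumes "e \<in> E" "e' \<in> E" "e \<noteq> e'"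
  shows "path_image (route e) \<inter> path_image (route e') \<subseteq> (upper \<circ> vertex) ` (e \<inter> e')"
proof
  have crossing: False
    if "upper p = lower q" "p \<in> spoke v a" "q \<in> bridge b" "a \<in> E" "v \<in> a" "b \<in> E" "a \<noteq> b"
      for p q v a b
    using upper_eq_lowerD[OF that(1,4)] frontier_spoke_bridge_disjoint that by blast
  fix y assume "y \<in> path_image (route e) \<inter> path_image (route e')"
  then have y: "y \<in> path_image (route e)" "y \<in> path_image (route e')" by auto
  from y(1) assms(1) show "y \<in> (upper \<circ> vertex) ` (e \<inter> e')"
  proof (cases rule: path_image_routeE)
    case (spoke v p)
    from y(2) assms(2) show ?thesis
    proof (cases rule: path_image_routeE)
      case spoke': (spoke v' p')
      then have p: "p \<in> spoke v' e'" using spoke(3) inj_upper by (auto dest: injD)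
      then have "v = v'"
        using spokes_of_distinct_vertices_disjoint[OF spoke(2) p] assms spoke(1) spoke'(1) by blast
      moreover from this have "p = vertex v" using spokes_of_vertex_meet[OF spoke(2)] p assms
        by blast
      ultimately show ?thesis using spoke spoke' by auto
    next
      case (bridge q)
      then show ?thesis using crossing[of p q v e e'] spoke assms by simp
    qed
  next
    case (bridge q)
    from y(2) assms(2) show ?thesis
    proof (cases rule: path_image_routeE)
      case (spoke v' p')
      then show ?thesis using crossing[of p' q v' e' e] bridge assms by simp
    next
      case bridge': (bridge q')
      then have "q = q'" using bridge(2) inj_lower by (auto dest: injD)
      then show ?thesis using bridges_disjoint bridge bridge' assms by blast
    qed
  qed
qed

lemma embeds_in_double_plate: "embeds_in V E (double plate)"
  unfolding embeds_in_def
proof (intro exI[of _ "upper \<circ> vertex"] exI[of _ route] conjI ballI impI)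
  show "inj_on (upper \<circ> vertex) V"
    using inj_on_vertex inj_upper by (intro comp_inj_on) (auto intro: inj_on_subset)
  show "(upper \<circ> vertex) ` V \<subseteq> double plate"
    using upper_in_double vertex_in_plate by auto
  fix e assume e: "e \<in> E"
  show "arc (route e)" "path_image (route e) \<subseteq> double plate"
    "path_image (route e) \<inter> (upper \<circ> vertex) ` V = (upper \<circ> vertex) ` e"
    using e by (rule arc_route route_subset_double route_vertices)+
  show "{pathstart (route e), pathfinish (route e)} = (upper \<circ> vertex) ` e"
    by (subst (3) edge_ends(1)[OF e]) (simp add: pathstart_route pathfinish_route)
  fix e' assume e': "e' \<in> E" "e \<noteq> e'"
  have "(upper \<circ> vertex) ` (e \<inter> e') \<subseteq> path_image (route e) \<inter> path_image (route e')"
    using route_vertices[OF e] route_vertices[OF e'(1)] by blast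
  then show "path_image (route e) \<inter> path_image (route e') = (upper \<circ> vertex) ` (e \<inter> e')"
    using routes_meet_subset[OF e e'] by blast
qed

end

lemma (in graph_drawing) graph_genus_le: "graph_genus V E \<le> 2 * card E"
proof -
  obtain r where "r > 0" "\<forall>e\<in>E. \<forall>v\<in>e. cball (portal v e) (4 * r) \<inter> obstacles v e = {}"
    using ex_clearance by blast
  then interpret drilled_drawing V E src tgt x h \<delta> r
    by unfold_locales auto
  have "orientable_surface (2 * card E) (double plate)"
    unfolding orientable_surface_def using disc_with_holes_plate by blast
  then show ?thesis
    unfolding graph_genus_def using embeds_in_double_plate by (intro Least_le) blast
qed

theorem graph_genus_le_edges:
  assumes "finite V" and edges: "\<And>e. e \<in> E \<Longrightarrow> e \<subseteq> V \<and> card e = 2"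
  shows "graph_genus V E \<le> 2 * card E"
proof -
  have finE: "finite E"
    using edges finite_subset[of E "Pow V"] assms(1) by auto
  obtain num where num: "bij_betw num V {..<card V}"
    using ex_bij_betw_finite_nat[OF assms(1)] by (auto simp: atLeast0LessThan)
  obtain ix where ix: "bij_betw ix E {..<card E}"
    using ex_bij_betw_finite_nat[OF finE] by (auto simp: atLeast0LessThan)
  have "\<forall>e\<in>E. \<exists>u w. e = {u, w} \<and> u \<noteq> w"
    using edges by (simp add: card_2_iff)
  then obtain src tgt where ends: "\<And>e. e \<in> E \<Longrightarrow> e = {src e, tgt e}" "\<And>e. e \<in> E \<Longrightarrow> src e \<noteq> tgt e"
    by metis
  define \<delta> :: real where "\<delta> = 1 / (2 * (real (card V) + 1))"
  define x where "x v = real (num v) * \<delta>" for v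
  define h where "h e = (real (ix e) + 1) / (2 * (real (card E) + 1))" for e
  have \<delta>: "\<delta> > 0" by (simp add: \<delta>_def)
  interpret graph_drawing V E src tgt x h \<delta>
  proof
    show "x v + \<delta> \<le> 1 / 2" if "v \<in> V" for v
    proof -
      have "real (num v) + 1 \<le> real (card V) + 1" using bij_betwE[OF num] that by fastforce
      then have "(real (num v) + 1) * \<delta> \<le> (real (card V) + 1) * \<delta>"
        using \<delta> by (intro mult_right_mono) auto
      also have "\<dots> = 1 / 2" by (simp add: \<delta>_def field_simps)
      finally show ?thesis by (simp add: x_def algebra_simps)
    qed
    show "\<delta> \<le> \<bar>x v - x w\<bar>" if "v \<in> V" "w \<in> V" "v \<noteq> w" for v w
    proof -
      have "num v \<noteq> num w" using num that by (auto simp: bij_betw_def dest: inj_onD)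
      then have "1 * \<delta> \<le> \<bar>real (num v) - real (num w)\<bar> * \<delta>" using \<delta> by (intro mult_right_mono) auto
      also have "\<dots> = \<bar>x v - x w\<bar>" using \<delta> by (simp add: x_def abs_mult flip: left_diff_distrib)
      finally show ?thesis by simp
    qed
    show "h e < 1 / 2" if "e \<in> E" for e
      using bij_betwE[OF ix] that by (fastforce simp: h_def field_simps)
    show "inj_on h E"
      using ix by (auto simp: h_def inj_on_def bij_betw_def field_simps)
  qed (use finE edges ends \<delta> in \<open>auto simp: x_def h_def\<close>)
  show ?thesis by (rule graph_genus_le)
qed

subsection \<open>Values of gates\<close>

lemma vertex_values_snoc:
  "vertex_values f (C @ [G]) = vertex_values f C @ [f (vertex_values f C) G]"
  by (simp add: vertex_values_def)

lemma length_vertex_values [simp]: "length (vertex_values f C) = length C"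
  by (induction C rule: rev_induct) (auto simp: vertex_values_snoc, simp add: vertex_values_def)

lemma take_vertex_values: "take i (vertex_values f C) = vertex_values f (take i C)"
proof (induction C rule: rev_induct)
  case Nil
  show ?case by (simp add: vertex_values_def)
next
  case (snoc G C)
  then show ?case by (cases "i \<le> length C") (auto simp: vertex_values_snoc)
qed

lemma last_vertex_values: "C \<noteq> [] \<Longrightarrow> last (vertex_values f C) = vertex_values f C ! (length C - 1)"
  by (metis last_conv_nth length_0_conv length_vertex_values)

lemma vertex_values_nth:
  assumes "wf_circuit C" "i < length C"
    and cong: "\<And>vs ws G. (\<And>j. j \<in> set (fan_in G) \<Longrightarrow> vs ! j = ws ! j) \<Longrightarrow> f vs G = f ws G"
  shows "vertex_values f C ! i = f (vertex_values f C) (C ! i)"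
proof -
  have "vertex_values f C ! i = take (Suc i) (vertex_values f C) ! i" by simp
  also have "\<dots> = vertex_values f (take i C @ [C ! i]) ! i"
    using assms(2) by (simp only: take_vertex_values take_Suc_conv_app_nth)
  also have "\<dots> = f (take i (vertex_values f C)) (C ! i)"
    using assms(2) by (simp add: vertex_values_snoc nth_append take_vertex_values)
  also have "\<dots> = f (vertex_values f C) (C ! i)"
    using assms(1,2) by (intro cong) (auto simp: wf_circuit_def)
  finally show ?thesis .
qed

lemma fan_in_less: "wf_circuit C \<Longrightarrow> i < length C \<Longrightarrow> j \<in> set (fan_in (C ! i)) \<Longrightarrow> j < i"
  by (auto simp: wf_circuit_def)

lemma distinct_fan_in: "wf_circuit C \<Longrightarrow> i < length C \<Longrightarrow> distinct (fan_in (C ! i))"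
  by (simp add: wf_circuit_def)

lemma fan_in_nonempty: "wf_circuit C \<Longrightarrow> i < length C \<Longrightarrow> \<not> is_LIT (C ! i) \<Longrightarrow> fan_in (C ! i) \<noteq> []"
  by (auto simp: wf_circuit_def)

lemma length_fan_in_le:
  assumes "wf_circuit C" "i < length C"
  shows "length (fan_in (C ! i)) \<le> length C"
proof -
  have "set (fan_in (C ! i)) \<subseteq> {..<length C}"
    using fan_in_less[OF assms] assms(2) by fastforce
  from card_mono[OF _ this] show ?thesis
    using distinct_card[OF distinct_fan_in[OF assms]] by simp
qed

definition gate_value :: "nat set \<Rightarrow> circuit \<Rightarrow> nat \<Rightarrow> bool" where
  "gate_value S C i = vertex_values (gate_eval S) C ! i"

lemma gate_value_simps:
  assumes "wf_circuit C" "i < length C"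
  shows "C ! i = LIT b v \<Longrightarrow> gate_value S C i \<longleftrightarrow> (v \<in> S) = b"
    and "C ! i = NOT j \<Longrightarrow> gate_value S C i \<longleftrightarrow> \<not> gate_value S C j"
    and "C ! i = AND js \<Longrightarrow> gate_value S C i \<longleftrightarrow> (\<forall>j\<in>set js. gate_value S C j)"
    and "C ! i = OR js \<Longrightarrow> gate_value S C i \<longleftrightarrow> (\<exists>j\<in>set js. gate_value S C j)"
proof -
  have "gate_eval S vs G = gate_eval S ws G" if "\<And>j. j \<in> set (fan_in G) \<Longrightarrow> vs ! j = ws ! j"
    for vs ws G
    using that by (cases G) auto
  from vertex_values_nth[OF assms, of "gate_eval S", OF this]
  show "C ! i = LIT b v \<Longrightarrow> gate_value S C i \<longleftrightarrow> (v \<in> S) = b"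
    "C ! i = NOT j \<Longrightarrow> gate_value S C i \<longleftrightarrow> \<not> gate_value S C j"
    "C ! i = AND js \<Longrightarrow> gate_value S C i \<longleftrightarrow> (\<forall>j\<in>set js. gate_value S C j)"
    "C ! i = OR js \<Longrightarrow> gate_value S C i \<longleftrightarrow> (\<exists>j\<in>set js. gate_value S C j)"
    by (simp_all add: gate_value_def)
qed

lemma satisfies_gate_value: "C \<noteq> [] \<Longrightarrow> satisfies S C \<longleftrightarrow> gate_value S C (length C - 1)"
  by (simp add: satisfies_def gate_value_def last_vertex_values)

definition path_value :: "(gate \<Rightarrow> bool) \<Rightarrow> circuit \<Rightarrow> nat \<Rightarrow> nat" where
  "path_value P C i =
     vertex_values (\<lambda>vs G. of_bool (P G) + Max (insert 0 ((\<lambda>j. vs ! j) ` set (fan_in G)))) C ! i"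

lemma max_on_path_path_value: "C \<noteq> [] \<Longrightarrow> max_on_path P C = path_value P C (length C - 1)"
  by (simp add: max_on_path_def path_value_def last_vertex_values)

lemma path_value_unfold:
  assumes "wf_circuit C" "i < length C"
  shows "path_value P C i =
      of_bool (P (C ! i)) + Max (insert 0 (path_value P C ` set (fan_in (C ! i))))"
  unfolding path_value_def by (subst vertex_values_nth[OF assms]) (auto cong: image_cong)

lemma path_value_fan_in:
  assumes "wf_circuit C" "i < length C" "j \<in> set (fan_in (C ! i))"
  shows "of_bool (P (C ! i)) + path_value P C j \<le> path_value P C i"
  unfolding path_value_unfold[OF assms(1,2)] using assms(3) by (intro add_left_mono Max_ge) auto

lemma path_value_ge: "wf_circuit C \<Longrightarrow> i < length C \<Longrightarrow> of_bool (P (C ! i)) \<le> path_value P C i"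
  by (simp add: path_value_unfold)

lemma path_value_LIT:
  "wf_circuit C \<Longrightarrow> i < length C \<Longrightarrow> is_LIT (C ! i) \<Longrightarrow> path_value (\<lambda>G. \<not> is_LIT G) C i = 0"
  by (cases "C ! i") (simp_all add: path_value_unfold)

lemma path_value_le:
  assumes wf: "wf_circuit C"
    and fan_in: "\<And>i j. i < length C \<Longrightarrow> j \<in> set (fan_in (C ! i)) \<Longrightarrow> of_bool (P (C ! i)) + \<rho> j \<le> \<rho> i"
    and gate: "\<And>i. i < length C \<Longrightarrow> of_bool (P (C ! i)) \<le> \<rho> i"
    and "i < length C"
  shows "path_value P C i \<le> \<rho> i"
  using assms(4)
proof (induction i rule: less_induct)
  case (less i)
  have "of_bool (P (C ! i)) + y \<le> \<rho> i" if "y \<in> insert 0 (path_value P C ` set (fan_in (C ! i)))"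
    for y
  proof (cases "y = 0")
    case False
    with that have "y \<in> path_value P C ` set (fan_in (C ! i))" by blast
    then obtain j where j: "j \<in> set (fan_in (C ! i))" "y = path_value P C j" by blast
    then have "y \<le> \<rho> j" using less fan_in_less[OF wf less.prems j(1)] by simp
    then show ?thesis using fan_in[OF less.prems j(1)] by simp
  qed (simp add: gate less.prems)
  then show ?case
    unfolding path_value_unfold[OF wf less.prems]
    using Max_in[of "insert 0 (path_value P C ` set (fan_in (C ! i)))"] by blast
qed

lemma weft_le_depth:
  assumes wf: "wf_circuit C"
  shows "weft C \<le> depth C"
proof -
  have "C \<noteq> []" using wf by (simp add: wf_circuit_def)
  have "of_bool (2 < length (fan_in G)) \<le> (of_bool (\<not> is_LIT G) :: nat)" for G by (cases G) auto
  then have "path_value (\<lambda>G. 2 < length (fan_in G)) C (length C - 1) \<le>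
      path_value (\<lambda>G. \<not> is_LIT G) C (length C - 1)"
    using path_value_fan_in[OF wf, of _ _ "\<lambda>G. \<not> is_LIT G"]
      path_value_ge[OF wf, of _ "\<lambda>G. \<not> is_LIT G"] \<open>C \<noteq> []\<close>
    by (intro path_value_le[OF wf]) (meson add_le_mono1 order_trans | simp)+
  then show ?thesis
    using max_on_path_path_value[OF \<open>C \<noteq> []\<close>] by (simp add: weft_def depth_def)
qed

subsection \<open>Alternating bounded quantifiers\<close>

definition quant :: "bool \<Rightarrow> nat \<Rightarrow> (nat \<Rightarrow> bool) \<Rightarrow> bool" where
  "quant b R P \<longleftrightarrow> (if b then \<exists>g<R. P g else \<forall>g<R. P g)"

primrec alt_quant :: "nat \<Rightarrow> bool \<Rightarrow> nat \<Rightarrow> (nat list \<Rightarrow> bool) \<Rightarrow> bool" where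
  "alt_quant R b 0 P = P []"
| "alt_quant R b (Suc n) P = quant b R (\<lambda>g. alt_quant R (\<not> b) n (\<lambda>gs. P (g # gs)))"

lemma quant_simps [simp]: "quant True R P \<longleftrightarrow> (\<exists>g<R. P g)" "quant False R P \<longleftrightarrow> (\<forall>g<R. P g)"
  by (simp_all add: quant_def)

lemma quant_cong: "(\<And>g. g < R \<Longrightarrow> P g = P' g) \<Longrightarrow> quant b R P = quant b R P'"
  by (auto simp: quant_def)

lemma quant_const: "0 < R \<Longrightarrow> quant b R (\<lambda>_. c) = c"
  by (auto simp: quant_def)

lemma quant_set:
  "(if b then \<exists>j\<in>set js. P j else \<forall>j\<in>set js. P j) \<longleftrightarrow> quant b (length js) (\<lambda>a. P (js ! a))"
  unfolding quant_def by (metis in_set_conv_nth)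

lemma mult_add_less: "J < (K::nat) \<Longrightarrow> c < B \<Longrightarrow> J * B + c < K * B"
proof -
  assume "J < K" "c < B"
  then have "J * B + c < (J + 1) * B" by simp
  also have "\<dots> \<le> K * B" using \<open>J < K\<close> by (intro mult_le_mono1) simp
  finally show ?thesis .
qed

lemma quant_pair: "quant b (r * r) (\<lambda>g. P (g div r) (g mod r)) \<longleftrightarrow> quant b r (\<lambda>a. quant b r (P a))"
proof -
  have ex: "(\<exists>g<r * r. P (g div r) (g mod r)) \<longleftrightarrow> (\<exists>a<r. \<exists>c<r. P a c)" for P
  proof
    assume "\<exists>g<r * r. P (g div r) (g mod r)"
    then obtain g where "g < r * r" "P (g div r) (g mod r)" by blast
    moreover from this have "g div r < r" "g mod r < r"
      by (cases "r = 0"; simp add: less_mult_imp_div_less)+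
    ultimately show "\<exists>a<r. \<exists>c<r. P a c" by blast
  next
    assume "\<exists>a<r. \<exists>c<r. P a c"
    then obtain a c where "a < r" "c < r" "P a c" by blast
    then show "\<exists>g<r * r. P (g div r) (g mod r)"
      using mult_add_less[of a r c r] by (intro exI[of _ "a * r + c"]) simp
  qed
  show ?thesis using ex[of P] ex[of "\<lambda>a c. \<not> P a c"] by (cases b) auto
qed

lemma alt_quant_cong:
  "(\<And>gs. length gs = n \<Longrightarrow> (\<forall>g\<in>set gs. g < R) \<Longrightarrow> P gs = P' gs) \<Longrightarrow>
      alt_quant R b n P = alt_quant R b n P'"
proof (induction n arbitrary: b P P')
  case (Suc n)
  show ?case unfolding alt_quant.simps by (intro quant_cong Suc.IH Suc.prems) auto
qed simp

lemma alt_quant_mono: "alt_quant R b n P \<Longrightarrow> (\<And>gs. P gs \<Longrightarrow> P' gs) \<Longrightarrow> alt_quant R b n P'"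
proof (induction n arbitrary: b P P')
  case (Suc n)
  have "alt_quant R (\<not> b) n (\<lambda>gs. P' (g # gs))" if "alt_quant R (\<not> b) n (\<lambda>gs. P (g # gs))" for g
    using that Suc.prems(2) by (rule Suc.IH)
  then show ?case using Suc.prems(1) by (auto simp: quant_def split: if_splits)
qed simp

lemma alt_quant_const: "0 < R \<Longrightarrow> alt_quant R b n (\<lambda>_. c) = c"
  by (induction n arbitrary: b) (simp_all add: quant_const)

lemma alt_quant_snoc:
  "alt_quant R b (Suc n) P \<longleftrightarrow> alt_quant R b n (\<lambda>gs. quant (b = even n) R (\<lambda>h. P (gs @ [h])))"
proof (induction n arbitrary: b P)
  case (Suc n)
  have "alt_quant R b (Suc (Suc n)) P \<longleftrightarrow>
      quant b R (\<lambda>g. alt_quant R (\<not> b) n (\<lambda>gs. quant ((\<not> b) = even n) R (\<lambda>h. P (g # gs @ [h]))))"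
    unfolding alt_quant.simps(2)[of R b "Suc n"] Suc.IH by simp
  also have "((\<not> b) = even n) = (b = even (Suc n))" by auto
  finally show ?case by simp
qed simp

text \<open>Little-endian; \<open>digits\<close> and \<open>horner\<close> are big-endian.\<close>

definition digit :: "nat \<Rightarrow> nat \<Rightarrow> nat \<Rightarrow> nat" where
  "digit B y p = y div B ^ p mod B"

lemma digit_Suc_div: "digit B y (Suc p) = digit B (y div B) p"
  by (simp add: digit_def div_mult2_eq)

lemma ex_digits:
  assumes "\<And>p. p < d \<Longrightarrow> f p < B"
  shows "\<exists>y<B ^ d. \<forall>p<d. digit B y p = f p"
  using assms
proof (induction d arbitrary: f)
  case (Suc d)
  from Suc.IH[of "\<lambda>p. f (Suc p)"] Suc.prems
  obtain y where y: "y < B ^ d" "\<forall>p<d. digit B y p = f (Suc p)" by auto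
  have f0: "f 0 < B" using Suc.prems by simp
  have "digit B (y * B + f 0) p = f p" if "p < Suc d" for p
    using that y(2) f0 by (cases p) (simp_all add: digit_Suc_div, simp add: digit_def)
  moreover have "y * B + f 0 < B ^ Suc d" using mult_add_less[OF y(1) f0]
    by (simp add: mult.commute)
  ultimately show ?case by blast
qed simp

definition digits :: "nat \<Rightarrow> nat \<Rightarrow> nat \<Rightarrow> nat list" where
  "digits R t j = map (\<lambda>p. digit R j (t - 1 - p)) [0..<t]"

abbreviation horner :: "nat \<Rightarrow> nat \<Rightarrow> nat list \<Rightarrow> nat" where
  "horner R \<equiv> foldl (\<lambda>a g. a * R + g)"

lemma digits_snoc:
  assumes "g < R"
  shows "digits R (Suc t) (j * R + g) = digits R t j @ [g]"
proof -
  have "digit R (j * R + g) (t - p) = digit R j (t - 1 - p)" if "p < t" for p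
    using digit_Suc_div[of R "j * R + g" "t - 1 - p"] that assms by (simp add: Suc_diff_Suc)
  then show ?thesis using assms by (auto simp: digits_def digit_def[of _ _ 0])
qed

lemma digits_horner: "\<forall>g\<in>set gs. g < R \<Longrightarrow> digits R (length gs) (horner R 0 gs) = gs"
proof (induction gs rule: rev_induct)
  case Nil
  show ?case by (simp add: digits_def)
next
  case (snoc g gs)
  then show ?case by (simp add: digits_snoc)
qed

lemma all_alt_quant_digits:
  assumes "2 \<le> t" "0 < R"
  shows "(\<forall>j<R ^ 2. alt_quant R True (t - 2) (\<lambda>gs. P (digits R t (horner R j gs)))) \<longleftrightarrow>
    (\<forall>g<R. alt_quant R False (t - 1) (\<lambda>gs. P (g # gs)))"
proof -
  have "alt_quant R True (t - 2) (\<lambda>gs. P (digits R t (horner R (g * R + g') gs))) \<longleftrightarrow>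
      alt_quant R True (t - 2) (\<lambda>gs. P (g # g' # gs))" if "g < R" "g' < R" for g g'
  proof (rule alt_quant_cong)
    fix gs assume "length gs = t - 2" "\<forall>x\<in>set gs. x < R"
    moreover from this have "length (g # g' # gs) = t" using assms(1) by simp
    ultimately show "P (digits R t (horner R (g * R + g') gs)) = P (g # g' # gs)"
      using digits_horner[of "g # g' # gs" R] that by (simp del: list.size)
  qed
  moreover have "R ^ 2 = R * R" "t - 1 = Suc (t - 2)" using assms(1)
    by (simp_all add: power2_eq_square)
  ultimately show ?thesis
    using quant_pair[of False R "\<lambda>a c. alt_quant R True (t - 2) (\<lambda>gs. P (digits R t (horner R (a * R + c) gs)))"]
    by simp
qed

subsection \<open>Layered circuits\<close>

lemma concat_nth_offset:
  "d < n \<Longrightarrow> j < length (L d) \<Longrightarrow> concat (map L [0..<n]) ! ((\<Sum>d'<d. length (L d')) + j) = L d ! j"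
proof (induction n)
  case (Suc n)
  have len: "length (concat (map L [0..<n])) = (\<Sum>d'<n. length (L d'))" for n
    by (induction n) auto
  show ?case
  proof (cases "d = n")
    case True
    then show ?thesis using Suc.prems by (simp add: nth_append len[symmetric])
  next
    case False
    then have d: "d < n" using Suc.prems by simp
    have "(\<Sum>d'<d. length (L d')) + j < (\<Sum>d'<Suc d. length (L d'))" using Suc.prems by simp
    also have "\<dots> \<le> (\<Sum>d'<n. length (L d'))" using d by (intro sum_mono2) auto
    finally show ?thesis using Suc.IH[OF d Suc.prems(2)] by (simp add: nth_append len)
  qed
qed simp

lemma sum_offset_cases:
  fixes s :: "nat \<Rightarrow> nat"
  assumes "i < (\<Sum>d<n. s d)"
  obtains d j where "d < n" "j < s d" "i = (\<Sum>d'<d. s d') + j"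
proof -
  have "\<exists>d<n. \<exists>j<s d. i = (\<Sum>d'<d. s d') + j"
    using assms
  proof (induction n)
    case (Suc n)
    show ?case
    proof (cases "i < (\<Sum>d<n. s d)")
      case True
      then show ?thesis using Suc.IH less_SucI by blast
    next
      case False
      then show ?thesis using Suc.prems
        by (intro exI[of _ n]) (auto intro!: exI[of _ "i - (\<Sum>d<n. s d)"])
    qed
  qed simp
  then show ?thesis using that by blast
qed

lemma set_upt_offset: "set [a..<a + n] = (\<lambda>i. a + i) ` {..<n}"
  by (simp add: lessThan_atLeast0 add.commute[of n])

definition connective :: "bool \<Rightarrow> nat list \<Rightarrow> gate" where
  "connective b js = (if b then OR js else AND js)"

lemma connective_simps [simp]:
  "fan_in (connective b js) = js" "is_OR (connective b js) \<longleftrightarrow> b" "is_AND (connective b js) \<longleftrightarrow> \<not> b"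
  "\<not> is_LIT (connective b js)" "\<not> is_NOT (connective b js)"
  by (simp_all add: connective_def)

lemma gate_cases [case_names LIT NOT connective]:
  obtains c v where "G = LIT c v" | j where "G = NOT j" | any js where "G = connective any js"
  using that(3)[of False] that(3)[of True] that(1,2) by (cases G) (simp_all add: connective_def)

lemma gate_value_quant:
  assumes "wf_circuit C" "i < length C" "C ! i = connective any js"
  shows "gate_value S C i \<longleftrightarrow> quant any (length js) (\<lambda>a. gate_value S C (js ! a))"
  using gate_value_simps(3,4)[OF assms(1,2)] assms(3)
  unfolding quant_set[symmetric] by (auto simp: connective_def split: if_splits)

lemma gate_value_eq_quant:
  assumes "wf_circuit C" "i < length C" "C ! i = connective any js"
  shows "gate_value S C i = b \<longleftrightarrow> quant (any = b) (length js) (\<lambda>a. gate_value S C (js ! a) = b)"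
  unfolding gate_value_quant[OF assms] by (cases b; cases any) auto

text \<open>
  The variables \<open>0, \<dots>, N - 1\<close>, of which the gates only use \<open>0, \<dots>, V\<close>, are followed by \<open>Q\<close> clauses
  and, for \<open>d < t - 1\<close>, by a level of \<open>R ^ (t - d)\<close> gates. The gate \<open>j\<close> of a level \<open>d > 0\<close> has the
  inputs \<open>j * R, \<dots>, j * R + R - 1\<close> on the level below. The output is the conjunction of all clauses
  and of the highest level.
\<close>

definition level_offset :: "nat \<Rightarrow> nat \<Rightarrow> nat \<Rightarrow> nat \<Rightarrow> nat \<Rightarrow> nat" where
  "level_offset N Q R t d = N + Q + (\<Sum>d'<d. R ^ (t - d'))"

definition bottom_gate :: "nat \<Rightarrow> (nat \<Rightarrow> bool) \<Rightarrow> gate" where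
  "bottom_gate V p = OR (filter p [0..<Suc V])"

definition level_gate ::
  "nat \<Rightarrow> nat \<Rightarrow> nat \<Rightarrow> nat \<Rightarrow> nat \<Rightarrow> (nat \<Rightarrow> nat \<Rightarrow> bool) \<Rightarrow> nat \<Rightarrow> nat \<Rightarrow> gate" where
  "level_gate N V Q R t leaf d j =
     (if d = 0 then bottom_gate V (leaf j)
      else connective (even (t - d))
        [level_offset N Q R t (d - 1) + j * R..<level_offset N Q R t (d - 1) + j * R + R])"

definition layered_circuit ::
  "nat \<Rightarrow> nat \<Rightarrow> nat \<Rightarrow> nat \<Rightarrow> nat \<Rightarrow> (nat \<Rightarrow> nat \<Rightarrow> bool) \<Rightarrow> (nat \<Rightarrow> nat \<Rightarrow> bool) \<Rightarrow> circuit" where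
  "layered_circuit N V Q R t clause leaf =
     map (LIT True) [0..<N] @ map (\<lambda>c. bottom_gate V (clause c)) [0..<Q] @
     concat (map (\<lambda>d. map (level_gate N V Q R t leaf d) [0..<R ^ (t - d)]) [0..<t - 1]) @
     [AND ([N..<N + Q] @ [level_offset N Q R t (t - 2)..<level_offset N Q R t (t - 2) + R ^ 2])]"

lemma bottom_gate_simps [simp]:
  "set (fan_in (bottom_gate V p)) = {r. r \<le> V \<and> p r}" "distinct (fan_in (bottom_gate V p))"
  "is_OR (bottom_gate V p)" "\<not> is_AND (bottom_gate V p)" "\<not> is_LIT (bottom_gate V p)"
    "\<not> is_NOT (bottom_gate V p)"
  by (auto simp: bottom_gate_def simp del: upt_Suc)

locale layered =
  fixes N V Q R t :: nat and clause leaf :: "nat \<Rightarrow> nat \<Rightarrow> bool"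
  assumes V_less: "V < N" and R_pos: "0 < R" and two_le_t: "2 \<le> t" and even_t: "even t"
    and clause_nonempty: "\<And>c. c < Q \<Longrightarrow> \<exists>r\<le>V. clause c r"
    and leaf_nonempty: "\<And>j. \<exists>r\<le>V. leaf j r"
begin

abbreviation "off \<equiv> level_offset N Q R t"
abbreviation "C \<equiv> layered_circuit N V Q R t clause leaf"

lemma off_0: "off 0 = N + Q"
  by (simp add: level_offset_def)

lemma off_Suc: "off (Suc d) = off d + R ^ (t - d)"
  by (simp add: level_offset_def)

lemma off_mono: "d \<le> d' \<Longrightarrow> off d \<le> off d'"
  unfolding level_offset_def by (intro add_left_mono sum_mono2) auto

lemma off_ge: "N + Q \<le> off d"
  by (simp add: level_offset_def)

lemma N_le_off: "N \<le> off d"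
  by (simp add: level_offset_def)

lemma off_top: "off (t - 1) = off (t - 2) + R ^ 2"
  using off_Suc[of "t - 2"] two_le_t by (simp add: Suc_diff_Suc numeral_2_eq_2)

lemma length_C: "length C = Suc (off (t - 1))"
  by (simp add: layered_circuit_def level_offset_def length_concat sum_list_sum_nth
    atLeast0LessThan)

lemma nth_variable: "i < N \<Longrightarrow> C ! i = LIT True i"
  by (simp add: layered_circuit_def nth_append)

lemma nth_clause: "c < Q \<Longrightarrow> C ! (N + c) = bottom_gate V (clause c)"
  by (simp add: layered_circuit_def nth_append)

lemma nth_level:
  assumes "d < t - 1" "j < R ^ (t - d)"
  shows "C ! (off d + j) = level_gate N V Q R t leaf d j"
proof -
  let ?L = "\<lambda>d. map (level_gate N V Q R t leaf d) [0..<R ^ (t - d)]"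
  have "concat (map ?L [0..<t - 1]) ! ((\<Sum>d'<d. length (?L d')) + j) = ?L d ! j"
    using assms by (intro concat_nth_offset) auto
  moreover have "off d + j < off (t - 1)"
    using off_Suc[of d] off_mono[of "Suc d" "t - 1"] assms by simp
  moreover have "length (concat (map ?L [0..<t - 1])) = (\<Sum>d'<t - 1. R ^ (t - d'))"
    by (simp add: length_concat sum_list_sum_nth atLeast0LessThan)
  ultimately show ?thesis
    using assms by (simp add: layered_circuit_def nth_append level_offset_def add.assoc)
qed

lemma nth_root: "C ! off (t - 1) = AND ([N..<N + Q] @ [off (t - 2)..<off (t - 2) + R ^ 2])"
proof -
  have "C ! off (t - 1) = last C" using length_C
    by (metis diff_Suc_1 last_conv_nth length_0_conv nat.distinct(1))
  then show ?thesis by (simp add: layered_circuit_def)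
qed

lemma vertex_cases:
  assumes "i < length C"
  obtains (variable) "i < N" "C ! i = LIT True i"
  | (bottom) p where "N \<le> i" "i < off 1" "C ! i = bottom_gate V p" "\<exists>r\<le>V. p r"
  | (inner) d j where "Suc d < t - 1" "j < R ^ (t - Suc d)" "i = off (Suc d) + j"
      "C ! i = connective (even (t - Suc d)) [off d + j * R..<off d + j * R + R]"
  | (root) "i = off (t - 1)" "C ! i = AND ([N..<N + Q] @ [off (t - 2)..<off (t - 2) + R ^ 2])"
proof -
  consider "i < N" | c where "c < Q" "i = N + c" | "off 0 \<le> i" "i < off (t - 1)" | "i = off (t - 1)"
    using assms length_C off_0
    by (metis add_diff_inverse_nat less_Suc_eq nat_add_left_cancel_less not_less)
  then show ?thesis
  proof cases
    case 1
    then show ?thesis using variable nth_variable by blast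
  next
    case (2 c)
    then show ?thesis using bottom[of "clause c"] nth_clause clause_nonempty off_ge[of 1] by simp
  next
    case 3
    then have "i - (N + Q) < (\<Sum>d<t - 1. R ^ (t - d))" by (simp add: level_offset_def)
    then obtain d j where "d < t - 1" "j < R ^ (t - d)" "i - (N + Q) = (\<Sum>d'<d. R ^ (t - d')) + j"
      by (rule sum_offset_cases)
    then have level: "d < t - 1" "j < R ^ (t - d)" "i = off d + j"
      using 3(1) off_0 by (simp_all add: level_offset_def)
    show ?thesis
    proof (cases d)
      case 0
      then show ?thesis
        using bottom[of "leaf j"] level nth_level[OF level(1,2)] leaf_nonempty off_Suc[of 0] off_0
        by (simp add: level_gate_def)
    next
      case (Suc d')
      then show ?thesis using inner[of d' j] level nth_level[OF level(1,2)]
        by (simp add: level_gate_def)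
    qed
  next
    case 4
    then show ?thesis using root nth_root by simp
  qed
qed

lemma is_LIT_iff:
  assumes "i < length C"
  shows "is_LIT (C ! i) \<longleftrightarrow> i < N"
  using assms by (cases rule: vertex_cases) (use N_le_off in \<open>auto simp: trans_le_add1 not_less\<close>)

lemma level_child:
  assumes "Suc d < t - 1" "j < R ^ (t - Suc d)" "a < R"
  shows "j * R + a < R ^ (t - d)"
proof -
  have "R ^ (t - d) = R ^ (t - Suc d) * R"
    using assms(1) by (metis Suc_diff_Suc Suc_lessD diff_le_self less_le_trans power_Suc2)
  then show ?thesis using mult_add_less[OF assms(2,3)] by simp
qed

lemma fan_in_cases:
  assumes "i < length C" "j \<in> set (fan_in (C ! i))"
  obtains (variable) "j \<le> V" "N \<le> i" "i < off 1" "is_OR (C ! i)"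
  | (inner) d j' a where "Suc d < t - 1" "j' < R ^ (t - Suc d)" "i = off (Suc d) + j'" "a < R"
      "j = off d + (j' * R + a)" "j' * R + a < R ^ (t - d)"
  | (clause) c where "i = off (t - 1)" "c < Q" "j = N + c"
  | (top) j' where "i = off (t - 1)" "j' < R ^ 2" "j = off (t - 2) + j'"
  using assms(1)
proof (cases rule: vertex_cases)
  case variable
  then show ?thesis using assms(2) by simp
next
  case (bottom p)
  then show ?thesis using assms(2) that(1) by simp
next
  case (inner d j')
  then obtain a where "a < R" "j = off d + (j' * R + a)"
    using assms(2) by (auto simp: set_upt_offset simp del: set_upt)
  then show ?thesis using that(2)[of d j' a] inner level_child[of d j' a] by simp
next
  case root
  then show ?thesis
    using assms(2) that(3)[of "j - N"] that(4)[of "j - off (t - 2)"] by auto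
qed

lemma inner_type:
  assumes "d < t - 1" "j < R ^ (t - d)"
  shows "is_OR (C ! (off d + j)) \<longleftrightarrow> even d" "is_AND (C ! (off d + j)) \<longleftrightarrow> odd d"
  using nth_level[OF assms] even_t assms(1) by (auto simp: level_gate_def)

lemma fan_in_wf:
  assumes "i < length C"
  shows "distinct (fan_in (C ! i)) \<and> (fan_in (C ! i) = [] \<longrightarrow> is_LIT (C ! i))"
  using assms
proof (cases rule: vertex_cases)
  case (bottom p)
  then have "set (fan_in (C ! i)) \<noteq> {}" by auto
  then have "fan_in (C ! i) \<noteq> []" by (simp only: set_empty not_False_eq_True)
  then show ?thesis using bottom(3) by simp
next
  case root
  then show ?thesis using off_ge[of "t - 2"] R_pos by simp
qed (use R_pos in simp_all)

lemma literals_C: "filter is_LIT C = map (LIT True) [0..<N]"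
proof -
  have "filter is_LIT (map (level_gate N V Q R t leaf d) xs) = []" for d xs
    by (auto simp: filter_empty_conv level_gate_def)
  then have "filter is_LIT (concat
      (map (\<lambda>d. map (level_gate N V Q R t leaf d) [0..<R ^ (t - d)]) [0..<n])) = []" for n
    by (induction n) auto
  moreover have "filter is_LIT (map (\<lambda>c. bottom_gate V (clause c)) [0..<Q]) = []"
    by (auto simp: filter_empty_conv)
  ultimately show ?thesis
    by (auto simp: layered_circuit_def filter_id_conv)
qed

lemma fan_in_smaller:
  assumes "i < length C" "j \<in> set (fan_in (C ! i))"
  shows "j < i"
  using assms
proof (cases rule: fan_in_cases)
  case (inner d j' a)
  then show ?thesis using off_Suc[of d] by simp
next
  case (clause c)
  then show ?thesis using off_ge[of "t - 1"] by simp
qed (use V_less off_top in simp_all)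

lemma wf_C: "wf_circuit C"
proof -
  have "C \<noteq> []" "distinct (filter is_LIT C)"
    using length_C literals_C by (auto simp: distinct_map inj_on_def)
  moreover have "distinct (fan_in G) \<and> (fan_in G = [] \<longrightarrow> is_LIT G)" if "G \<in> set C" for G
    using that fan_in_wf by (auto simp: in_set_conv_nth)
  ultimately show ?thesis
    unfolding wf_circuit_def using fan_in_smaller by blast
qed

lemma LIT_in_C_iff: "LIT b v \<in> set C \<longleftrightarrow> b \<and> v < N"
proof -
  have "LIT b v \<in> set C \<longleftrightarrow> LIT b v \<in> set (filter is_LIT C)" by simp
  then show ?thesis unfolding literals_C by auto
qed

lemma monotone_C: "monotone_circuit C"
  by (simp add: monotone_circuit_def LIT_in_C_iff)

lemma vars_C: "vars C = {..<N}"
  by (auto simp: vars_def LIT_in_C_iff)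

definition rank :: "nat \<Rightarrow> nat" where
  "rank i = (if i < N then 0 else Suc (LEAST d. i < off (Suc d)))"

lemma rank_bottom: "N \<le> i \<Longrightarrow> i < off 1 \<Longrightarrow> rank i = 1"
  by (simp add: rank_def Least_eq_0)

lemma rank_level:
  assumes "d \<le> t - 1" "j < R ^ (t - d)"
  shows "rank (off d + j) = Suc d"
proof -
  have "(LEAST d'. off d + j < off (Suc d')) = d"
  proof (rule Least_equality)
    show "off d + j < off (Suc d)" using off_Suc assms by simp
    show "d \<le> d'" if "off d + j < off (Suc d')" for d'
      using that off_mono[of "Suc d'" d] by (cases "d \<le> d'") auto
  qed
  then show ?thesis using off_ge[of d] by (simp add: rank_def)
qed

lemma rank_root: "rank (off (t - 1)) = t"
  using rank_level[of "t - 1" 0] R_pos two_le_t by simp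

lemma rank_fan_in_less:
  assumes "i < length C" "j \<in> set (fan_in (C ! i))"
  shows "rank j < rank i"
  using assms
proof (cases rule: fan_in_cases)
  case variable
  then show ?thesis using V_less rank_bottom by (simp add: rank_def[of j])
next
  case (inner d j' a)
  then show ?thesis using rank_level[of "Suc d" j'] rank_level[of d "j' * R + a"] by simp
next
  case (clause c)
  then have "rank j = 1" using rank_bottom[of j] off_ge[of 1] by simp
  then show ?thesis using clause(1) rank_root two_le_t by simp
next
  case (top j')
  then have "rank j = Suc (t - 2)" using rank_level[of "t - 2" j'] two_le_t by simp
  then show ?thesis using top(1) rank_root two_le_t by simp
qed

lemma depth_C: "depth C \<le> t"
proof -
  have "path_value (\<lambda>G. \<not> is_LIT G) C (length C - 1) \<le> rank (length C - 1)"
  proof (rule path_value_le[OF wf_C])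
    fix i assume i: "i < length C"
    then show "of_bool (\<not> is_LIT (C ! i)) \<le> rank i"
      by (simp add: is_LIT_iff rank_def)
    show "of_bool (\<not> is_LIT (C ! i)) + rank j \<le> rank i" if "j \<in> set (fan_in (C ! i))" for j
      using rank_fan_in_less[OF i that] by (simp add: of_bool_def)
  qed (simp add: length_C)
  moreover have "C \<noteq> []" using length_C by auto
  ultimately show ?thesis
    using rank_root length_C by (simp add: depth_def max_on_path_path_value)
qed

lemma outdegree_C:
  assumes "N \<le> j"
  shows "outdegree C j \<le> 1"
proof -
  define parent where "parent = (if j < N + Q \<or> rank j = t - 1 then off (t - 1)
    else off (rank j) + (j - off (rank j - 1)) div R)"
  have "i = parent" if "i < length C" "j \<in> set (fan_in (C ! i))" for i
    using that
  proof (cases rule: fan_in_cases)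
    case variable
    then show ?thesis using assms V_less by simp
  next
    case (inner d j' a)
    then have "rank j = Suc d" "N + Q \<le> j" using rank_level[of d "j' * R + a"] off_ge[of d]
      by simp_all
    then show ?thesis using inner by (simp add: parent_def)
  next
    case (clause c)
    then show ?thesis by (simp add: parent_def)
  next
    case (top j')
    then have "rank j = t - 1" using rank_level[of "t - 2" j'] two_le_t by simp
    then show ?thesis using top(1) by (simp add: parent_def)
  qed
  then have "{i. i < length C \<and> j \<in> set (fan_in (C ! i))} \<subseteq> {parent}" by blast
  from card_mono[OF _ this] show ?thesis by (simp add: outdegree_def)
qed

lemma fan_in_alternates:
  assumes "i < length C" "j \<in> set (fan_in (C ! i))"
  shows "\<not> (is_AND (C ! i) \<and> is_AND (C ! j)) \<and> \<not> (is_OR (C ! i) \<and> is_OR (C ! j))"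
  using assms
proof (cases rule: fan_in_cases)
  case variable
  then show ?thesis using nth_variable[of j] V_less by simp
next
  case (inner d j' a)
  then show ?thesis using inner_type[of "Suc d" j'] inner_type[of d "j' * R + a"] by auto
next
  case (clause c)
  then show ?thesis using nth_root nth_clause by simp
next
  case (top j')
  then show ?thesis using nth_root inner_type[of "t - 2" j'] two_le_t even_t by auto
qed

lemma Pi_C: "Pi_circuit t C"
  unfolding Pi_circuit_def
proof (intro conjI allI impI ballI wf_C depth_C)
  show "is_AND (last C)" by (simp add: layered_circuit_def)
  show "\<not> is_NOT G" if "G \<in> set C" for G
  proof -
    from that obtain i where "i < length C" "G = C ! i" by (auto simp: in_set_conv_nth)
    then show ?thesis by (elim vertex_cases) auto
  qed
  show "outdegree C j \<le> 1" if "j < length C" "\<not> is_LIT (C ! j)" for j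
    using that is_LIT_iff by (intro outdegree_C) (simp add: not_less)
  show "\<not> (is_AND (C ! i) \<and> is_AND (C ! j))" "\<not> (is_OR (C ! i) \<and> is_OR (C ! j))"
    if "i < length C" "j \<in> set (fan_in (C ! i))" for i j
    using fan_in_alternates[OF that] by auto
qed

lemma gate_value_variable: "r \<le> V \<Longrightarrow> gate_value S C r \<longleftrightarrow> r \<in> S"
  using gate_value_simps(1)[OF wf_C, of r True r S] nth_variable[of r] V_less length_C
    off_ge[of "t - 1"] by simp

lemma gate_value_bottom:
  assumes "i < length C" "C ! i = bottom_gate V p"
  shows "gate_value S C i \<longleftrightarrow> (\<exists>r\<le>V. p r \<and> r \<in> S)"
  using gate_value_simps(4)[OF wf_C assms(1) assms(2)[unfolded bottom_gate_def]]
  by (auto simp: gate_value_variable less_Suc_eq_le simp del: upt_Suc)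

lemma gate_value_connective:
  assumes "i < length C" "C ! i = connective b [a..<a + n]"
  shows "gate_value S C i \<longleftrightarrow> quant b n (\<lambda>k. gate_value S C (a + k))"
  unfolding gate_value_quant[OF wf_C assms] by (auto intro!: quant_cong)

lemma gate_value_level:
  assumes "d < t - 1" "j < R ^ (t - d)"
  shows "gate_value S C (off d + j) \<longleftrightarrow>
    alt_quant R (even (t - d)) d (\<lambda>gs. \<exists>r\<le>V. leaf (horner R j gs) r \<and> r \<in> S)"
  using assms
proof (induction d arbitrary: j)
  case 0
  have "off 1 \<le> off (t - 1)" using two_le_t by (intro off_mono) linarith
  then have "off 0 + j < length C" using 0 off_Suc[of 0] length_C by simp
  then show ?case using nth_level[OF 0] by (simp add: level_gate_def gate_value_bottom)
next
  case (Suc d)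
  have "off (Suc d) + j < length C"
    using Suc.prems off_Suc[of "Suc d"] off_mono[of "Suc (Suc d)" "t - 1"] length_C by simp
  moreover have "C ! (off (Suc d) + j) =
      connective (even (t - Suc d)) [off d + j * R..<off d + j * R + R]"
    using nth_level[OF Suc.prems] by (simp add: level_gate_def)
  ultimately have "gate_value S C (off (Suc d) + j) \<longleftrightarrow>
      quant (even (t - Suc d)) R (\<lambda>a. gate_value S C (off d + j * R + a))"
    by (rule gate_value_connective)
  also have "\<dots> \<longleftrightarrow> quant (even (t - Suc d)) R (\<lambda>a. gate_value S C (off d + (j * R + a)))"
    by (simp only: add.assoc)
  also have "\<dots> \<longleftrightarrow> quant (even (t - Suc d)) R (\<lambda>a. alt_quant R (even (t - d)) d
      (\<lambda>gs. \<exists>r\<le>V. leaf (horner R (j * R + a) gs) r \<and> r \<in> S))"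
    using Suc.IH level_child[OF Suc.prems] Suc.prems by (intro quant_cong) simp
  also have "even (t - d) = (\<not> even (t - Suc d))"
    using Suc.prems by (simp add: Suc_diff_Suc[symmetric])
  finally show ?case by simp
qed

lemma satisfies_C:
  "satisfies S C \<longleftrightarrow> (\<forall>c<Q. \<exists>r\<le>V. clause c r \<and> r \<in> S) \<and>
     (\<forall>j<R ^ 2. alt_quant R True (t - 2) (\<lambda>gs. \<exists>r\<le>V. leaf (horner R j gs) r \<and> r \<in> S))"
proof -
  have "C \<noteq> []" using length_C by auto
  then have "satisfies S C \<longleftrightarrow> gate_value S C (off (t - 1))"
    using length_C by (simp add: satisfies_gate_value)
  also have "\<dots> \<longleftrightarrow> (\<forall>j\<in>set ([N..<N + Q] @ [off (t - 2)..<off (t - 2) + R ^ 2]). gate_value S C j)"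
    using gate_value_simps(3)[OF wf_C _ nth_root] length_C by simp
  also have "\<dots> \<longleftrightarrow> (\<forall>c<Q. gate_value S C (N + c)) \<and> (\<forall>j<R ^ 2. gate_value S C (off (t - 2) + j))"
    unfolding set_append set_upt_offset by auto
  also have "(\<forall>c<Q. gate_value S C (N + c)) \<longleftrightarrow> (\<forall>c<Q. \<exists>r\<le>V. clause c r \<and> r \<in> S)"
    using gate_value_bottom[OF _ nth_clause] off_ge[of "t - 1"] length_C by simp
  also have "(\<forall>j<R ^ 2. gate_value S C (off (t - 2) + j)) \<longleftrightarrow>
      (\<forall>j<R ^ 2. alt_quant R True (t - 2) (\<lambda>gs. \<exists>r\<le>V. leaf (horner R j gs) r \<and> r \<in> S))"
    using gate_value_level[of "t - 2"] two_le_t by simp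
  finally show ?thesis .
qed

text \<open>The variables above \<open>V\<close> are isolated, so they do not occur in this bound.\<close>

lemma genus_C: "circuit_genus C \<le> 2 * (V + 1 + (off (t - 1) - N)) ^ 2"
proof -
  let ?E = "{{i, j} | i j. i < length C - 1 \<and> j \<in> set (fan_in (C ! i))}"
  let ?X = "{..V} \<union> {N..<off (t - 1)}"
  have ends: "i \<in> ?X" "j \<in> ?X" "j < i" if ij: "i < length C - 1" "j \<in> set (fan_in (C ! i))" for i j
  proof -
    have i: "i < length C" "i < off (t - 1)" using ij length_C by auto
    show j: "j < i" using fan_in_smaller[OF i(1) ij(2)] .
    from i(1) ij(2) have "N \<le> i \<and> (j \<le> V \<or> N \<le> j)"
      by (cases rule: fan_in_cases) (use N_le_off i(2) in \<open>auto intro: trans_le_add1\<close>)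
    then show "i \<in> ?X" "j \<in> ?X" using i j by auto
  qed
  have "graph_genus {..<length C - 1} ?E \<le> 2 * card ?E"
  proof (rule graph_genus_le_edges)
    fix e assume "e \<in> ?E"
    then obtain i j where ij: "e = {i, j}" "i < length C - 1" "j \<in> set (fan_in (C ! i))" by blast
    then show "e \<subseteq> {..<length C - 1} \<and> card e = 2"
      using ends(3)[of i j] by auto
  qed simp
  moreover have "card ?E \<le> (V + 1 + (off (t - 1) - N)) ^ 2"
  proof -
    have "?E \<subseteq> (\<lambda>(i, j). {i, j}) ` (?X \<times> ?X)" using ends by fast
    then have "card ?E \<le> card ((\<lambda>(i, j). {i, j}) ` (?X \<times> ?X))" by (rule card_mono[rotated]) simp
    also have "\<dots> \<le> card ?X * card ?X"
      by (rule order_trans[OF card_image_le]) (simp_all add: card_cartesian_product)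
    also have "card ?X \<le> V + 1 + (off (t - 1) - N)" using card_Un_le[of "{..V}" "{N..<off (t - 1)}"]
      by simp
    finally show ?thesis by (simp add: power2_eq_square mult_le_mono)
  qed
  ultimately show ?thesis unfolding circuit_genus_def by linarith
qed

end

subsection \<open>Choosing one value in every group\<close>

text \<open>
  Variable \<open>J * B + v\<close> states that group \<open>J < K\<close> has value \<open>v < B\<close>. The variable \<open>K * B\<close> only keeps
  disjunctions nonempty: it is false since the weight is used up by the groups. The clause
  \<open>q * K + J'\<close> states that group \<open>J'\<close> has a value and, if \<open>q < K * B\<close>, that this value is allowed
  by the variable \<open>q\<close> unless \<open>q\<close> is false.
\<close>

definition choice_clause ::
  "nat \<Rightarrow> nat \<Rightarrow> (nat \<Rightarrow> nat \<Rightarrow> nat \<Rightarrow> nat \<Rightarrow> bool) \<Rightarrow> nat \<Rightarrow> nat \<Rightarrow> bool" where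
  "choice_clause K B allowed c r \<longleftrightarrow>
     (r = K * B \<and> c div K < K * B) \<or>
     (r < K * B \<and> ((c div K < K * B \<and> r div B = c div K div B \<and> r \<noteq> c div K) \<or>
       (r div B = c mod K \<and>
        (c div K < K * B \<longrightarrow> allowed (c div K div B) (c div K mod B) (r div B) (r mod B)))))"

definition choice_leaf :: "nat \<Rightarrow> nat \<Rightarrow> (nat list \<Rightarrow> nat \<Rightarrow> nat \<Rightarrow> bool) \<Rightarrow> nat list \<Rightarrow> nat \<Rightarrow> bool" where
  "choice_leaf K B leaf gs r \<longleftrightarrow> r = K * B \<or> (r < K * B \<and> leaf gs (r div B) (r mod B))"

definition choice_circuit ::
  "nat \<Rightarrow> nat \<Rightarrow> nat \<Rightarrow> nat \<Rightarrow> nat \<Rightarrow> (nat \<Rightarrow> nat \<Rightarrow> nat \<Rightarrow> nat \<Rightarrow> bool) \<Rightarrow>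
    (nat list \<Rightarrow> nat \<Rightarrow> nat \<Rightarrow> bool) \<Rightarrow> circuit" where
  "choice_circuit N K B R t allowed leaf =
     layered_circuit N (K * B) ((K * B + 1) * K) R t (choice_clause K B allowed)
       (\<lambda>j. choice_leaf K B leaf (digits R t j))"

definition compatible_choice ::
  "nat \<Rightarrow> nat \<Rightarrow> (nat \<Rightarrow> nat \<Rightarrow> nat \<Rightarrow> nat \<Rightarrow> bool) \<Rightarrow> (nat \<Rightarrow> nat) \<Rightarrow> bool" where
  "compatible_choice K B allowed ch \<longleftrightarrow>
     (\<forall>J<K. ch J < B) \<and> (\<forall>J<K. \<forall>J'<K. allowed J (ch J) J' (ch J'))"

definition choice_vars :: "nat \<Rightarrow> nat \<Rightarrow> (nat \<Rightarrow> nat) \<Rightarrow> nat set" where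
  "choice_vars K B ch = (\<lambda>J. J * B + ch J) ` {..<K}"

lemma in_choice_vars_iff:
  assumes "\<forall>J<K. ch J < B"
  shows "r \<in> choice_vars K B ch \<longleftrightarrow> r < K * B \<and> r mod B = ch (r div B)"
proof
  assume "r \<in> choice_vars K B ch"
  then show "r < K * B \<and> r mod B = ch (r div B)"
    using assms mult_add_less[of _ K "ch _" B] by (auto simp: choice_vars_def)
next
  assume "r < K * B \<and> r mod B = ch (r div B)"
  then have "r = r div B * B + ch (r div B)" "r div B < K"
    using div_mult_mod_eq[of r B] by (simp_all add: less_mult_imp_div_less)
  then show "r \<in> choice_vars K B ch" unfolding choice_vars_def by blast
qed

lemma card_choice_vars:
  assumes "\<forall>J<K. ch J < B"
  shows "card (choice_vars K B ch) = K"
proof -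
  have "(J * B + ch J) div B = J" if "J < K" for J
    using assms[rule_format, OF that] by simp
  then have "inj_on (\<lambda>J. J * B + ch J) {..<K}"
    by (intro inj_on_inverseI[where g="\<lambda>r. r div B"]) simp
  then show ?thesis by (simp add: choice_vars_def card_image)
qed

lemma ex_choice_of_clauses:
  assumes "finite S" "card S = K"
    and clauses: "\<forall>c<(K * B + 1) * K. \<exists>r\<le>K * B. choice_clause K B allowed c r \<and> r \<in> S"
  shows "\<exists>ch. compatible_choice K B allowed ch \<and> S = choice_vars K B ch"
proof -
  have clause: "\<exists>r\<le>K * B. choice_clause K B allowed (q * K + J) r \<and> r \<in> S" if "q \<le> K * B" "J < K"
    for q J
    using clauses mult_add_less[of q "K * B + 1" J K] that by simp
  have "\<exists>v<B. J * B + v \<in> S" if J: "J < K" for J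
  proof -
    obtain r where "r \<in> S" "r < K * B" "r div B = J"
      using clause[OF order_refl J] J by (auto simp: choice_clause_def)
    moreover from this have "r mod B < B" by (cases "B = 0") auto
    ultimately show ?thesis using div_mult_mod_eq[of r B] by metis
  qed
  then obtain ch where ch: "\<And>J. J < K \<Longrightarrow> ch J < B \<and> J * B + ch J \<in> S" by metis
  then have range: "\<forall>J<K. ch J < B" and "choice_vars K B ch \<subseteq> S" by (auto simp: choice_vars_def)
  then have S: "S = choice_vars K B ch"
    using card_subset_eq[OF assms(1), of "choice_vars K B ch"] card_choice_vars[OF range] assms(2)
    by simp
  have "allowed J (ch J) J' (ch J')" if J: "J < K" "J' < K" for J J'
  proof -
    have q: "J * B + ch J < K * B" "(J * B + ch J) div B = J" "(J * B + ch J) mod B = ch J"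
      using mult_add_less[of J K "ch J" B] range[rule_format, OF J(1)] J(1) by simp_all
    obtain r where "choice_clause K B allowed ((J * B + ch J) * K + J') r" "r \<in> S"
      using clause[of "J * B + ch J" J'] q(1) J(2) by auto
    moreover from this(2) have "r < K * B" "r mod B = ch (r div B)"
      unfolding S in_choice_vars_iff[OF range] by auto
    moreover from this(2) have "r = J * B + ch J" if "r div B = J"
      using that div_mult_mod_eq[of r B] by simp
    ultimately show ?thesis using q J(2) unfolding choice_clause_def by auto
  qed
  then show ?thesis using range S by (auto simp: compatible_choice_def)
qed

lemma choice_clause_satisfied:
  assumes ch: "compatible_choice K B allowed ch" and c: "c < (K * B + 1) * K"
  shows "\<exists>r\<le>K * B. choice_clause K B allowed c r \<and> r \<in> choice_vars K B ch"
proof -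
  have range: "\<forall>J<K. ch J < B" and ok: "\<And>J J'. J < K \<Longrightarrow> J' < K \<Longrightarrow> allowed J (ch J) J' (ch J')"
    using ch by (auto simp: compatible_choice_def)
  let ?var = "\<lambda>J. J * B + ch J"
  have var: "?var J < K * B" "?var J div B = J" "?var J mod B = ch J" "?var J \<in> choice_vars K B ch"
    if "J < K" for J
    using mult_add_less[of J K "ch J" B] range[rule_format, OF that] that
    by (simp_all add: choice_vars_def)
  define q where "q = c div K"
  have J': "c mod K < K" using c by (cases K) auto
  show ?thesis
  proof (cases "q < K * B \<and> q \<noteq> ?var (q div B)")
    case True
    then have "q div B < K" by (simp add: less_mult_imp_div_less)
    from var[OF this] show ?thesis
      using True by (intro exI[of _ "?var (q div B)"]) (auto simp: choice_clause_def q_def)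
  next
    case False
    have "allowed (q div B) (q mod B) (c mod K) (ch (c mod K))" if "q < K * B"
    proof -
      have "q div B < K" using that by (simp add: less_mult_imp_div_less)
      moreover have "q mod B = ch (q div B)" using False that var(3)[OF calculation] by metis
      ultimately show ?thesis using ok J' by simp
    qed
    with var[OF J'] show ?thesis
      by (intro exI[of _ "?var (c mod K)"]) (auto simp: choice_clause_def q_def)
  qed
qed

lemma ex_choice_leaf_iff:
  assumes "\<forall>J<K. ch J < B"
  shows "(\<exists>r\<le>K * B. choice_leaf K B leaf gs r \<and> r \<in> choice_vars K B ch) \<longleftrightarrow> (\<exists>J<K. leaf gs J (ch J))"
proof -
  have "J * B + ch J < K * B" "(J * B + ch J) div B = J" "(J * B + ch J) mod B = ch J" if "J < K"
    for J
    using mult_add_less[of J K "ch J" B] assms[rule_format, OF that] that by simp_all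
  then have "J * B + ch J \<le> K * B \<and> choice_leaf K B leaf gs (J * B + ch J) \<longleftrightarrow> leaf gs J (ch J)"
    if "J < K" for J
    using that by (fastforce simp: choice_leaf_def)
  then show ?thesis unfolding choice_vars_def by (simp add: image_iff) blast
qed

locale choice =
  fixes N K B R t :: nat
    and allowed :: "nat \<Rightarrow> nat \<Rightarrow> nat \<Rightarrow> nat \<Rightarrow> bool" and leaf :: "nat list \<Rightarrow> nat \<Rightarrow> nat \<Rightarrow> bool"
  assumes vars_less: "K * B < N" and B_pos: "0 < B" and R_pos: "0 < R" and two_le_t: "2 \<le> t"
    and even_t: "even t"

sublocale choice \<subseteq> layered N "K * B" "(K * B + 1) * K" R t "choice_clause K B allowed"
  "\<lambda>j. choice_leaf K B leaf (digits R t j)"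
proof
  fix c assume c: "c < (K * B + 1) * K"
  show "\<exists>r\<le>K * B. choice_clause K B allowed c r"
  proof (cases "c div K < K * B")
    case True
    then show ?thesis by (intro exI[of _ "K * B"]) (simp add: choice_clause_def)
  next
    case False
    have "c mod K < K" using c by (cases K) auto
    then show ?thesis
      using False mult_add_less[of "c mod K" K 0 B] B_pos
      by (intro exI[of _ "c mod K * B"]) (simp add: choice_clause_def)
  qed
qed (use vars_less R_pos two_le_t even_t in \<open>auto simp: choice_leaf_def\<close>)

context choice
begin

lemma satisfies_iff:
  assumes "finite S" "card S = K"
  shows "satisfies S C \<longleftrightarrow> (\<exists>ch. compatible_choice K B allowed ch \<and> S = choice_vars K B ch \<and>
    (\<forall>g<R. alt_quant R False (t - 1) (\<lambda>gs. \<exists>J<K. leaf (g # gs) J (ch J))))"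
proof -
  let ?leaf = "\<lambda>S gs. \<exists>r\<le>K * B. choice_leaf K B leaf gs r \<and> r \<in> S"
  have "satisfies S C \<longleftrightarrow> (\<forall>c<(K * B + 1) * K. \<exists>r\<le>K * B. choice_clause K B allowed c r \<and> r \<in> S) \<and>
      (\<forall>g<R. alt_quant R False (t - 1) (\<lambda>gs. ?leaf S (g # gs)))"
    unfolding satisfies_C using all_alt_quant_digits[OF two_le_t R_pos, of "?leaf S"] by simp
  also have "\<dots> \<longleftrightarrow> (\<exists>ch. compatible_choice K B allowed ch \<and> S = choice_vars K B ch \<and>
      (\<forall>g<R. alt_quant R False (t - 1) (\<lambda>gs. ?leaf S (g # gs))))"
    using ex_choice_of_clauses[OF assms] choice_clause_satisfied by blast
  also have "\<dots> \<longleftrightarrow> (\<exists>ch. compatible_choice K B allowed ch \<and> S = choice_vars K B ch \<and>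
      (\<forall>g<R. alt_quant R False (t - 1) (\<lambda>gs. \<exists>J<K. leaf (g # gs) J (ch J))))"
  proof -
    have "?leaf (choice_vars K B ch) gs \<longleftrightarrow> (\<exists>J<K. leaf gs J (ch J))"
      if "compatible_choice K B allowed ch" for ch gs
      using that by (intro ex_choice_leaf_iff) (simp add: compatible_choice_def)
    then show ?thesis by (intro ex_cong1 conj_cong) simp_all
  qed
  finally show ?thesis .
qed

lemma weight_satisfiable_iff:
  "weight_satisfiable C K \<longleftrightarrow> (\<exists>ch. compatible_choice K B allowed ch \<and>
     (\<forall>g<R. alt_quant R False (t - 1) (\<lambda>gs. \<exists>J<K. leaf (g # gs) J (ch J))))"
       (is "_ \<longleftrightarrow> (\<exists>ch. ?ok ch)")
proof
  assume "weight_satisfiable C K"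
  then obtain S where S: "S \<subseteq> {..<N}" "card S = K" "satisfies S C"
    unfolding weight_satisfiable_def vars_C by blast
  moreover from S(1) have "finite S" by (rule finite_subset) simp
  ultimately show "\<exists>ch. ?ok ch" using satisfies_iff by blast
next
  assume "\<exists>ch. ?ok ch"
  then obtain ch where ch: "?ok ch" by blast
  then have range: "\<forall>J<K. ch J < B" by (simp add: compatible_choice_def)
  have "r < N" if "r \<in> choice_vars K B ch" for r
    using that vars_less unfolding in_choice_vars_iff[OF range] by linarith
  then have "choice_vars K B ch \<subseteq> {..<N}" by blast
  moreover from this have "finite (choice_vars K B ch)" by (rule finite_subset) simp
  moreover from this have "satisfies (choice_vars K B ch) C"
    using ch card_choice_vars[OF range] by (subst satisfies_iff) blast+
  ultimately show "weight_satisfiable C K"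
    using card_choice_vars[OF range] unfolding weight_satisfiable_def vars_C by blast
qed

end

subsection \<open>Sets given by their gaps\<close>

text \<open>\<open>U\<close> lists the \<open>k\<close> elements of \<open>S\<close>, shifted by one, between the sentinels \<open>0\<close> and \<open>M - 1\<close>.\<close>

definition gaps :: "nat \<Rightarrow> nat \<Rightarrow> nat set \<Rightarrow> (nat \<Rightarrow> nat) \<Rightarrow> bool" where
  "gaps k M S U \<longleftrightarrow> U 0 = 0 \<and> U (k + 1) = M - 1 \<and> (\<forall>i\<le>k. U i < U (i + 1)) \<and> S =
      (\<lambda>i. U i - 1) ` {1..k}"

lemma gaps_less: "gaps k M S U \<Longrightarrow> i < j \<Longrightarrow> j \<le> k + 1 \<Longrightarrow> U i < U j"
proof (induction j)
  case (Suc j)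
  have "U j < U (Suc j)" using Suc.prems by (simp add: gaps_def)
  then show ?case using Suc by (cases "i = j") auto
qed simp

lemma gaps_pos: "gaps k M S U \<Longrightarrow> 1 \<le> i \<Longrightarrow> i \<le> k + 1 \<Longrightarrow> 1 \<le> U i"
  using gaps_less[of k M S U 0 i] by simp

lemma gaps_less_bound:
  assumes "gaps k M S U" "i \<le> k + 1"
  shows "U i < M"
proof -
  have "U (k + 1) = M - 1" "0 < U (k + 1)"
    using assms(1) gaps_pos[OF assms(1), of "k + 1"] by (simp_all add: gaps_def)
  then show ?thesis using gaps_less[OF assms(1), of i "k + 1"] assms(2) by (cases "i = k + 1") auto
qed

lemma gaps_card:
  assumes "gaps k M S U"
  shows "card S = k"
proof -
  have "inj_on (\<lambda>i. U i - 1) {1..k}"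
  proof (rule linorder_inj_onI')
    fix i j assume ij: "i \<in> {1..k}" "j \<in> {1..k}" "i < j"
    then have "U i < U j" "1 \<le> U i" using gaps_less[OF assms] gaps_pos[OF assms] by auto
    then show "U i - 1 \<noteq> U j - 1" by simp
  qed
  then show ?thesis using assms by (simp add: gaps_def card_image)
qed

lemma gaps_mem:
  assumes "gaps k M S U"
  shows "v \<in> S \<longleftrightarrow> (\<exists>i\<le>k. U i = v + 1)"
proof
  assume "v \<in> S"
  then obtain i where "i \<in> {1..k}" "v = U i - 1" using assms by (auto simp: gaps_def)
  then show "\<exists>i\<le>k. U i = v + 1" using gaps_pos[OF assms, of i] by (intro exI[of _ i]) auto
next
  assume "\<exists>i\<le>k. U i = v + 1"
  then obtain i where i: "i \<le> k" "U i = v + 1" by blast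
  moreover from this have "i \<noteq> 0" using assms by (intro notI) (simp add: gaps_def)
  ultimately show "v \<in> S" using assms by (auto simp: gaps_def intro!: image_eqI[of _ _ i])
qed

lemma gaps_not_mem:
  assumes gaps: "gaps k M S U" and v: "v + 1 < M - 1"
  shows "v \<notin> S \<longleftrightarrow> (\<exists>i\<le>k. U i < v + 1 \<and> v + 1 < U (i + 1))"
proof
  assume "v \<notin> S"
  then have ne: "U i \<noteq> v + 1" if "i \<le> k" for i using gaps_mem[OF gaps] that by blast
  define i where "i = (GREATEST i. i \<le> k \<and> U i \<le> v + 1)"
  have "0 \<le> k \<and> U 0 \<le> v + 1" using gaps by (simp add: gaps_def)
  then have i: "i \<le> k" "U i \<le> v + 1" and max: "\<And>j. j \<le> k \<Longrightarrow> U j \<le> v + 1 \<Longrightarrow> j \<le> i"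
    unfolding i_def
    using GreatestI_nat[of "\<lambda>i. i \<le> k \<and> U i \<le> v + 1" 0 k]
      Greatest_le_nat[of "\<lambda>i. i \<le> k \<and> U i \<le> v + 1" _ k]
    by blast+
  have "v + 1 < U (i + 1)"
  proof (rule ccontr)
    assume "\<not> v + 1 < U (i + 1)"
    moreover from this have "i \<noteq> k" using gaps v by (auto simp: gaps_def)
    ultimately show False using max[of "i + 1"] i(1) by simp
  qed
  then show "\<exists>i\<le>k. U i < v + 1 \<and> v + 1 < U (i + 1)" using i ne[OF i(1)] by (intro exI[of _ i]) auto
next
  assume "\<exists>i\<le>k. U i < v + 1 \<and> v + 1 < U (i + 1)"
  then obtain i where i: "i \<le> k" "U i < v + 1" "v + 1 < U (i + 1)" by blast
  show "v \<notin> S"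
  proof
    assume "v \<in> S"
    then obtain j where j: "j \<le> k" "U j = v + 1" using gaps_mem[OF gaps] by blast
    have "\<not> j < i" "i \<noteq> j" using gaps_less[OF gaps, of j i] i j by auto
    moreover have "\<not> i + 1 < j" "j \<noteq> i + 1" using gaps_less[OF gaps, of "i + 1" j] i j by auto
    ultimately show False by simp
  qed
qed

lemma ex_gaps:
  assumes "finite S" "card S = k" "\<And>v. v \<in> S \<Longrightarrow> v + 1 < M - 1" "2 \<le> M"
  shows "\<exists>U. gaps k M S U"
proof -
  define xs where "xs = map Suc (sorted_list_of_set S)"
  define U where "U = (!) (0 # xs @ [M - 1])"
  have len: "length xs = k" and set: "set xs = Suc ` S" using assms(1,2) by (simp_all add: xs_def)
  have "sorted_wrt (<) xs" unfolding xs_def by (simp add: sorted_wrt_map)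
  then have "sorted_wrt (<) (0 # xs @ [M - 1])"
    using assms(3,4) set by (auto simp: sorted_wrt_append)
  then have "U i < U (i + 1)" if "i \<le> k" for i
    using that len sorted_wrt_nth_less[of "(<)" "0 # xs @ [M - 1]" i "i + 1"] by (simp add: U_def)
  moreover have "(\<lambda>i. U i - 1) ` {1..k} = S"
  proof -
    have "{1..k} = Suc ` {..<k}" by (simp add: image_Suc_lessThan)
    then have "(\<lambda>i. U i - 1) ` {1..k} = (\<lambda>i. U (Suc i) - 1) ` {..<k}" by (simp add: image_image)
    also have "\<dots> = (\<lambda>x. x - 1) ` ((!) xs ` {..<k})"
      using len by (simp add: U_def nth_append image_image)
    also have "(!) xs ` {..<k} = Suc ` S" using len set
      by (metis atLeast0LessThan nth_image order_refl take_all_iff)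
    finally show ?thesis by (simp add: image_image)
  qed
  ultimately show ?thesis
    using len by (intro exI[of _ U]) (auto simp: gaps_def U_def nth_append)
qed

text \<open>
  Group 0 holds a guessed index, groups \<open>1, \<dots>, k + 1\<close> hold the pairs of consecutive elements of
  the chosen set, and the remaining groups hold certificates that are checked against these gaps.
\<close>

definition gap_compatible ::
  "nat \<Rightarrow> nat \<Rightarrow> nat \<Rightarrow> (nat \<Rightarrow> bool) \<Rightarrow> (nat \<Rightarrow> nat \<Rightarrow> nat \<Rightarrow> nat \<Rightarrow> nat \<Rightarrow> bool) \<Rightarrow>
   nat \<Rightarrow> nat \<Rightarrow> nat \<Rightarrow> nat \<Rightarrow> bool" where
  "gap_compatible k M R allowed check J v J' v' \<longleftrightarrow>
     (J = 0 \<longrightarrow> v < R) \<and>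
     (1 \<le> J \<and> J \<le> k + 1 \<longrightarrow>
        v div M < v mod M \<and> (J = 1 \<longrightarrow> v div M = 0) \<and> (J \<noteq> 1 \<longrightarrow> allowed (v div M - 1)) \<and>
        (J = k + 1 \<longrightarrow> v mod M = M - 1) \<and>
        (J' = J + 1 \<and> J \<le> k \<longrightarrow> v mod M = v' div M) \<and>
        (k + 2 \<le> J' \<longrightarrow> check (J - 1) (v div M) (v mod M) (J' - (k + 2)) v'))"

definition gap_leaf :: "nat \<Rightarrow> (nat list \<Rightarrow> nat \<Rightarrow> nat \<Rightarrow> bool) \<Rightarrow> nat list \<Rightarrow> nat \<Rightarrow> nat \<Rightarrow> bool" where
  "gap_leaf k cert gs J v \<longleftrightarrow> (J = 0 \<and> v \<noteq> hd gs) \<or> (k + 2 \<le> J \<and> cert gs (J - (k + 2)) v)"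

definition certificates_valid ::
  "nat \<Rightarrow> nat \<Rightarrow> nat \<Rightarrow> (nat \<Rightarrow> nat \<Rightarrow> nat \<Rightarrow> nat \<Rightarrow> nat \<Rightarrow> bool) \<Rightarrow> (nat \<Rightarrow> nat) \<Rightarrow> (nat \<Rightarrow> nat) \<Rightarrow> bool" where
  "certificates_valid k E B check U y \<longleftrightarrow>
     (\<forall>e<E. y e < B \<and> (\<forall>i\<le>k. check i (U i) (U (i + 1)) e (y e)))"

definition certified ::
  "nat \<Rightarrow> nat \<Rightarrow> nat \<Rightarrow> nat \<Rightarrow> nat \<Rightarrow> (nat \<Rightarrow> nat \<Rightarrow> nat \<Rightarrow> nat \<Rightarrow> nat \<Rightarrow> bool) \<Rightarrow>
   (nat list \<Rightarrow> nat \<Rightarrow> nat \<Rightarrow> bool) \<Rightarrow> (nat \<Rightarrow> nat) \<Rightarrow> bool" where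
  "certified k E B R n check cert U \<longleftrightarrow>
     (\<exists>g<R. \<exists>y. certificates_valid k E B check U y \<and>
        alt_quant R False n (\<lambda>gs. \<exists>e<E. cert (g # gs) e (y e)))"

lemma ex_less_add: "(\<exists>i<m + n. P i) \<longleftrightarrow> (\<exists>i<m. P i) \<or> (\<exists>j<n. P (m + j))" for m n :: nat
proof
  assume "\<exists>i<m + n. P i"
  then obtain i where i: "i < m + n" "P i" by blast
  show "(\<exists>i<m. P i) \<or> (\<exists>j<n. P (m + j))"
  proof (cases "i < m")
    case False
    then obtain j where "i = m + j" by (metis le_Suc_ex not_less)
    then show ?thesis using i by auto
  qed (use i in blast)
qed (meson add_less_mono1 add_strict_left_mono nat_add_left_cancel_less trans_less_add1)

lemma ex_gap_leaf_iff:
  "(\<exists>J<k + 2 + E. gap_leaf k cert (g # gs) J (ch J)) \<longleftrightarrow>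
     ch 0 \<noteq> g \<or> (\<exists>e<E. cert (g # gs) e (ch (k + 2 + e)))"
  unfolding ex_less_add[of "k + 2" E] by (auto simp: gap_leaf_def intro: exI[of _ 0])

text \<open>Since every index other than the guessed one satisfies the formula, only the guess matters.\<close>

lemma all_alt_quant_gap_leaf:
  assumes "0 < R" "ch 0 < R"
  shows "(\<forall>g<R. alt_quant R False n (\<lambda>gs. \<exists>J<k + 2 + E. gap_leaf k cert (g # gs) J (ch J))) \<longleftrightarrow>
    alt_quant R False n (\<lambda>gs. \<exists>e<E. cert (ch 0 # gs) e (ch (k + 2 + e)))"
proof -
  have "alt_quant R False n (\<lambda>gs. ch 0 \<noteq> g \<or> (\<exists>e<E. cert (g # gs) e (ch (k + 2 + e)))) \<longleftrightarrow>
      (ch 0 = g \<longrightarrow> alt_quant R False n (\<lambda>gs. \<exists>e<E. cert (ch 0 # gs) e (ch (k + 2 + e))))" for g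
    by (cases "ch 0 = g") (auto simp: alt_quant_const[OF assms(1)])
  then show ?thesis unfolding ex_gap_leaf_iff using assms(2) by auto
qed

definition gap_starts :: "nat \<Rightarrow> nat \<Rightarrow> (nat \<Rightarrow> nat) \<Rightarrow> nat \<Rightarrow> nat" where
  "gap_starts k M ch i = (if i \<le> k then ch (i + 1) div M else M - 1)"

lemma gap_compatible_decode:
  assumes "compatible_choice (k + 2 + E) B (gap_compatible k M R allowed check) ch"
  defines "U \<equiv> gap_starts k M ch"
  shows "ch 0 < R" "gaps k M ((\<lambda>i. U i - 1) ` {1..k}) U" "(\<lambda>i. U i - 1) ` {1..k} \<subseteq> Collect allowed"
    "certificates_valid k E B check U (\<lambda>e. ch (k + 2 + e))"
proof -
  have range: "\<And>J. J < k + 2 + E \<Longrightarrow> ch J < B"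
    and ok: "\<And>J J'. J < k + 2 + E \<Longrightarrow> J' < k + 2 + E \<Longrightarrow>
        gap_compatible k M R allowed check J (ch J) J' (ch J')"
    using assms(1) by (auto simp: compatible_choice_def)
  show "ch 0 < R" using ok[of 0 0] by (simp add: gap_compatible_def)
  have lower: "U i = ch (i + 1) div M" if "i \<le> k" for i
    using that by (simp add: U_def gap_starts_def)
  have upper: "U (i + 1) = ch (i + 1) mod M" if "i \<le> k" for i
    using that ok[of "i + 1" 0] ok[of "i + 1" "i + 2"]
    by (cases "i = k") (auto simp: gap_compatible_def U_def gap_starts_def)
  have "U i < U (i + 1)" if "i \<le> k" for i
    unfolding lower[OF that] upper[OF that] using that ok[of "i + 1" 0]
    by (simp add: gap_compatible_def)
  moreover have "U 0 = 0" "U (k + 1) = M - 1"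
    using ok[of 1 0] by (auto simp: gap_compatible_def U_def gap_starts_def)
  ultimately show "gaps k M ((\<lambda>i. U i - 1) ` {1..k}) U" by (simp add: gaps_def)
  have "allowed (U i - 1)" if "i \<in> {1..k}" for i
    using that ok[of "i + 1" 0] lower[of i] by (simp add: gap_compatible_def)
  then show "(\<lambda>i. U i - 1) ` {1..k} \<subseteq> Collect allowed" by blast
  have "check i (U i) (U (i + 1)) e (ch (k + 2 + e))" if "e < E" "i \<le> k" for e i
    using ok[of "i + 1" "k + 2 + e"] that lower[of i] upper[of i] by (simp add: gap_compatible_def)
  then show "certificates_valid k E B check U (\<lambda>e. ch (k + 2 + e))"
    using range by (simp add: certificates_valid_def)
qed

definition gap_choice :: "nat \<Rightarrow> nat \<Rightarrow> nat \<Rightarrow> (nat \<Rightarrow> nat) \<Rightarrow> (nat \<Rightarrow> nat) \<Rightarrow> nat \<Rightarrow> nat" where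
  "gap_choice k M g U y J =
     (if J = 0 then g else if J \<le> k + 1 then U (J - 1) * M + U J else y (J - (k + 2)))"

lemma gap_choice_gap:
  assumes gaps: "gaps k M S U" and J: "1 \<le> J" "J \<le> k + 1"
  shows "gap_choice k M g U y J < M * M" "gap_choice k M g U y J div M = U (J - 1)"
    "gap_choice k M g U y J mod M = U J"
  using J gaps_less_bound[OF gaps, of J] gaps_less_bound[OF gaps, of "J - 1"]
    mult_add_less[of "U (J - 1)" M "U J" M]
  by (simp_all add: gap_choice_def)

lemma gap_choice_less:
  assumes "gaps k M S U" "g < R" "certificates_valid k E B check U y" "M * M \<le> B" "R \<le> B"
    "J < k + 2 + E"
  shows "gap_choice k M g U y J < B"
proof -
  consider "J = 0" | "1 \<le> J" "J \<le> k + 1" | "k + 2 \<le> J" by linarith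
  then show ?thesis
  proof cases
    case 2
    then show ?thesis using gap_choice_gap(1)[OF assms(1)] assms(4) by (meson less_le_trans)
  qed (use assms in \<open>simp_all add: gap_choice_def certificates_valid_def\<close>)
qed

lemma gap_choice_compatible:
  assumes gaps: "gaps k M S U" and S: "S \<subseteq> Collect allowed" and g: "g < R"
    and y: "certificates_valid k E B check U y" and B: "M * M \<le> B" "R \<le> B"
  shows "compatible_choice (k + 2 + E) B (gap_compatible k M R allowed check) (gap_choice k M g U y)"
proof -
  let ?ch = "gap_choice k M g U y"
  have "gap_compatible k M R allowed check J (?ch J) J' (?ch J')"
    if J: "J < k + 2 + E" "J' < k + 2 + E" for J J'
    unfolding gap_compatible_def
  proof (intro conjI impI; (elim conjE)?)
    show "?ch J < R" if "J = 0" using that g by (simp add: gap_choice_def)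
  next
    assume J1: "1 \<le> J" "J \<le> k + 1"
    then obtain i where i: "J = i + 1" "i \<le> k"
      by (metis Suc_eq_plus1 Suc_le_mono le_add_diff_inverse2)
    have lower: "?ch J div M = U i" and upper: "?ch J mod M = U (i + 1)"
      using gap_choice_gap(2,3)[OF gaps J1] i(1) by simp_all
    show "?ch J div M < ?ch J mod M" unfolding lower upper using gaps i(2) by (simp add: gaps_def)
    show "?ch J div M = 0" if "J = 1" unfolding lower using gaps i(1) that by (simp add: gaps_def)
    show "?ch J mod M = M - 1" if "J = k + 1" unfolding upper using gaps i(1) that
      by (simp add: gaps_def)
    show "allowed (?ch J div M - 1)" if "J \<noteq> 1"
    proof -
      have "i \<in> {1..k}" using i that by simp
      then have "U i - 1 \<in> S" using gaps by (simp add: gaps_def)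
      then show ?thesis unfolding lower using S by blast
    qed
    show "?ch J mod M = ?ch J' div M" if "J' = J + 1" "J \<le> k"
      using gap_choice_gap(2)[OF gaps, of J'] that i(1) upper by simp
    show "check (J - 1) (?ch J div M) (?ch J mod M) (J' - (k + 2)) (?ch J')" if "k + 2 \<le> J'"
      unfolding lower upper using y J(2) i that
      by (simp add: certificates_valid_def gap_choice_def[of _ _ _ _ _ J'])
  qed
  then show ?thesis using gap_choice_less[OF gaps g y B] by (simp add: compatible_choice_def)
qed

lemma ex_gap_choice_iff:
  assumes "M * M \<le> B" "R \<le> B" "0 < R"
  shows "(\<exists>ch. compatible_choice (k + 2 + E) B (gap_compatible k M R allowed check) ch \<and>
       (\<forall>g<R. alt_quant R False n (\<lambda>gs. \<exists>J<k + 2 + E. gap_leaf k cert (g # gs) J (ch J)))) \<longleftrightarrow>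
     (\<exists>S U. S \<subseteq> Collect allowed \<and> gaps k M S U \<and> certified k E B R n check cert U)"
       (is "?choice \<longleftrightarrow> ?gaps")
proof
  assume ?choice
  then obtain ch where ch: "compatible_choice (k + 2 + E) B (gap_compatible k M R allowed check) ch"
    and "\<forall>g<R. alt_quant R False n (\<lambda>gs. \<exists>J<k + 2 + E. gap_leaf k cert (g # gs) J (ch J))" by blast
  then have "alt_quant R False n (\<lambda>gs. \<exists>e<E. cert (ch 0 # gs) e (ch (k + 2 + e)))"
    using all_alt_quant_gap_leaf[of R ch] assms(3) gap_compatible_decode(1)[OF ch] by blast
  then have "certified k E B R n check cert (gap_starts k M ch)"
    unfolding certified_def using gap_compatible_decode(1,4)[OF ch]
    by (intro exI[of _ "ch 0"] exI[of _ "\<lambda>e. ch (k + 2 + e)"] conjI)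
  then show ?gaps using gap_compatible_decode(2,3)[OF ch] by blast
next
  assume ?gaps
  then obtain S U g y where S: "S \<subseteq> Collect allowed" "gaps k M S U" and g: "g < R"
    and y: "certificates_valid k E B check U y"
      and cert: "alt_quant R False n (\<lambda>gs. \<exists>e<E. cert (g # gs) e (y e))"
    unfolding certified_def by blast
  let ?ch = "gap_choice k M g U y"
  have "compatible_choice (k + 2 + E) B (gap_compatible k M R allowed check) ?ch"
    using S(2,1) g y assms(1,2) by (rule gap_choice_compatible)
  moreover have "?ch 0 = g" "\<And>e. ?ch (k + 2 + e) = y e" by (simp_all add: gap_choice_def)
  then have "\<forall>g<R. alt_quant R False n (\<lambda>gs. \<exists>J<k + 2 + E. gap_leaf k cert (g # gs) J (?ch J))"
    using all_alt_quant_gap_leaf[of R ?ch n k E cert] assms(3) g cert by simp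
  ultimately show ?choice by blast
qed

subsection \<open>Writing the circuit\<close>

lemma encode_append: "encode (C @ D) = encode C @ encode D"
  by (simp add: encode_def)

lemma encode_map: "encode (map f xs) = concat (map (\<lambda>x. encode [f x]) xs)"
  by (induction xs) (auto simp: encode_def)

lemma encode_concat: "encode (concat (map f xs)) = concat (map (\<lambda>x. encode (f x)) xs)"
  by (induction xs) (auto simp: encode_append, simp add: encode_def)

lemma feasible_input_only: "feasible 0 (\<lambda>I _. f I) \<Longrightarrow> feasible a (\<lambda>I _. f I)"
  by (rule feasible_mono[OF _ le0])

lemma emits_literal: "feasible a v \<Longrightarrow> emits a (\<lambda>I \<rho>. encode [LIT True (v I \<rho>)])"
proof -
  have "encode [LIT True x] = encode_nat 2 @ encode_nat 1 @ encode_nat x" for x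
    by (simp add: encode_def encode_nats_def numeral_2_eq_2)
  then show "feasible a v \<Longrightarrow> ?thesis"
    by (simp only:) (intro emits_append emits_encode_nat feasible_const)
qed

lemma emits_connective:
  assumes "feasible a (\<lambda>I \<rho>. length (js I \<rho>))" "emits a (\<lambda>I \<rho>. concat (map encode_nat (js I \<rho>)))"
  shows "emits a (\<lambda>I \<rho>. encode [connective b (js I \<rho>)])"
proof -
  have "encode [connective b ks] = encode_nat (length ks + 1) @ encode_nat (if b then 4 else 3) @
      concat (map encode_nat ks)" for ks
    by (simp add: encode_def encode_nats_def connective_def)
  then show ?thesis
    using assms by (simp only:) (intro emits_append emits_encode_nat feasible_add feasible_const)
qed

lemma emits_interval:
  assumes "feasible a f" "feasible a n"
  shows "emits a (\<lambda>I \<rho>. concat (map encode_nat [f I \<rho>..<f I \<rho> + n I \<rho>]))"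
proof -
  have "concat (map encode_nat [s..<s + m]) = concat (map (\<lambda>i. encode_nat (s + i)) [0..<m])" for s m
    by (induction m) auto
  then show ?thesis
    using assms(2) feasible_mono[OF assms(1)]
    by (simp only:) (intro emits_for emits_encode_nat feasible_add)
qed

lemma emits_bottom_gate:
  assumes V: "feasible a V"
    and p: "\<And>v b. a \<le> b \<Longrightarrow> feasible b v \<Longrightarrow> feasible_pred b (\<lambda>I \<rho>. p I \<rho> (v I \<rho>))"
  shows "emits a (\<lambda>I \<rho>. encode [bottom_gate (V I \<rho>) (p I \<rho>)])"
proof -
  have length_filter: "length (filter q [0..<n]) = (\<Sum>i<n. of_bool (q i))" for q n
    by (induction n) auto
  have concat_filter: "concat (map encode_nat (filter q [0..<n])) =
      concat (map (\<lambda>i. if q i then encode_nat i else []) [0..<n])" for q n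
    by (induction n) auto
  have n: "feasible a (\<lambda>I \<rho>. V I \<rho> + 1)" by (intro feasible_add V feasible_const)
  have "emits a (\<lambda>I \<rho>. encode [connective True (filter (p I \<rho>) [0..<V I \<rho> + 1])])"
  proof (rule emits_connective)
    show "feasible a (\<lambda>I \<rho>. length (filter (p I \<rho>) [0..<V I \<rho> + 1]))"
      unfolding length_filter by (intro feasible_sum n p[unfolded feasible_pred_def])
    show "emits a (\<lambda>I \<rho>. concat (map encode_nat (filter (p I \<rho>) [0..<V I \<rho> + 1])))"
      unfolding concat_filter by (intro emits_for n emits_if emits_encode_nat emits_Nil p)
  qed
  then show ?thesis by (simp add: bottom_gate_def connective_def)
qed

lemma feasible_level_offset:
  assumes "feasible 0 (\<lambda>I _. N I)" "feasible 0 (\<lambda>I _. Q I)" "feasible 0 (\<lambda>I _. R I)"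
  shows "feasible a (\<lambda>I _. level_offset (N I) (Q I) (R I) t d)"
  unfolding level_offset_def
  by (intro feasible_add feasible_sum_const feasible_power assms[THEN feasible_input_only])

lemma emits_level_gate:
  assumes N: "feasible 0 (\<lambda>I _. N I)" and V: "feasible 0 (\<lambda>I _. V I)"
    and Q: "feasible 0 (\<lambda>I _. Q I)" and R: "feasible 0 (\<lambda>I _. R I)"
    and leaf: "\<And>v w b. feasible b v \<Longrightarrow> feasible b w \<Longrightarrow> feasible_pred b (\<lambda>I \<rho>. leaf I (v I \<rho>) (w I \<rho>))"
    and v: "feasible a v"
  shows "emits a (\<lambda>I \<rho>. encode [level_gate (N I) (V I) (Q I) (R I) t (leaf I) d (v I \<rho>)])"
proof (cases "d = 0")
  case True
  have "emits a (\<lambda>I \<rho>. encode [bottom_gate (V I) (leaf I (v I \<rho>))])"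
    by (rule emits_bottom_gate[OF feasible_input_only[OF V] leaf[OF feasible_mono[OF v]]])
  then show ?thesis using True by (simp add: level_gate_def)
next
  case False
  let ?start = "\<lambda>I. level_offset (N I) (Q I) (R I) t (d - 1)"
  have R': "feasible a (\<lambda>I _. R I)" using R by (rule feasible_input_only)
  then have "feasible a (\<lambda>I \<rho>. ?start I + v I \<rho> * R I)"
    by (intro feasible_add feasible_mult v feasible_level_offset N Q R)
  then have "emits a
      (\<lambda>I \<rho>. encode [connective (even (t - d)) [?start I + v I \<rho> * R I..<?start I + v I \<rho> * R I + R I]])"
    using R' by (intro emits_connective emits_interval) simp_all
  then show ?thesis using False by (simp add: level_gate_def)
qed

lemma emits_layered_circuit:
  assumes N: "feasible 0 (\<lambda>I _. N I)" and V: "feasible 0 (\<lambda>I _. V I)"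
    and Q: "feasible 0 (\<lambda>I _. Q I)" and R: "feasible 0 (\<lambda>I _. R I)"
    and clause: "\<And>v w b. feasible b v \<Longrightarrow> feasible b w \<Longrightarrow>
        feasible_pred b (\<lambda>I \<rho>. clause I (v I \<rho>) (w I \<rho>))"
    and leaf: "\<And>v w b. feasible b v \<Longrightarrow> feasible b w \<Longrightarrow> feasible_pred b (\<lambda>I \<rho>. leaf I (v I \<rho>) (w I \<rho>))"
  shows "emits 0 (\<lambda>I _. encode (layered_circuit (N I) (V I) (Q I) (R I) t (clause I) (leaf I)))"
proof -
  let ?top = "\<lambda>I. level_offset (N I) (Q I) (R I) t (t - 2)"
  have variables: "emits 0 (\<lambda>I _. concat (map (\<lambda>i. encode [LIT True i]) [0..<N I]))"
    by (intro emits_for N emits_literal)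
  have clauses: "emits 0 (\<lambda>I _. concat (map (\<lambda>c. encode [bottom_gate (V I) (clause I c)]) [0..<Q I]))"
    by (rule emits_for[OF Q emits_bottom_gate[OF feasible_input_only[OF V] clause[OF feasible_mono]]])
  have levels: "emits 0 (\<lambda>I _. concat (map (\<lambda>d. concat
      (map (\<lambda>j. encode [level_gate (N I) (V I) (Q I) (R I) t (leaf I) d j]) [0..<R I ^ (t - d)]))
      [0..<t - 1]))"
    by (rule emits_concat_const, rule emits_for[OF feasible_power[OF R] emits_level_gate[OF N V Q R leaf]])
  have root: "emits 0 (\<lambda>I _. encode [connective False ([N I..<N I + Q I] @ [?top I..<?top I + R I ^ 2])])"
    by (intro emits_connective, unfold length_append map_append concat_append)
       (simp_all add: emits_append emits_interval feasible_add feasible_power feasible_level_offset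
         N Q R)
  have "encode (layered_circuit (N I) (V I) (Q I) (R I) t (clause I) (leaf I)) =
      concat (map (\<lambda>i. encode [LIT True i]) [0..<N I]) @
      concat (map (\<lambda>c. encode [bottom_gate (V I) (clause I c)]) [0..<Q I]) @
      concat (map (\<lambda>d. concat (map
        (\<lambda>j. encode [level_gate (N I) (V I) (Q I) (R I) t (leaf I) d j]) [0..<R I ^ (t - d)])) [0..<t - 1]) @
      encode [connective False ([N I..<N I + Q I] @ [?top I..<?top I + R I ^ 2])]" for I
    unfolding layered_circuit_def encode_append encode_concat encode_map connective_def if_False ..
  then show ?thesis by (simp only:) (intro emits_append variables clauses levels root)
qed

lemma feasible_pred_digits:
  assumes R: "feasible 0 (\<lambda>I _. R I)" and v: "feasible b v"
    and P: "\<And>vs. length vs = t \<Longrightarrow> (\<forall>v\<in>set vs. feasible b v) \<Longrightarrow>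
        feasible_pred b (\<lambda>I \<rho>. P I \<rho> (map (\<lambda>v. v I \<rho>) vs))"
  shows "feasible_pred b (\<lambda>I \<rho>. P I \<rho> (digits (R I) t (v I \<rho>)))"
proof -
  let ?digits = "map (\<lambda>p I \<rho>. v I \<rho> div R I ^ (t - 1 - p) mod R I) [0..<t]"
  have "feasible_pred b (\<lambda>I \<rho>. P I \<rho> (map (\<lambda>v. v I \<rho>) ?digits))"
    using v by (intro P) (auto intro!: feasible_mod feasible_div feasible_power
      feasible_input_only[OF R])
  then show ?thesis by (simp add: digits_def digit_def comp_def)
qed

lemma emits_choice_circuit:
  assumes N: "feasible 0 (\<lambda>I _. N I)" and K: "feasible 0 (\<lambda>I _. K I)"
    and B: "feasible 0 (\<lambda>I _. B I)" and R: "feasible 0 (\<lambda>I _. R I)"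
    and allowed: "\<And>J v J' v' b. feasible b J \<Longrightarrow> feasible b v \<Longrightarrow> feasible b J' \<Longrightarrow> feasible b v' \<Longrightarrow>
      feasible_pred b (\<lambda>I \<rho>. allowed I (J I \<rho>) (v I \<rho>) (J' I \<rho>) (v' I \<rho>))"
    and leaf: "\<And>gs J v b. length gs = t \<Longrightarrow> (\<forall>g\<in>set gs. feasible b g) \<Longrightarrow> feasible b J \<Longrightarrow> feasible b v \<Longrightarrow>
      feasible_pred b (\<lambda>I \<rho>. leaf I (map (\<lambda>g. g I \<rho>) gs) (J I \<rho>) (v I \<rho>))"
  shows "emits 0 (\<lambda>I _. encode (choice_circuit (N I) (K I) (B I) (R I) t (allowed I) (leaf I)))"
  unfolding choice_circuit_def
proof (intro emits_layered_circuit feasible_intros N K B R)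
  fix v w b assume v: "feasible b v" and w: "feasible b w"
  have K': "feasible b (\<lambda>I _. K I)" and B': "feasible b (\<lambda>I _. B I)" using K B
    by (auto intro: feasible_input_only)
  with v w show "feasible_pred b (\<lambda>I \<rho>. choice_clause (K I) (B I) (allowed I) (v I \<rho>) (w I \<rho>))"
    unfolding choice_clause_def by (intro feasible_intros allowed)
  have "feasible_pred b (\<lambda>I \<rho>. leaf I (digits (R I) t (v I \<rho>)) (w I \<rho> div B I) (w I \<rho> mod B I))"
    using w B' by (intro feasible_pred_digits[OF R v, of t "\<lambda>I \<rho> gs. leaf I gs (w I \<rho> div B I) (w I \<rho> mod B I)"] leaf
      feasible_div feasible_mod)
  with K' B' w show "feasible_pred b
      (\<lambda>I \<rho>. choice_leaf (K I) (B I) (leaf I) (digits (R I) t (v I \<rho>)) (w I \<rho>))"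
    unfolding choice_leaf_def by (intro feasible_intros)
qed

subsection \<open>Parsing a circuit\<close>

definition falses :: "bool list \<Rightarrow> nat \<Rightarrow> nat" where
  "falses x a = (\<Sum>b<a. of_bool (b < length x \<and> \<not> x ! b))"

text \<open>The number whose unary code follows the first \<open>p\<close> occurrences of \<open>False\<close>.\<close>

definition token :: "bool list \<Rightarrow> nat \<Rightarrow> nat" where
  "token x p = (\<Sum>a<length x. of_bool (x ! a \<and> falses x a = p))"

lemma falses_Cons: "falses (b # x) (Suc a) = of_bool (\<not> b) + falses x a"
  unfolding falses_def sum.lessThan_Suc_shift by simp

lemma token_Cons:
  "token (True # x) p = of_bool (p = 0) + token x p"
  "token (False # x) p = (if p = 0 then 0 else token x (p - 1))"
proof -
  have "falses (b # x) 0 = 0" for b by (simp add: falses_def)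
  then show "token (True # x) p = of_bool (p = 0) + token x p"
    and "token (False # x) p = (if p = 0 then 0 else token x (p - 1))"
    unfolding token_def length_Cons sum.lessThan_Suc_shift by (cases p; auto simp: falses_Cons)+
qed

lemma token_encode_nat_append: "token (encode_nat n @ x) p = (if p = 0 then n else token x (p - 1))"
  by (induction n) (auto simp: encode_nat_def token_Cons)

lemma falses_encode_nat_append:
  "falses (encode_nat n @ x) (length (encode_nat n) + a) = Suc (falses x a)"
  by (induction n) (auto simp: encode_nat_def falses_Cons)

lemma token_concat: "token (concat (map encode_nat ns)) p = (if p < length ns then ns ! p else 0)"
proof (induction ns arbitrary: p)
  case Nil
  show ?case by (simp add: token_def)
next
  case (Cons n ns)
  then show ?case by (cases p) (simp_all add: token_encode_nat_append)
qed

lemma falses_concat: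
  "falses (concat (map encode_nat ns)) (length (concat (map encode_nat ns))) = length ns"
proof (induction ns)
  case Nil
  show ?case by (simp add: falses_def)
next
  case (Cons n ns)
  then show ?case by (simp add: falses_encode_nat_append del: length_concat)
qed

lemma token_le_length: "token x p \<le> length x"
  unfolding token_def by (rule order_trans[OF sum_bounded_above[where K=1]]) auto

definition gate_start :: "bool list \<Rightarrow> nat \<Rightarrow> nat" where
  "gate_start x i = rec_nat 0 (\<lambda>_ r. r + 1 + token x r) i"

definition num_gates :: "bool list \<Rightarrow> nat" where
  "num_gates x = (\<Sum>i<length x. of_bool (gate_start x i < falses x (length x)))"

definition gate_kind :: "bool list \<Rightarrow> nat \<Rightarrow> nat" where
  "gate_kind x i = token x (gate_start x i + 1)"

definition num_args :: "bool list \<Rightarrow> nat \<Rightarrow> nat" where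
  "num_args x i = token x (gate_start x i) - 1"

definition gate_arg :: "bool list \<Rightarrow> nat \<Rightarrow> nat \<Rightarrow> nat" where
  "gate_arg x i p = token x (gate_start x i + 2 + p)"

definition tokens :: "circuit \<Rightarrow> nat list" where
  "tokens C = concat (map (\<lambda>i. length (gate_code (C ! i)) # gate_code (C ! i)) [0..<length C])"

lemma encode_tokens: "encode C = concat (map encode_nat (tokens C))"
proof -
  have "encode D = concat (map encode_nat (concat (map (\<lambda>G. length (gate_code G) # gate_code G) D)))" for D
    by (induction D) (auto simp: encode_def encode_nats_def)
  moreover have "map (\<lambda>G. length (gate_code G) # gate_code G) C =
      map (\<lambda>i. length (gate_code (C ! i)) # gate_code (C ! i)) [0..<length C]"
    by (rule nth_equalityI) auto
  ultimately show ?thesis by (simp add: tokens_def)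
qed

lemma token_encode: "token (encode C) p = (if p < length (tokens C) then tokens C ! p else 0)"
  unfolding encode_tokens by (rule token_concat)

lemma length_tokens: "length (tokens C) = (\<Sum>i<length C. 1 + length (gate_code (C ! i)))"
  by (simp add: tokens_def length_concat sum_list_sum_nth atLeast0LessThan)

lemma tokens_nth:
  assumes "i < length C" "q \<le> length (gate_code (C ! i))"
  defines "s \<equiv> \<Sum>i'<i. 1 + length (gate_code (C ! i'))"
  shows "s + q < length (tokens C)"
    "tokens C ! (s + q) = (length (gate_code (C ! i)) # gate_code (C ! i)) ! q"
proof -
  have "s + q < (\<Sum>i'<Suc i. 1 + length (gate_code (C ! i')))" using assms by simp
  also have "\<dots> \<le> length (tokens C)" unfolding length_tokens using assms(1) by (intro sum_mono2) auto
  finally show "s + q < length (tokens C)" .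
  show "tokens C ! (s + q) = (length (gate_code (C ! i)) # gate_code (C ! i)) ! q"
    using concat_nth_offset[of i "length C" q "\<lambda>i. length (gate_code (C ! i)) # gate_code (C ! i)"]
      assms
    by (simp add: tokens_def)
qed

lemma gate_start_encode:
  "i \<le> length C \<Longrightarrow> gate_start (encode C) i = (\<Sum>i'<i. 1 + length (gate_code (C ! i')))"
proof (induction i)
  case (Suc i)
  then have "gate_start (encode C) i = (\<Sum>i'<i. 1 + length (gate_code (C ! i')))" by simp
  moreover have "token (encode C) (\<Sum>i'<i. 1 + length (gate_code (C ! i'))) =
      length (gate_code (C ! i))"
    using tokens_nth[of i C 0] Suc.prems by (simp add: token_encode)
  ultimately show ?case by (simp add: gate_start_def)
qed (simp add: gate_start_def)

lemma gate_start_mono: "i \<le> j \<Longrightarrow> gate_start x i \<le> gate_start x j"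
  by (rule lift_Suc_mono_le[of "gate_start x"]) (auto simp: gate_start_def)

lemma length_le_encode: "length C \<le> length (encode C)"
  by (induction C) (auto simp: encode_def encode_nats_def encode_nat_def)

lemma num_gates_encode: "num_gates (encode C) = length C"
proof -
  have "gate_start (encode C) i < length (tokens C) \<longleftrightarrow> i < length C" for i
  proof
    assume "i < length C"
    then show "gate_start (encode C) i < length (tokens C)"
      using tokens_nth(1)[of i C 0] by (simp add: gate_start_encode)
  next
    assume "gate_start (encode C) i < length (tokens C)"
    then have "\<not> gate_start (encode C) (length C) \<le> gate_start (encode C) i"
      by (simp add: gate_start_encode length_tokens)
    then show "i < length C" using gate_start_mono[of "length C" i "encode C"] by linarith
  qed
  then have "num_gates (encode C) = (\<Sum>i<length (encode C). of_bool (i < length C))"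
    using falses_concat[of "tokens C"] by (simp add: num_gates_def encode_tokens[symmetric])
  also have "\<dots> = card {i. i < length (encode C) \<and> i < length C}"
    by (simp add: of_bool_def sum.If_cases Int_def)
  also have "{i. i < length (encode C) \<and> i < length C} = {..<length C}" using length_le_encode[of C]
    by auto
  finally show ?thesis by simp
qed

lemma gate_code_parse:
  assumes "i < length C"
  shows "num_args (encode C) i = length (gate_code (C ! i)) - 1"
    "gate_kind (encode C) i = gate_code (C ! i) ! 0"
    "p + 1 < length (gate_code (C ! i)) \<Longrightarrow> gate_arg (encode C) i p = gate_code (C ! i) ! (p + 1)"
proof -
  have start: "gate_start (encode C) i = (\<Sum>i'<i. 1 + length (gate_code (C ! i')))"
    using assms by (intro gate_start_encode) simp
  show "num_args (encode C) i = length (gate_code (C ! i)) - 1"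
    using tokens_nth[OF assms, of 0] by (simp add: num_args_def token_encode start)
  have "1 \<le> length (gate_code (C ! i))" by (cases "C ! i") auto
  then show "gate_kind (encode C) i = gate_code (C ! i) ! 0"
    using tokens_nth[OF assms, of 1] by (simp add: gate_kind_def token_encode start)
  show "gate_arg (encode C) i p = gate_code (C ! i) ! (p + 1)"
    if "p + 1 < length (gate_code (C ! i))"
    using tokens_nth[OF assms, of "p + 2"] that
    by (simp add: gate_arg_def token_encode start add.assoc)
qed

lemma gate_parse:
  assumes "i < length C"
  shows "C ! i = LIT b v \<Longrightarrow> gate_kind (encode C) i = of_bool b \<and> gate_arg (encode C) i 0 = v"
    and "C ! i = NOT j \<Longrightarrow> gate_kind (encode C) i = 2 \<and> gate_arg (encode C) i 0 = j"
    and "C ! i = AND js \<Longrightarrow> gate_kind (encode C) i = 3 \<and> num_args (encode C) i = length js \<and>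
        (\<forall>p<length js. gate_arg (encode C) i p = js ! p)"
    and "C ! i = OR js \<Longrightarrow> gate_kind (encode C) i = 4 \<and> num_args (encode C) i = length js \<and>
        (\<forall>p<length js. gate_arg (encode C) i p = js ! p)"
  using gate_code_parse[OF assms] by auto

lemma gate_parse_connective:
  assumes "i < length C" "C ! i = connective any js"
  shows "gate_kind (encode C) i = (if any then 4 else 3)" "num_args (encode C) i = length js"
    "a < length js \<Longrightarrow> gate_arg (encode C) i a = js ! a"
  using gate_parse(3,4)[OF assms(1)] assms(2) by (auto simp: connective_def split: if_splits)

lemma gate_kind_le_1_iff:
  assumes "i < length C"
  shows "gate_kind (encode C) i \<le> 1 \<longleftrightarrow> is_LIT (C ! i)"
  using gate_parse[OF assms] by (cases "C ! i") auto

lemma gate_arg_le_length: "gate_arg x i p \<le> length x"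
  unfolding gate_arg_def by (rule token_le_length)

definition is_variable :: "bool list \<Rightarrow> nat \<Rightarrow> bool" where
  "is_variable x v \<longleftrightarrow> (\<exists>i<num_gates x. gate_kind x i \<le> 1 \<and> gate_arg x i 0 = v)"

lemma is_variable_vars: "Collect (is_variable (encode C)) = vars C"
proof -
  have "gate_kind (encode C) i \<le> 1 \<and> gate_arg (encode C) i 0 = v \<longleftrightarrow> (\<exists>b. C ! i = LIT b v)"
    if "i < length C" for i v
    unfolding gate_kind_le_1_iff[OF that] using gate_parse(1)[OF that] by (cases "C ! i") auto
  then have "is_variable (encode C) v \<longleftrightarrow> (\<exists>i<length C. \<exists>b. C ! i = LIT b v)" for v
    by (simp add: is_variable_def num_gates_encode) blast
  then show ?thesis unfolding vars_def in_set_conv_nth by blast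
qed

lemma feasible_falses: "feasible a v \<Longrightarrow> feasible a (\<lambda>I \<rho>. falses (fst I) (v I \<rho>))"
proof -
  have "b < length x \<and> \<not> x ! b \<longleftrightarrow> b < length x \<and> \<not> (b < length x \<and> x ! b)" for b and x :: "bool list"
    by auto
  moreover have "feasible_pred b
      (\<lambda>I \<rho>. w I \<rho> < length (fst I) \<and> \<not> (w I \<rho> < length (fst I) \<and> fst I ! w I \<rho>))"
    if "feasible b w" for b w
    using that by (intro feasible_intros feasible_pred_input_bit)
  ultimately show "feasible a v \<Longrightarrow> ?thesis"
    unfolding falses_def by (intro feasible_sum) (simp_all add: feasible_pred_def)
qed

lemma feasible_token:
  assumes "feasible a v"
  shows "feasible a (\<lambda>I \<rho>. token (fst I) (v I \<rho>))"
proof -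
  have "token x p = (\<Sum>a<length x. of_bool ((a < length x \<and> x ! a) \<and> falses x a = p))" for x p
    unfolding token_def by (intro sum.cong) auto
  moreover have "feasible_pred b
      (\<lambda>I \<rho>. (w I \<rho> < length (fst I) \<and> fst I ! w I \<rho>) \<and> falses (fst I) (w I \<rho>) = v I \<rho>)"
    if "a \<le> b" "feasible b w" for b w
    using that feasible_mono[OF assms that(1)]
    by (intro feasible_pred_conj feasible_pred_eq feasible_pred_input_bit feasible_falses)
  ultimately show ?thesis
    by (simp only:) (intro feasible_sum feasible_length, simp only: feasible_pred_def)
qed

lemma feasible_gate_start:
  assumes v: "feasible a v"
  shows "feasible a (\<lambda>I \<rho>. gate_start (fst I) (v I \<rho>))"
  unfolding gate_start_def
proof (rule feasible_rec[OF v feasible_const, where M="\<lambda>I \<rho>. v I \<rho> * (length (fst I) + 1)"])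
  show "feasible b (\<lambda>I \<rho>. w I \<rho> + 1 + token (fst I) (w I \<rho>))" if "feasible b w" for w b
    using that by (intro feasible_add feasible_const feasible_token)
  show "fpt_bounded a (\<lambda>I \<rho>. v I \<rho> * (length (fst I) + 1))"
    by (intro fpt_bounded_intros feasible_fpt_bounded[OF v order_refl]
      feasible_fpt_bounded[OF feasible_length order_refl])
  fix I :: input and \<rho> i assume i: "i \<le> v I \<rho>"
  have "rec_nat 0 (\<lambda>_ r. r + 1 + token x r) i \<le> i * (length x + 1)" for x
  proof (induction i)
    case (Suc i)
    then show ?case using token_le_length[of x "rec_nat 0 (\<lambda>_ r. r + 1 + token x r) i"] by simp
  qed simp
  also have "i * (length (fst I) + 1) \<le> v I \<rho> * (length (fst I) + 1)" using i
    by (rule mult_le_mono1)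
  finally show "rec_nat 0 (\<lambda>_ r. r + 1 + token (fst I) r) i \<le> v I \<rho> * (length (fst I) + 1)" .
qed

lemma feasible_num_gates: "feasible a (\<lambda>I \<rho>. num_gates (fst I))"
proof -
  have "feasible_pred b (\<lambda>I \<rho>. gate_start (fst I) (w I \<rho>) < falses (fst I) (length (fst I)))"
    if "feasible b w" for b w
    using that by (intro feasible_pred_less feasible_gate_start feasible_falses feasible_length)
  then show ?thesis
    unfolding num_gates_def by (intro feasible_sum feasible_length)
      (simp_all add: feasible_pred_def)
qed

lemma feasible_gate_kind: "feasible a v \<Longrightarrow> feasible a (\<lambda>I \<rho>. gate_kind (fst I) (v I \<rho>))"
  unfolding gate_kind_def by (intro feasible_token feasible_add feasible_gate_start feasible_const)

lemma feasible_num_args: "feasible a v \<Longrightarrow> feasible a (\<lambda>I \<rho>. num_args (fst I) (v I \<rho>))"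
  unfolding num_args_def by (intro feasible_diff feasible_token feasible_gate_start feasible_const)

lemma feasible_gate_arg:
  "feasible a v \<Longrightarrow> feasible a w \<Longrightarrow> feasible a (\<lambda>I \<rho>. gate_arg (fst I) (v I \<rho>) (w I \<rho>))"
  unfolding gate_arg_def by (intro feasible_token feasible_add feasible_gate_start feasible_const)

lemma feasible_pred_is_variable:
  assumes v: "feasible a v"
  shows "feasible_pred a (\<lambda>I \<rho>. is_variable (fst I) (v I \<rho>))"
  unfolding is_variable_def
proof (rule feasible_pred_ex[OF feasible_num_gates])
  fix w b assume b: "a \<le> b" "feasible b w"
  then show "feasible_pred b
      (\<lambda>I \<rho>. gate_kind (fst I) (w I \<rho>) \<le> 1 \<and> gate_arg (fst I) (w I \<rho>) 0 = v I \<rho>)"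
    using feasible_mono[OF v b(1)]
    by (intro feasible_pred_conj feasible_pred_le feasible_pred_eq feasible_gate_kind
      feasible_gate_arg feasible_const)
qed

subsection \<open>Reductions that choose a set by its gaps\<close>

definition genus_padding :: "(nat \<Rightarrow> nat) \<Rightarrow> nat \<Rightarrow> nat \<Rightarrow> bool" where
  "genus_padding g a0 d \<longleftrightarrow> (\<forall>a N. a0 \<le> a \<longrightarrow> a ^ d \<le> N \<longrightarrow> 2 * a ^ 2 \<le> g N)"

lemma ex_genus_padding:
  assumes c: "c > 0" and g: "(\<lambda>n. real (g n)) \<in> \<Omega>(\<lambda>n. real n powr c)"
  shows "\<exists>a0 d. genus_padding g a0 d"
proof -
  obtain \<epsilon> where \<epsilon>: "\<epsilon> > 0"
    and "eventually (\<lambda>n. norm (real (g n)) \<ge> \<epsilon> * norm (real n powr c)) at_top"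
    using landau_omega.bigE[OF g] by blast
  then obtain N0 where N0: "\<And>n. N0 \<le> n \<Longrightarrow> \<epsilon> * real n powr c \<le> real (g n)"
    unfolding eventually_at_top_linorder by auto
  obtain a0 :: nat where a0: "real N0 + 2 / \<epsilon> + 1 \<le> real a0" using real_nat_ceiling_ge by blast
  obtain d :: nat where "3 / c \<le> real d" using real_nat_ceiling_ge by blast
  then have d: "3 \<le> real d * c" using c by (simp add: field_simps)
  then have "d \<noteq> 0" by (intro notI) simp
  have "2 * a ^ 2 \<le> g N" if "a0 \<le> a" and N: "a ^ d \<le> N" for a N
  proof -
    have "0 < 2 / \<epsilon>" using \<epsilon> by simp
    then have "real N0 \<le> real a" "1 \<le> real a" "2 / \<epsilon> \<le> real a" using a0 \<open>a0 \<le> a\<close> by linarith+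
    then have a: "N0 \<le> a" "1 \<le> a" "2 \<le> \<epsilon> * real a" using \<epsilon> by (auto simp: field_simps)
    have "a \<le> a ^ d" using a(2) \<open>d \<noteq> 0\<close> by (simp add: self_le_power)
    then have "N0 \<le> N" using N a(1) by simp
    have "2 * real a ^ 2 \<le> \<epsilon> * real a * real a ^ 2" using a(3) by (rule mult_right_mono) simp
    also have "\<dots> = \<epsilon> * real a powr 3" using a(2)
      by (simp add: power2_eq_square power3_eq_cube mult.assoc)
    also have "\<dots> \<le> \<epsilon> * real a powr (real d * c)" using a(2) d \<epsilon>
      by (intro mult_left_mono powr_mono) auto
    also have "real a powr (real d * c) = real (a ^ d) powr c"
      using a(2) by (simp add: powr_powr[symmetric] powr_realpow)
    also have "\<epsilon> * real (a ^ d) powr c \<le> \<epsilon> * real N powr c"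
      using N c \<epsilon> by (intro mult_left_mono powr_mono2)
        (simp_all only: of_nat_le_iff of_nat_0_le_iff less_imp_le)
    also have "\<dots> \<le> real (g N)" using \<open>N0 \<le> N\<close> by (rule N0)
    finally have "real (2 * a ^ 2) \<le> real (g N)" by simp
    then show ?thesis by (simp only: of_nat_le_iff)
  qed
  then show ?thesis unfolding genus_padding_def by blast
qed

lemma weighted_sat_simps:
  "(encode C, k) \<in> instances (weighted_sat \<C>) \<longleftrightarrow> \<C> C"
  "(encode C, k) \<in> yes_instances (weighted_sat \<C>) \<longleftrightarrow> \<C> C \<and> weight_satisfiable C k"
  by (auto simp: weighted_sat_def encode_eq_iff)

lemma weighted_sat_instanceE:
  assumes "(x, k) \<in> instances (weighted_sat \<C>)"
  obtains C where "x = encode C" "\<C> C"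
  using assms by (auto simp: weighted_sat_def)

lemma fpt_reducible_weighted_sat_mono:
  assumes "fpt_reducible P (weighted_sat \<C>)" "\<And>C. \<C> C \<Longrightarrow> \<D> C"
  shows "fpt_reducible P (weighted_sat \<D>)"
  using assms(1)
proof (rule fpt_reducible_extend)
  show "instances (weighted_sat \<C>) \<subseteq> instances (weighted_sat \<D>)"
    using assms(2) by (auto simp: weighted_sat_def)
  show "(x, k) \<in> yes_instances (weighted_sat \<C>) \<longleftrightarrow> (x, k) \<in> yes_instances (weighted_sat \<D>)"
    if "(x, k) \<in> instances (weighted_sat \<C>)" for x k
    using that assms(2) by (elim weighted_sat_instanceE) (simp add: weighted_sat_simps)
qed

definition gap_bound :: "input \<Rightarrow> nat" where
  "gap_bound I = length (fst I) + 3"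

lemma vars_less_gap_bound: "v \<in> vars C \<Longrightarrow> v + 1 < gap_bound (encode C, k) - 1"
  unfolding is_variable_vars[symmetric] is_variable_def gap_bound_def
  using gate_arg_le_length[of "encode C" _ 0] by (auto simp: less_Suc_eq_le)

lemma ex_gaps_vars:
  assumes "S \<subseteq> vars C" "card S = k"
  shows "\<exists>U. gaps k (gap_bound (encode C, k)) S U"
proof (rule ex_gaps)
  have "S \<subseteq> {..<gap_bound (encode C, k)}" using assms(1) vars_less_gap_bound[of _ C k] by force
  then show "finite S" by (rule finite_subset) simp
qed (use assms vars_less_gap_bound in \<open>auto simp: gap_bound_def\<close>)

lemma feasible_gap_bound: "feasible a (\<lambda>I _. gap_bound I)"
  unfolding gap_bound_def by (intro feasible_intros)

definition choice_size :: "nat \<Rightarrow> nat \<Rightarrow> nat \<Rightarrow> nat \<Rightarrow> nat" where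
  "choice_size K B R t = K * B + 1 + ((K * B + 1) * K + (\<Sum>d<t - 1. R ^ (t - d)))"

lemma (in choice) genus_le_choice_size: "circuit_genus C \<le> 2 * choice_size K B R t ^ 2"
proof -
  have "off (t - 1) - N = (K * B + 1) * K + (\<Sum>d<t - 1. R ^ (t - d))" by (simp add: level_offset_def)
  then show ?thesis using genus_C by (simp add: choice_size_def)
qed

locale gap_reduction =
  fixes t :: nat and g :: "nat \<Rightarrow> nat" and a0 d D :: nat and E B R :: "input \<Rightarrow> nat"
    and check :: "input \<Rightarrow> nat \<Rightarrow> nat \<Rightarrow> nat \<Rightarrow> nat \<Rightarrow> nat \<Rightarrow> bool"
    and cert :: "input \<Rightarrow> nat list \<Rightarrow> nat \<Rightarrow> nat \<Rightarrow> bool"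
  assumes two_le_t: "2 \<le> t" and even_t: "even t" and padding: "genus_padding g a0 d"
    and feasible_E: "feasible 0 (\<lambda>I _. E I)" and feasible_B: "feasible 0 (\<lambda>I _. B I)"
      and feasible_R: "feasible 0 (\<lambda>I _. R I)"
    and feasible_pred_check: "\<And>i u w e y b. feasible b i \<Longrightarrow> feasible b u \<Longrightarrow> feasible b w \<Longrightarrow>
        feasible b e \<Longrightarrow> feasible b y \<Longrightarrow>
      feasible_pred b (\<lambda>I \<rho>. check I (i I \<rho>) (u I \<rho>) (w I \<rho>) (e I \<rho>) (y I \<rho>))"
    and feasible_pred_cert: "\<And>gs e y b. length gs = t \<Longrightarrow> (\<forall>g\<in>set gs. feasible b g) \<Longrightarrow> feasible b e \<Longrightarrow>
        feasible b y \<Longrightarrow>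
      feasible_pred b (\<lambda>I \<rho>. cert I (map (\<lambda>g. g I \<rho>) gs) (e I \<rho>) (y I \<rho>))"
    and E_le: "\<And>x k. E (x, k) \<le> 2 ^ (D * (k + 1))"
    and gap_bound_le_B: "\<And>I. gap_bound I * gap_bound I \<le> B I" and R_le_B: "\<And>I. R I \<le> B I"
      and R_pos: "\<And>I. 0 < R I"
begin

definition weight :: "input \<Rightarrow> nat" where
  "weight I = snd I + 2 + E I"

definition num_vars :: "input \<Rightarrow> nat" where
  "num_vars I = weight I * B I + 1 + (choice_size (weight I) (B I) (R I) t + a0) ^ d"

definition gap_circuit :: "input \<Rightarrow> circuit" where
  "gap_circuit I = choice_circuit (num_vars I) (weight I) (B I) (R I) t
     (gap_compatible (snd I) (gap_bound I) (R I) (is_variable (fst I)) (check I))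
     (gap_leaf (snd I) (cert I))"

lemma choice: "choice (num_vars I) (weight I) (B I) (R I) t"
proof
  show "0 < B I" using R_pos[of I] R_le_B[of I] by simp
qed (simp_all add: num_vars_def R_pos two_le_t even_t)

lemma gap_circuit_WSAT_mono:
  "Pi_circuit t (gap_circuit I)" "monotone_circuit (gap_circuit I)"
  "circuit_genus (gap_circuit I) \<le> g (card (vars (gap_circuit I)))"
proof -
  interpret choice "num_vars I" "weight I" "B I" "R I" t
    "gap_compatible (snd I) (gap_bound I) (R I) (is_variable (fst I)) (check I)"
      "gap_leaf (snd I) (cert I)"
    by (rule choice)
  let ?a = "choice_size (weight I) (B I) (R I) t"
  have "2 * ?a ^ 2 \<le> 2 * (?a + a0) ^ 2" by (simp add: power_mono)
  also have "\<dots> \<le> g (num_vars I)" using padding unfolding genus_padding_def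
    by (simp add: num_vars_def)
  finally have "circuit_genus (gap_circuit I) \<le> g (num_vars I)"
    using genus_le_choice_size by (simp add: gap_circuit_def choice_circuit_def)
  then show "Pi_circuit t (gap_circuit I)" "monotone_circuit (gap_circuit I)"
    "circuit_genus (gap_circuit I) \<le> g (card (vars (gap_circuit I)))"
    using Pi_C monotone_C vars_C by (simp_all add: gap_circuit_def choice_circuit_def)
qed

lemma weight_satisfiable_gap_circuit:
  "weight_satisfiable (gap_circuit I) (weight I) \<longleftrightarrow>
     (\<exists>S U. S \<subseteq> Collect (is_variable (fst I)) \<and> gaps (snd I) (gap_bound I) S U \<and>
        certified (snd I) (E I) (B I) (R I) (t - 1) (check I) (cert I) U)"
  using choice.weight_satisfiable_iff[OF choice] ex_gap_choice_iff[OF gap_bound_le_B R_le_B R_pos]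
  by (simp add: gap_circuit_def choice_circuit_def weight_def)

lemma feasible_weight: "feasible a (\<lambda>I _. weight I)"
  unfolding weight_def by (intro feasible_intros feasible_input_only[OF feasible_E])

lemma emits_gap_circuit: "emits 0 (\<lambda>I _. encode (gap_circuit I))"
  unfolding gap_circuit_def
proof (rule emits_choice_circuit)
  note lift = feasible_B[THEN feasible_input_only] feasible_R[THEN feasible_input_only]
    feasible_weight feasible_gap_bound
  show "feasible 0 (\<lambda>I _. weight I)" by (rule feasible_weight)
  show "feasible 0 (\<lambda>I _. num_vars I)"
    unfolding num_vars_def choice_size_def by (intro feasible_intros feasible_sum_const lift)
  show "feasible_pred b (\<lambda>I \<rho>. gap_compatible (snd I) (gap_bound I) (R I) (is_variable (fst I)) (check I)
      (J I \<rho>) (v I \<rho>) (J' I \<rho>) (v' I \<rho>))"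
    if "feasible b J" "feasible b v" "feasible b J'" "feasible b v'" for J v J' v' b
    unfolding gap_compatible_def using that
    by (intro feasible_intros lift feasible_pred_is_variable feasible_pred_check)
  show "feasible_pred b (\<lambda>I \<rho>. gap_leaf (snd I) (cert I) (map (\<lambda>g. g I \<rho>) gs) (J I \<rho>) (v I \<rho>))"
    if "length gs = t" "\<forall>g\<in>set gs. feasible b g" "feasible b J" "feasible b v" for gs J v b
  proof -
    have "gs \<noteq> []" using that(1) two_le_t by auto
    then have "hd (map (\<lambda>g. g I \<rho>) gs) = hd gs I \<rho>" for I \<rho> by (simp add: hd_map)
    moreover have "feasible b (hd gs)" using that(2) \<open>gs \<noteq> []\<close> by simp
    ultimately show ?thesis
      unfolding gap_leaf_def using that by (simp only:) (intro feasible_intros feasible_pred_cert)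
  qed
qed (rule feasible_B feasible_R)+

lemma weight_le: "weight (x, k) \<le> 2 ^ ((D + 2) * (k + 1))"
proof -
  have "k + 2 \<le> 2 ^ (k + 1)" by (induction k) auto
  also have "\<dots> \<le> 2 ^ ((D + 1) * (k + 1))" by (intro power_increasing) auto
  finally have "k + 2 \<le> 2 ^ ((D + 1) * (k + 1))" .
  moreover have "E (x, k) \<le> 2 ^ ((D + 1) * (k + 1))"
    using E_le[of x k] by (rule order_trans) (intro power_increasing, auto)
  ultimately have "weight (x, k) \<le> 2 ^ ((D + 1) * (k + 1) + 1)" by (simp add: weight_def)
  also have "\<dots> \<le> 2 ^ ((D + 2) * (k + 1))" by (intro power_increasing) auto
  finally show ?thesis .
qed

theorem reduction:
  assumes P: "fpt_reducible P (weighted_sat \<C>)"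
    and satisfies: "\<And>C k S U. \<C> C \<Longrightarrow> gaps k (gap_bound (encode C, k)) S U \<Longrightarrow>
      satisfies S C \<longleftrightarrow> certified k (E (encode C, k)) (B (encode C, k)) (R (encode C, k)) (t - 1)
        (check (encode C, k)) (cert (encode C, k)) U"
  shows "fpt_reducible P (WSAT_mono t g)"
proof (rule fpt_reducible_transduce[OF P emits_gap_circuit feasible_weight weight_le])
  fix x k assume "(x, k) \<in> instances (weighted_sat \<C>)"
  then obtain C where x: "x = encode C" and C: "\<C> C" by (rule weighted_sat_instanceE)
  have "weight_satisfiable C k \<longleftrightarrow> (\<exists>S U. S \<subseteq> vars C \<and> gaps k (gap_bound (x, k)) S U \<and> satisfies S C)"
    unfolding weight_satisfiable_def x using ex_gaps_vars[of _ C k] gaps_card[of k] by metis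
  also have "\<dots> \<longleftrightarrow> weight_satisfiable (gap_circuit (x, k)) (weight (x, k))"
    unfolding weight_satisfiable_gap_circuit fst_conv snd_conv x is_variable_vars
      using satisfies[OF C] by blast
  finally show "(encode (gap_circuit (x, k)), weight (x, k)) \<in> instances (WSAT_mono t g) \<and>
      ((x, k) \<in> yes_instances (weighted_sat \<C>) \<longleftrightarrow>
       (encode (gap_circuit (x, k)), weight (x, k)) \<in> yes_instances (WSAT_mono t g))"
    unfolding WSAT_mono_def x weighted_sat_simps using C gap_circuit_WSAT_mono by simp
qed

end

subsection \<open>Prenex form of circuits of bounded weft\<close>

definition connect :: "bool \<Rightarrow> bool \<Rightarrow> bool \<Rightarrow> bool" where
  "connect any P Q \<longleftrightarrow> (if any then P \<or> Q else P \<and> Q)"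

definition guard :: "bool \<Rightarrow> bool \<Rightarrow> bool \<Rightarrow> bool" where
  "guard any G P \<longleftrightarrow> (if any then G \<and> P else G \<longrightarrow> P)"

lemma quant_connect: "0 < R \<Longrightarrow> quant b R (\<lambda>x. quant b R (\<lambda>y. connect any (P x) (Q y))) \<longleftrightarrow>
    connect any (quant b R P) (quant b R Q)"
  by (cases b) (auto simp: connect_def)

lemma quant_le_2:
  assumes "0 < n" "n \<le> 2"
  shows "quant any n P \<longleftrightarrow> connect any (P 0) (P (n - 1))"
proof -
  consider "n = 1" | "n = 2" using assms by linarith
  then show ?thesis by cases (auto simp: quant_def connect_def less_2_cases_iff)
qed

lemma quant_guard: "n \<le> R \<Longrightarrow> quant b R (\<lambda>g. guard b (g < n) (P g)) \<longleftrightarrow> quant b n P"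
  unfolding quant_def guard_def by (auto intro: less_le_trans)

lemma alt_quant_guard:
  "0 < R \<Longrightarrow> alt_quant R q n (\<lambda>gs. guard b G (P gs)) \<longleftrightarrow> guard b G (alt_quant R q n P)"
  by (cases b; cases G) (simp_all add: guard_def alt_quant_const)

lemma alt_quant_connect:
  assumes "0 < r"
  shows "alt_quant (r * r) b n
      (\<lambda>gs. connect any (P (map (\<lambda>g. g div r) gs)) (Q (map (\<lambda>g. g mod r) gs))) \<longleftrightarrow>
    connect any (alt_quant r b n P) (alt_quant r b n Q)"
proof (induction n arbitrary: b P Q)
  case (Suc n)
  have "alt_quant (r * r) (\<not> b) n
      (\<lambda>gs. connect any (P (x # map (\<lambda>g. g div r) gs)) (Q (y # map (\<lambda>g. g mod r) gs))) \<longleftrightarrow>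
      connect any (alt_quant r (\<not> b) n (\<lambda>gs. P (x # gs))) (alt_quant r (\<not> b) n (\<lambda>gs. Q (y # gs)))"
        for x y
    using Suc.IH[of "\<not> b" "\<lambda>gs. P (x # gs)" "\<lambda>gs. Q (y # gs)"] .
  then show ?case
    using quant_pair[of b r "\<lambda>x y.
        connect any (alt_quant r (\<not> b) n (\<lambda>gs. P (x # gs))) (alt_quant r (\<not> b) n (\<lambda>gs. Q (y # gs)))"]
      quant_connect[OF assms] by simp
qed simp

lemma alt_quant_div:
  "0 < r \<Longrightarrow> alt_quant (r * r) b n (\<lambda>gs. P (map (\<lambda>g. g div r) gs)) \<longleftrightarrow> alt_quant r b n P"
  using alt_quant_connect[of r b n False P "\<lambda>_. True"] by (simp add: connect_def alt_quant_const)

lemma alt_quant_mod: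
  "0 < r \<Longrightarrow> alt_quant (r * r) b n (\<lambda>gs. P (map (\<lambda>g. g mod r) gs)) \<longleftrightarrow> alt_quant r b n P"
  using alt_quant_connect[of r b n False "\<lambda>_. True" P] by (simp add: connect_def alt_quant_const)

lemma alt_quant_absorb:
  assumes "0 < r" "len \<le> r"
  shows "alt_quant (r * r) b (Suc n)
      (\<lambda>gs. guard b (hd gs div r < len) (P (hd gs div r) (map (\<lambda>g. g mod r) gs))) \<longleftrightarrow>
    quant b len (\<lambda>a. alt_quant r b (Suc n) (P a))"
proof -
  have "alt_quant (r * r) b (Suc n)
      (\<lambda>gs. guard b (hd gs div r < len) (P (hd gs div r) (map (\<lambda>g. g mod r) gs))) \<longleftrightarrow>
      quant b (r * r) (\<lambda>g. guard b (g div r < len) (alt_quant r (\<not> b) n (\<lambda>hs. P (g div r) (g mod r # hs))))"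
    using alt_quant_mod[OF assms(1), of "\<not> b" n "\<lambda>hs. P a (c # hs)" for a c] assms(1)
    by (simp add: alt_quant_guard)
  also have "\<dots> \<longleftrightarrow> quant b r (\<lambda>a. quant b r (\<lambda>c. guard b (a < len) (alt_quant r (\<not> b) n (\<lambda>hs. P a (c # hs)))))"
    by (rule quant_pair)
  also have "\<dots> \<longleftrightarrow> quant b r (\<lambda>a. guard b (a < len) (alt_quant r b (Suc n) (P a)))"
    using alt_quant_guard[OF assms(1), of b 1 b G "\<lambda>gs. F (hd gs)" for G F] by simp
  also have "\<dots> \<longleftrightarrow> quant b len (\<lambda>a. alt_quant r b (Suc n) (P a))" using assms(2) by (rule quant_guard)
  finally show ?thesis .
qed

text \<open>
  The value of vertex \<open>i\<close> (or of its negation, if \<open>b\<close> is false) as the matrix of a prenex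
  formula whose quantifiers range over the list \<open>gs\<close>; the leading quantifier is existential iff
  \<open>q\<close>. At a gate of fan-in at most 2 every index encodes a pair of indices, one for each input;
  a large gate is absorbed into the next quantifier of its own type, whose index also encodes
  the chosen input. The leaves are addressed by the numbers \<open>p, \<dots>, p + 2 ^ n - 1\<close>.
\<close>

primrec prenex ::
  "bool list \<Rightarrow> nat \<Rightarrow> (bool \<Rightarrow> nat \<Rightarrow> nat \<Rightarrow> bool) \<Rightarrow> nat \<Rightarrow> bool \<Rightarrow> bool \<Rightarrow> nat \<Rightarrow> nat list \<Rightarrow>
    nat \<Rightarrow> bool" where
  "prenex x m leaf 0 b q i gs p = leaf (b = (gate_kind x i = 1)) (gate_arg x i 0) p"
| "prenex x m leaf (Suc n) b q i gs p =
    (let r = m ^ (2 ^ n); any = ((gate_kind x i = 4) = b); hs = (if q = any then gs else tl gs) in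
     if gate_kind x i \<le> 1 then leaf (b = (gate_kind x i = 1)) (gate_arg x i 0) p
     else if gate_kind x i = 2 then prenex x m leaf n (\<not> b) q (gate_arg x i 0) (map (\<lambda>g. g div r) gs) p
     else if num_args x i \<le> 2 then
       connect any (prenex x m leaf n b q (gate_arg x i 0) (map (\<lambda>g. g div r) gs) p)
         (prenex x m leaf n b q (gate_arg x i (num_args x i - 1)) (map (\<lambda>g. g mod r) gs) (p + 2 ^ n))
     else guard any (hd hs div r < num_args x i)
       (prenex x m leaf n b any (gate_arg x i (hd hs div r)) (map (\<lambda>g. g mod r) hs) p))"

lemma prenex_literal:
  "gate_kind x i \<le> 1 \<Longrightarrow> prenex x m leaf n b q i gs p =
      leaf (b = (gate_kind x i = 1)) (gate_arg x i 0) p"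
  by (cases n) simp_all

lemma prenex_negation:
  "gate_kind x i = 2 \<Longrightarrow> prenex x m leaf (Suc n) b q i gs p =
    prenex x m leaf n (\<not> b) q (gate_arg x i 0) (map (\<lambda>g. g div m ^ (2 ^ n)) gs) p"
  by simp

lemma prenex_small:
  "2 < gate_kind x i \<Longrightarrow> num_args x i \<le> 2 \<Longrightarrow> prenex x m leaf (Suc n) b q i gs p =
    connect ((gate_kind x i = 4) = b)
      (prenex x m leaf n b q (gate_arg x i 0) (map (\<lambda>g. g div m ^ (2 ^ n)) gs) p)
      (prenex x m leaf n b q (gate_arg x i (num_args x i - 1)) (map (\<lambda>g. g mod m ^ (2 ^ n)) gs) (p + 2 ^ n))"
  by (simp add: Let_def)

lemma prenex_large:
  fixes b :: bool and m n :: nat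
  assumes "2 < gate_kind x i" "2 < num_args x i"
  defines "any \<equiv> (gate_kind x i = 4) = b" and "r \<equiv> m ^ (2 ^ n)"
  shows "prenex x m leaf (Suc n) b q i gs p =
    (let hs = if q = any then gs else tl gs in guard any (hd hs div r < num_args x i)
      (prenex x m leaf n b any (gate_arg x i (hd hs div r)) (map (\<lambda>g. g mod r) hs) p))"
  using assms(1,2) by (simp add: Let_def any_def r_def)

lemma power_two_power_Suc: "m ^ (2 ^ Suc n) = m ^ (2 ^ n) * m ^ (2 ^ n)" for m :: nat
  by (simp add: power_add[symmetric] mult_2)

lemma alt_quant_prenex_small:
  assumes "0 < m" "gate_kind x i = (if any then 4 else 3)" "0 < num_args x i" "num_args x i \<le> 2"
    and inputs: "\<And>a p. a < num_args x i \<Longrightarrow>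
      alt_quant (m ^ (2 ^ n)) q L (\<lambda>gs. prenex x m leaf n b q (gate_arg x i a) gs p) \<longleftrightarrow> V a"
  shows "alt_quant (m ^ (2 ^ Suc n)) q L (\<lambda>gs. prenex x m leaf (Suc n) b q i gs p) \<longleftrightarrow>
    quant (any = b) (num_args x i) V"
proof -
  have "2 < gate_kind x i" and any: "(gate_kind x i = 4) = any" using assms(2) by simp_all
  have "0 < m ^ (2 ^ n)" using assms(1) by simp
  show ?thesis
    unfolding power_two_power_Suc prenex_small[OF \<open>2 < gate_kind x i\<close> assms(4)] any
      quant_le_2[OF assms(3,4)]
      alt_quant_connect[OF \<open>0 < m ^ (2 ^ n)\<close>, where P="\<lambda>gs. prenex x m leaf n b q (gate_arg x i 0) gs p"
        and Q="\<lambda>gs. prenex x m leaf n b q (gate_arg x i (num_args x i - 1)) gs (p + 2 ^ n)"]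
    using inputs assms(3) by simp
qed

lemma alt_quant_prenex_large:
  assumes "0 < m" "gate_kind x i = (if any then 4 else 3)" "2 < num_args x i"
    "num_args x i \<le> m ^ (2 ^ n)" "2 \<le> L"
    and inputs: "\<And>a L'. a < num_args x i \<Longrightarrow> L \<le> Suc L' \<Longrightarrow>
      alt_quant (m ^ (2 ^ n)) (any = b) L'
        (\<lambda>gs. prenex x m leaf n b (any = b) (gate_arg x i a) gs p) \<longleftrightarrow> V a"
  shows "alt_quant (m ^ (2 ^ Suc n)) q L (\<lambda>gs. prenex x m leaf (Suc n) b q i gs p) \<longleftrightarrow>
    quant (any = b) (num_args x i) V"
proof -
  define r where "r = m ^ (2 ^ n)"
  have "0 < r" and r: "m ^ (2 ^ Suc n) = r * r"
    using assms(1) by (simp_all only: r_def power_two_power_Suc zero_less_power)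
  let ?A = "\<lambda>gs. guard (any = b) (hd gs div r < num_args x i)
    (prenex x m leaf n b (any = b) (gate_arg x i (hd gs div r)) (map (\<lambda>g. g mod r) gs) p)"
  have absorb: "alt_quant (r * r) (any = b) L' ?A \<longleftrightarrow> quant (any = b) (num_args x i) V"
    if "L \<le> Suc L'" for L'
  proof -
    have "L' \<noteq> 0" using assms(5) that by auto
    then obtain l where l: "L' = Suc l" by (rule not0_implies_Suc[THEN exE])
    have "alt_quant (r * r) (any = b) L' ?A \<longleftrightarrow> quant (any = b) (num_args x i)
        (\<lambda>a. alt_quant r (any = b) L' (\<lambda>gs. prenex x m leaf n b (any = b) (gate_arg x i a) gs p))"
      unfolding l using \<open>0 < r\<close> assms(4) by (intro alt_quant_absorb) (simp_all add: r_def)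
    also have "\<dots> \<longleftrightarrow> quant (any = b) (num_args x i) V"
      using inputs that by (intro quant_cong) (simp add: r_def)
    finally show ?thesis .
  qed
  have step: "prenex x m leaf (Suc n) b q i gs p = ?A (if q = (any = b) then gs else tl gs)" for gs
    using prenex_large[of x i] assms(2,3) by (simp add: Let_def r_def)
  show ?thesis
  proof (cases "q = (any = b)")
    case True
    show ?thesis unfolding r step if_P[OF True] unfolding True by (rule absorb) simp
  next
    case False
    obtain l where l: "L = Suc l" using assms(5) by (cases L) auto
    have "(\<not> q) = (any = b)" "0 < r * r" using False \<open>0 < r\<close> by auto
    then show ?thesis
      unfolding r step if_not_P[OF False] l alt_quant.simps(2) list.sel(3)
      using absorb[of l] by (simp only: l quant_const order_refl)
  qed
qed

lemma alt_quant_prenex_connective: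
  assumes wf: "wf_circuit C" and m: "length C + 2 \<le> m" and i: "i < length C"
    and G: "C ! i = connective any js"
    and L: "path_value (\<lambda>G. 2 < length (fan_in G)) C i < L"
    and inputs: "\<And>j q' p' L'. j \<in> set js \<Longrightarrow> L \<le> of_bool (2 < length js) + L' \<Longrightarrow>
      alt_quant (m ^ (2 ^ n)) q' L' (\<lambda>gs. prenex (encode C) m leaf n b q' j gs p') \<longleftrightarrow>
        gate_value S C j = b"
  shows "alt_quant (m ^ (2 ^ Suc n)) q L (\<lambda>gs. prenex (encode C) m leaf (Suc n) b q i gs p) \<longleftrightarrow>
      gate_value S C i = b"
proof -
  have "0 < m" "m \<le> m ^ (2 ^ n)" using m by (auto intro: self_le_power)
  have fan_in: "fan_in (C ! i) = js" using G by simp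
  have js: "0 < length js" "length js \<le> m ^ (2 ^ n)"
    using fan_in_nonempty[OF wf i] length_fan_in_le[OF wf i] G m \<open>m \<le> m ^ (2 ^ n)\<close> by auto
  note parse = gate_parse_connective[OF i G]
  have "alt_quant (m ^ (2 ^ Suc n)) q L (\<lambda>gs. prenex (encode C) m leaf (Suc n) b q i gs p) \<longleftrightarrow>
    quant (any = b) (num_args (encode C) i) (\<lambda>a. gate_value S C (js ! a) = b)"
  proof (cases "length js \<le> 2")
    case True
    show ?thesis
      using \<open>0 < m\<close> parse(1)
    proof (rule alt_quant_prenex_small)
      show "alt_quant (m ^ (2 ^ n)) q L
          (\<lambda>gs. prenex (encode C) m leaf n b q (gate_arg (encode C) i a) gs p') \<longleftrightarrow>
        gate_value S C (js ! a) = b" if "a < num_args (encode C) i" for a p'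
        using that by (simp add: parse inputs)
    qed (use True js(1) parse(2) in simp_all)
  next
    case False
    show ?thesis
      using \<open>0 < m\<close> parse(1)
    proof (rule alt_quant_prenex_large)
      show "2 \<le> L"
        using path_value_ge[OF wf i, of "\<lambda>G. 2 < length (fan_in G)"] L False fan_in by simp
      show "alt_quant (m ^ (2 ^ n)) (any = b) L'
          (\<lambda>gs. prenex (encode C) m leaf n b (any = b) (gate_arg (encode C) i a) gs p) \<longleftrightarrow>
        gate_value S C (js ! a) = b" if "a < num_args (encode C) i" "L \<le> Suc L'" for a L'
        using that False by (simp add: parse inputs)
    qed (use False js(2) parse(2) in simp_all)
  qed
  then show ?thesis unfolding gate_value_eq_quant[OF wf i G] parse(2) .
qed

lemma alt_quant_prenex_negation:
  assumes "0 < m" "gate_kind x i = 2"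
  shows "alt_quant (m ^ (2 ^ Suc n)) q L (\<lambda>gs. prenex x m leaf (Suc n) b q i gs p) \<longleftrightarrow>
    alt_quant (m ^ (2 ^ n)) q L (\<lambda>gs. prenex x m leaf n (\<not> b) q (gate_arg x i 0) gs p)"
proof -
  have "0 < m ^ (2 ^ n)" using assms(1) by simp
  from alt_quant_div[OF this] show ?thesis
    unfolding power_two_power_Suc prenex_negation[OF assms(2)] .
qed

lemma prenex_correct:
  assumes wf: "wf_circuit C" and m: "length C + 2 \<le> m"
    and "i < length C" "path_value (\<lambda>G. \<not> is_LIT G) C i \<le> n"
      "path_value (\<lambda>G. 2 < length (fan_in G)) C i < L"
  shows "alt_quant (m ^ (2 ^ n)) q L (\<lambda>gs. prenex (encode C) m (\<lambda>b v p. (v \<in> S) = b) n b q i gs p) \<longleftrightarrow>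
    gate_value S C i = b"
  using assms(3-5)
proof (induction n arbitrary: i b q p L)
  case 0
  then obtain c v where G: "C ! i = LIT c v"
    using path_value_ge[OF wf 0(1), of "\<lambda>G. \<not> is_LIT G"] by (cases "C ! i") auto
  then show ?case
    using gate_value_simps(1)[OF wf 0(1) G] gate_parse(1)[OF 0(1) G] m
    by (auto simp: alt_quant_const)
next
  case (Suc n)
  note i = \<open>i < length C\<close>
  have inputs: "alt_quant (m ^ (2 ^ n)) q' L'
      (\<lambda>gs. prenex (encode C) m (\<lambda>b v p. (v \<in> S) = b) n b' q' j gs p') \<longleftrightarrow>
      gate_value S C j = b'"
    if j: "j \<in> set (fan_in (C ! i))" and L': "L \<le> of_bool (2 < length (fan_in (C ! i))) + L'"
      for j b' q' p' L'
  proof (rule Suc.IH)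
    show "j < length C" using fan_in_less[OF wf i j] i by simp
    have "\<not> is_LIT (C ! i)" using j by (cases "C ! i") auto
    then show "path_value (\<lambda>G. \<not> is_LIT G) C j \<le> n"
      using path_value_fan_in[OF wf i j, of "\<lambda>G. \<not> is_LIT G"] Suc.prems(2) by simp
    show "path_value (\<lambda>G. 2 < length (fan_in G)) C j < L'"
      using path_value_fan_in[OF wf i j, of "\<lambda>G. 2 < length (fan_in G)"] Suc.prems(3) L' by linarith
  qed
  show ?case
  proof (cases "C ! i" rule: gate_cases)
    case (LIT c v)
    then show ?thesis
      using gate_value_simps(1)[OF wf i LIT] gate_parse(1)[OF i LIT] m
      by (auto simp: alt_quant_const)
  next
    case (NOT j)
    have kind: "gate_kind (encode C) i = 2" and arg: "gate_arg (encode C) i 0 = j"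
      using gate_parse(2)[OF i NOT] by simp_all
    have "0 < m" using m by simp
    then show ?thesis
      unfolding alt_quant_prenex_negation[OF \<open>0 < m\<close> kind] arg
      using gate_value_simps(2)[OF wf i NOT] inputs[of j L q "\<not> b" p] NOT by auto
  next
    case (connective any js)
    show ?thesis
      using wf m i connective Suc.prems(3)
      by (rule alt_quant_prenex_connective) (simp add: inputs connective)
  qed
qed

lemma prenex_mono:
  assumes "prenex x m leaf n b q i gs p"
    and "\<And>pol j p'. p \<le> p' \<Longrightarrow> p' < p + 2 ^ n \<Longrightarrow> leaf pol (gate_arg x j 0) p' \<Longrightarrow>
        leaf' pol (gate_arg x j 0) p'"
  shows "prenex x m leaf' n b q i gs p"
  using assms
proof (induction n arbitrary: b q i gs p)
  case (Suc n)
  have "prenex x m leaf' n b' q' j hs p" if "prenex x m leaf n b' q' j hs p" for b' q' j hs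
    using that by (rule Suc.IH) (rule Suc.prems(2), simp_all)
  moreover have "prenex x m leaf' n b' q' j hs (p + 2 ^ n)"
    if "prenex x m leaf n b' q' j hs (p + 2 ^ n)" for b' q' j hs
    using that by (rule Suc.IH) (rule Suc.prems(2), simp_all)
  moreover have "leaf pol (gate_arg x j 0) p \<Longrightarrow> leaf' pol (gate_arg x j 0) p" for pol j
    using Suc.prems(2)[of p] by simp
  ultimately show ?case
    using Suc.prems(1) unfolding prenex.simps Let_def connect_def guard_def
    by (auto split: if_splits)
qed simp

text \<open>The leaves have different addresses, so a witness can be chosen for each of them.\<close>

lemma prenex_choose_both:
  fixes k :: nat and leaf :: "nat \<Rightarrow> bool \<Rightarrow> nat \<Rightarrow> bool"
  defines "some \<equiv> \<lambda>pol v p. \<exists>\<sigma>\<le>k. leaf \<sigma> pol v" and "chosen \<equiv> \<lambda>f pol v p. leaf (f p) pol v"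
  assumes "\<exists>f. (\<forall>p. f p \<le> k) \<and> (prenex x m some n b q i gs p \<longrightarrow> prenex x m (chosen f) n b q i gs p)"
    and "\<exists>f. (\<forall>p. f p \<le> k) \<and>
      (prenex x m some n b q i' gs' (p + 2 ^ n) \<longrightarrow> prenex x m (chosen f) n b q i' gs' (p + 2 ^ n))"
  shows "\<exists>f. (\<forall>p. f p \<le> k) \<and> (prenex x m some n b q i gs p \<longrightarrow> prenex x m (chosen f) n b q i gs p) \<and>
    (prenex x m some n b q i' gs' (p + 2 ^ n) \<longrightarrow> prenex x m (chosen f) n b q i' gs' (p + 2 ^ n))"
proof -
  obtain f f' where f: "\<forall>p. f p \<le> k" "prenex x m some n b q i gs p \<longrightarrow>
      prenex x m (chosen f) n b q i gs p"
    and f': "\<forall>p. f' p \<le> k"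
      "prenex x m some n b q i' gs' (p + 2 ^ n) \<longrightarrow> prenex x m (chosen f') n b q i' gs' (p + 2 ^ n)"
    using assms(3,4) by blast
  define h where "h p' = (if p' < p + 2 ^ n then f p' else f' p')" for p'
  have "prenex x m (chosen f) n b q i gs p \<Longrightarrow> prenex x m (chosen h) n b q i gs p"
    "prenex x m (chosen f') n b q i' gs' (p + 2 ^ n) \<Longrightarrow>
        prenex x m (chosen h) n b q i' gs' (p + 2 ^ n)"
    by (erule prenex_mono; simp add: h_def chosen_def)+
  moreover have "\<forall>p. h p \<le> k" using f(1) f'(1) by (simp add: h_def)
  ultimately show ?thesis using f(2) f'(2) by blast
qed

lemma prenex_choose:
  "\<exists>f. (\<forall>p. f p \<le> (k::nat)) \<and> (prenex x m (\<lambda>pol v p. \<exists>\<sigma>\<le>k. leaf \<sigma> pol v) n b q i gs p \<longrightarrow>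
     prenex x m (\<lambda>pol v p. leaf (f p) pol v) n b q i gs p)"
proof (induction n arbitrary: b q i gs p)
  have choose_leaf: "\<exists>f. (\<forall>p. f p \<le> k) \<and> ((\<exists>\<sigma>\<le>k. leaf \<sigma> pol v) \<longrightarrow> leaf (f p) pol v)" for pol v
    and p :: nat
    by (cases "\<exists>\<sigma>\<le>k. leaf \<sigma> pol v") (auto intro: exI[of _ "\<lambda>_. _"] exI[of _ "\<lambda>_. 0"])
  {
    case 0
    show ?case using choose_leaf by simp
  next
    case (Suc n)
    let ?hs = "map (\<lambda>g. g div m ^ (2 ^ n)) gs" and ?hs' = "map (\<lambda>g. g mod m ^ (2 ^ n)) gs"
    consider (literal) "gate_kind x i \<le> 1" | (negation) "gate_kind x i = 2"
      | (small) "2 < gate_kind x i" "num_args x i \<le> 2" | (large) "2 < gate_kind x i"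
        "2 < num_args x i"
      by linarith
    then show ?case
    proof cases
      case literal
      then show ?thesis using choose_leaf by (simp only: prenex_literal)
    next
      case negation
      then show ?thesis using Suc.IH by (simp only: prenex_negation)
    next
      case small
      obtain f where "\<forall>p. f p \<le> k"
        and "prenex x m (\<lambda>pol v p. \<exists>\<sigma>\<le>k. leaf \<sigma> pol v) n b q (gate_arg x i 0) ?hs p \<longrightarrow>
          prenex x m (\<lambda>pol v p. leaf (f p) pol v) n b q (gate_arg x i 0) ?hs p"
        and "prenex x m (\<lambda>pol v p. \<exists>\<sigma>\<le>k. leaf \<sigma> pol v) n b q (gate_arg x i (num_args x i - 1)) ?hs' (p + 2 ^ n) \<longrightarrow>
          prenex x m (\<lambda>pol v p. leaf (f p) pol v) n b q (gate_arg x i (num_args x i - 1)) ?hs' (p + 2 ^ n)"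
        using prenex_choose_both[where i="gate_arg x i 0" and gs="?hs" and gs'="?hs'" and p=p,
            OF Suc.IH Suc.IH]
        by blast
      then show ?thesis
        unfolding prenex_small[OF small] connect_def by (intro exI[of _ f]) (auto split: if_splits)
    next
      case large
      let ?any = "(gate_kind x i = 4) = b"
      let ?gs = "if q = ?any then gs else tl gs"
      show ?thesis
        unfolding prenex_large[OF large] Let_def guard_def
        using Suc.IH[of b ?any "gate_arg x i (hd ?gs div m ^ (2 ^ n))" "map (\<lambda>g. g mod m ^ (2 ^ n)) ?gs" p]
        by (elim ex_forward) (auto split: if_splits)
    qed
  }
qed

lemma feasible_pred_bool_arg:
  assumes "feasible_pred a A" "\<And>c. feasible_pred a (P c)"
  shows "feasible_pred a (\<lambda>I \<rho>. P (A I \<rho>) I \<rho>)"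
proof -
  have "feasible_pred a (\<lambda>I \<rho>. if A I \<rho> then P True I \<rho> else P False I \<rho>)"
    by (intro feasible_pred_if assms)
  then show ?thesis by (rule back_subst[of "feasible_pred a"]) (auto simp: fun_eq_iff)
qed

lemma feasible_pred_connect:
  "feasible_pred a P \<Longrightarrow> feasible_pred a Q \<Longrightarrow> feasible_pred a (\<lambda>I \<rho>. connect any (P I \<rho>) (Q I \<rho>))"
  unfolding connect_def by (intro feasible_pred_if feasible_pred_disj feasible_pred_conj
    feasible_pred_const)

lemma feasible_pred_guard:
  "feasible_pred a P \<Longrightarrow> feasible_pred a Q \<Longrightarrow> feasible_pred a (\<lambda>I \<rho>. guard any (P I \<rho>) (Q I \<rho>))"
  unfolding guard_def by (intro feasible_pred_if feasible_pred_imp feasible_pred_conj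
    feasible_pred_const)

lemma feasible_hd_map: "\<forall>g\<in>set gs. feasible a g \<Longrightarrow> feasible a (\<lambda>I \<rho>. hd (map (\<lambda>g. g I \<rho>) gs))"
  by (cases gs) (simp_all add: feasible_const)

lemma feasible_pred_prenex_literal:
  assumes leaf: "\<And>pol v. feasible a v \<Longrightarrow> feasible_pred a (\<lambda>I \<rho>. leaf I \<rho> pol (v I \<rho>))"
    and i: "feasible a i"
  shows "feasible_pred a
      (\<lambda>I \<rho>. leaf I \<rho> (b = (gate_kind (fst I) (i I \<rho>) = 1)) (gate_arg (fst I) (i I \<rho>) 0))"
  by (rule feasible_pred_bool_arg[OF _ leaf[OF feasible_gate_arg[OF i feasible_const]]])
    (intro feasible_pred_iff feasible_pred_const feasible_pred_eq feasible_gate_kind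
      feasible_const i)

lemma feasible_pred_prenex:
  assumes m: "feasible a (\<lambda>I _. m I)"
    and leaf: "\<And>pol v p. feasible a v \<Longrightarrow> feasible_pred a (\<lambda>I \<rho>. leaf I \<rho> pol (v I \<rho>) p)"
    and "feasible a i" "\<forall>g\<in>set gs. feasible a g"
  shows "feasible_pred a (\<lambda>I \<rho>. prenex (fst I) (m I) (leaf I \<rho>) n b q (i I \<rho>) (map (\<lambda>g. g I \<rho>) gs) p)"
  using assms(3,4)
proof (induction n arbitrary: b q i gs p)
  have kind: "feasible_pred a (\<lambda>I \<rho>. gate_kind (fst I) (i I \<rho>) = c)" if "feasible a i" for i c
    using that by (intro feasible_pred_eq feasible_gate_kind feasible_const)
  {
    case 0
    show ?case unfolding prenex.simps using leaf 0(1) by (rule feasible_pred_prenex_literal)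
  next
    case (Suc n)
    let ?r = "\<lambda>I. m I ^ (2 ^ n)" and ?kind = "\<lambda>I \<rho>. gate_kind (fst I) (i I \<rho>)"
      and ?args = "\<lambda>I \<rho>. num_args (fst I) (i I \<rho>)"
    let ?gs = "\<lambda>I \<rho>. map (\<lambda>g. g I \<rho>) gs"
    have r: "feasible a (\<lambda>I _. ?r I)" using m by (rule feasible_power)
    have arg: "feasible a (\<lambda>I \<rho>. gate_arg (fst I) (i I \<rho>) (v I \<rho>))" if "feasible a v" for v
      using Suc.prems(1) that by (rule feasible_gate_arg)
    have args: "feasible a ?args" using Suc.prems(1) by (rule feasible_num_args)
    have "div": "feasible_pred a
        (\<lambda>I \<rho>. prenex (fst I) (m I) (leaf I \<rho>) n b' q' (j I \<rho>) (map (\<lambda>g. g div ?r I) (?gs I \<rho>)) p')"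
      if "feasible a j" for b' q' j p'
      using Suc.IH[OF that, of "map (\<lambda>g I \<rho>. g I \<rho> div ?r I) gs"] Suc.prems(2) r
      by (simp add: comp_def feasible_div)
    have "mod": "feasible_pred a
        (\<lambda>I \<rho>. prenex (fst I) (m I) (leaf I \<rho>) n b' q' (j I \<rho>) (map (\<lambda>g. g mod ?r I) (map (\<lambda>g. g I \<rho>) hs)) p')"
      if "feasible a j" "\<forall>g\<in>set hs. feasible a g" for b' q' j hs p'
      using Suc.IH[OF that(1), of "map (\<lambda>g I \<rho>. g I \<rho> mod ?r I) hs"] that(2) r
      by (simp add: comp_def feasible_mod)
    have any: "feasible_pred a (\<lambda>I \<rho>. (?kind I \<rho> = 4) = b)"
      by (intro feasible_pred_iff kind Suc.prems feasible_pred_const)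
    have small: "feasible_pred a (\<lambda>I \<rho>. connect any
        (prenex (fst I) (m I) (leaf I \<rho>) n b q (gate_arg (fst I) (i I \<rho>) 0) (map (\<lambda>g. g div ?r I) (?gs I \<rho>)) p)
        (prenex (fst I) (m I) (leaf I \<rho>) n b q (gate_arg (fst I) (i I \<rho>) (?args I \<rho> - 1))
          (map (\<lambda>g. g mod ?r I) (?gs I \<rho>)) (p + 2 ^ n)))"
      for any
      by (intro feasible_pred_connect "div" "mod" arg feasible_diff args feasible_const
        Suc.prems(2))
    have large: "feasible_pred a (\<lambda>I \<rho>. let hs = (if q = any then ?gs I \<rho> else tl (?gs I \<rho>)) in
        guard any (hd hs div ?r I < ?args I \<rho>)
          (prenex (fst I) (m I) (leaf I \<rho>) n b any (gate_arg (fst I) (i I \<rho>) (hd hs div ?r I))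
            (map (\<lambda>g. g mod ?r I) hs) p))" for any
    proof -
      define hs where "hs = (if q = any then gs else tl gs)"
      have hs: "\<forall>g\<in>set hs. feasible a g" using Suc.prems(2) by (cases gs) (auto simp: hs_def)
      have map: "(if q = any then ?gs I \<rho> else tl (?gs I \<rho>)) = map (\<lambda>g. g I \<rho>) hs" for I \<rho>
        by (simp add: hs_def map_tl)
      show ?thesis
        unfolding Let_def map
        by (intro feasible_pred_guard feasible_pred_less "mod" arg feasible_div feasible_hd_map args
          r hs)
    qed
    show ?case
      unfolding prenex.simps Let_def
      by (intro feasible_pred_if feasible_pred_prenex_literal[OF leaf] Suc.prems(1) feasible_pred_le
        feasible_gate_kind kind args "div" arg feasible_const
        feasible_pred_bool_arg[OF any small] feasible_pred_bool_arg[OF any large, unfolded Let_def])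
  }
qed

subsection \<open>Hardness\<close>

definition literal_gap :: "nat \<Rightarrow> nat \<Rightarrow> bool \<Rightarrow> nat \<Rightarrow> bool" where
  "literal_gap u w pol v \<longleftrightarrow> (if pol then u = v + 1 else u < v + 1 \<and> v + 1 < w)"

lemma gaps_literal_gap:
  "gaps k M S U \<Longrightarrow> v + 1 < M - 1 \<Longrightarrow> (v \<in> S) = pol \<longleftrightarrow> (\<exists>i\<le>k. literal_gap (U i) (U (i + 1)) pol v)"
  using gaps_mem[of k M S U v] gaps_not_mem[of k M S U v]
  by (cases pol) (simp_all add: literal_gap_def)

text \<open>
  A circuit of depth at most \<open>h\<close> has at most \<open>2 ^ h\<close> leaves in prenex form. The base \<open>k + 1\<close> digits
  of a certificate's index name a gap for every leaf, and the digits of the certificate are the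
  codes of these gaps.
\<close>

definition formula_base :: "input \<Rightarrow> nat" where
  "formula_base I = num_gates (fst I) + 2"

definition formula_range :: "nat \<Rightarrow> input \<Rightarrow> nat" where
  "formula_range h I = formula_base I ^ (2 ^ h)"

definition gap_codes :: "input \<Rightarrow> nat" where
  "gap_codes I = gap_bound I * gap_bound I"

definition num_gap_choices :: "nat \<Rightarrow> input \<Rightarrow> nat" where
  "num_gap_choices h I = (snd I + 1) ^ (2 ^ h)"

definition leaf_gaps_bound :: "nat \<Rightarrow> input \<Rightarrow> nat" where
  "leaf_gaps_bound h I = gap_codes I + formula_range h I + gap_codes I ^ (2 ^ h)"

definition leaf_gaps_check :: "nat \<Rightarrow> input \<Rightarrow> nat \<Rightarrow> nat \<Rightarrow> nat \<Rightarrow> nat \<Rightarrow> nat \<Rightarrow> bool" where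
  "leaf_gaps_check h I i u w e y \<longleftrightarrow>
     (\<forall>p<2 ^ h. digit (snd I + 1) e p = i \<longrightarrow> digit (gap_codes I) y p = u * gap_bound I + w)"

definition leaf_holds :: "input \<Rightarrow> nat \<Rightarrow> bool \<Rightarrow> nat \<Rightarrow> nat \<Rightarrow> bool" where
  "leaf_holds I y pol v p \<longleftrightarrow>
     literal_gap (digit (gap_codes I) y p div gap_bound I) (digit (gap_codes I) y p mod gap_bound I) pol v"

definition formula :: "nat \<Rightarrow> input \<Rightarrow> (bool \<Rightarrow> nat \<Rightarrow> nat \<Rightarrow> bool) \<Rightarrow> nat list \<Rightarrow> bool" where
  "formula h I leaf gs \<longleftrightarrow> (\<exists>a<formula_range h I.
     prenex (fst I) (formula_base I) leaf h True True (num_gates (fst I) - 1) (gs @ [a]) 0)"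

lemma formula_correct:
  assumes C: "wf_circuit C" "weft C \<le> t" "depth C \<le> h" and t: "2 \<le> t" "even t"
  shows "(\<exists>g<formula_range h (encode C, k). alt_quant (formula_range h (encode C, k)) False (t - 1)
      (\<lambda>gs. formula h (encode C, k) (\<lambda>b v p. (v \<in> S) = b) (g # gs))) \<longleftrightarrow> satisfies S C"
proof -
  let ?R = "formula_range h (encode C, k)"
  define matrix where "matrix gs \<longleftrightarrow>
    prenex (encode C) (formula_base (encode C, k))
      (\<lambda>b v p. (v \<in> S) = b) h True True (length C - 1) gs 0" for gs
  have "C \<noteq> []" using C(1) by (simp add: wf_circuit_def)
  have "alt_quant ?R True (Suc t) matrix \<longleftrightarrow> gate_value S C (length C - 1) = True"
    unfolding formula_range_def matrix_def
  proof (rule prenex_correct[OF C(1)])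
    show "path_value (\<lambda>G. \<not> is_LIT G) C (length C - 1) \<le> h"
      using C(3) by (simp add: depth_def max_on_path_path_value[OF \<open>C \<noteq> []\<close>])
    show "path_value (\<lambda>G. 2 < length (fan_in G)) C (length C - 1) < Suc t"
      using C(2) by (simp add: weft_def max_on_path_path_value[OF \<open>C \<noteq> []\<close>])
  qed (use \<open>C \<noteq> []\<close> in \<open>simp_all add: formula_base_def num_gates_encode\<close>)
  moreover have "alt_quant ?R True (Suc t) matrix \<longleftrightarrow>
      (\<exists>g<?R. alt_quant ?R False (Suc (t - 1)) (\<lambda>gs. matrix (g # gs)))"
    using t(1) by simp
  moreover have "odd (t - 1)" using t by simp
  ultimately show ?thesis
    unfolding alt_quant_snoc formula_def matrix_def using satisfies_gate_value[OF \<open>C \<noteq> []\<close>]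
    by (simp add: num_gates_encode)
qed

lemma gap_code_div_mod:
  assumes "gaps k M S U" "i \<le> k"
  shows "(U i * M + U (i + 1)) div M = U i" "(U i * M + U (i + 1)) mod M = U (i + 1)"
    "U i * M + U (i + 1) < M * M"
  using gaps_less_bound[OF assms(1), of i] gaps_less_bound[OF assms(1), of "i + 1"] assms(2)
    mult_add_less[of "U i" M "U (i + 1)" M] by simp_all

lemma digit_Suc_le: "digit (k + 1) e p \<le> k"
  using mod_less_divisor[of "k + 1"] unfolding digit_def by (simp add: less_Suc_eq_le)

context
  fixes h k :: nat and C :: circuit and S :: "nat set" and U :: "nat \<Rightarrow> nat" and I :: input
  defines "I \<equiv> (encode C, k)"
  assumes gaps: "gaps k (gap_bound I) S U"
begin

lemma ex_valid_leaf_gaps: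
  "\<exists>y. certificates_valid k (num_gap_choices h I) (leaf_gaps_bound h I) (leaf_gaps_check h I) U y"
proof -
  have "\<exists>y<gap_codes I ^ (2 ^ h). \<forall>p<2 ^ h. digit (gap_codes I) y p =
      U (digit (k + 1) e p) * gap_bound I + U (digit (k + 1) e p + 1)" for e
    unfolding gap_codes_def using gap_code_div_mod(3)[OF gaps digit_Suc_le] by (rule ex_digits)
  then obtain y where y: "\<And>e. y e < gap_codes I ^ (2 ^ h)" "\<And>e p. p < 2 ^ h \<Longrightarrow>
      digit (gap_codes I) (y e) p =
      U (digit (k + 1) e p) * gap_bound I + U (digit (k + 1) e p + 1)" by metis
  then show ?thesis
    by (intro exI[of _ y])
      (auto simp: certificates_valid_def leaf_gaps_bound_def leaf_gaps_check_def I_def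
        trans_less_add2)
qed

context
  fixes y :: "nat \<Rightarrow> nat"
  assumes y: "certificates_valid k (num_gap_choices h I) (leaf_gaps_bound h I) (leaf_gaps_check h I) U y"
begin

lemma leaf_holds_iff:
  assumes "e < num_gap_choices h I" "p < 2 ^ h"
  shows "leaf_holds I (y e) pol v p \<longleftrightarrow>
    literal_gap (U (digit (k + 1) e p)) (U (digit (k + 1) e p + 1)) pol v"
proof -
  have "leaf_gaps_check h I (digit (k + 1) e p) (U (digit (k + 1) e p)) (U (digit (k + 1) e p + 1)) e (y e)"
    using y assms(1) digit_Suc_le by (simp only: certificates_valid_def)
  then have "digit (gap_codes I) (y e) p =
      U (digit (k + 1) e p) * gap_bound I + U (digit (k + 1) e p + 1)"
    using assms(2) by (simp add: leaf_gaps_check_def I_def)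
  then show ?thesis using gap_code_div_mod[OF gaps digit_Suc_le] by (simp add: leaf_holds_def)
qed

lemma gate_arg_in_set_iff:
  "(gate_arg (encode C) j 0 \<in> S) = pol \<longleftrightarrow>
      (\<exists>i\<le>k. literal_gap (U i) (U (i + 1)) pol (gate_arg (encode C) j 0))"
  using gaps by (rule gaps_literal_gap)
    (use gate_arg_le_length[of "encode C" j 0] in \<open>simp add: gap_bound_def I_def\<close>)

lemma formula_of_leaf_gaps:
  assumes e: "e < num_gap_choices h I" and "formula h I (leaf_holds I (y e)) gs"
  shows "formula h I (\<lambda>b v p. (v \<in> S) = b) gs"
proof -
  have "(gate_arg (fst I) j 0 \<in> S) = pol"
    if "p < 2 ^ h" "leaf_holds I (y e) pol (gate_arg (fst I) j 0) p" for pol j p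
    using that leaf_holds_iff[OF e] digit_Suc_le gate_arg_in_set_iff unfolding I_def fst_conv
    by blast
  then show ?thesis
    using assms(2) unfolding formula_def by (auto elim!: prenex_mono)
qed

lemma ex_leaf_gaps_of_formula:
  assumes "formula h I (\<lambda>b v p. (v \<in> S) = b) gs"
  shows "\<exists>e<num_gap_choices h I. formula h I (leaf_holds I (y e)) gs"
proof -
  let ?matrix = "\<lambda>leaf a. prenex (fst I) (formula_base I) leaf h True True (num_gates (fst I) - 1) (gs @ [a]) 0"
  obtain a where a: "a < formula_range h I" "?matrix (\<lambda>b v p. (v \<in> S) = b) a"
    using assms unfolding formula_def by blast
  from a(2) have "?matrix (\<lambda>pol v p. \<exists>i\<le>k. literal_gap (U i) (U (i + 1)) pol v) a"
    by (rule prenex_mono) (use gate_arg_in_set_iff I_def in simp)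
  then obtain f where f: "\<forall>p. f p \<le> k"
    "?matrix (\<lambda>pol v p. literal_gap (U (f p)) (U (f p + 1)) pol v) a"
    using prenex_choose[of k _ _ "\<lambda>i. literal_gap (U i) (U (i + 1))"] by blast
  obtain e where e: "e < (k + 1) ^ (2 ^ h)" "\<And>p. p < 2 ^ h \<Longrightarrow> digit (k + 1) e p = f p"
    using ex_digits[of "2 ^ h" f "k + 1"] f(1) by (auto simp: less_Suc_eq_le)
  then have e': "e < num_gap_choices h I" by (simp add: num_gap_choices_def I_def)
  from f(2) have "?matrix (leaf_holds I (y e)) a"
    by (rule prenex_mono) (simp only: leaf_holds_iff[OF e'] e(2) add_0)
  then show ?thesis using a(1) e' unfolding formula_def by blast
qed

end

lemma certified_leaf_gaps_iff:
  assumes C: "wf_circuit C" "weft C \<le> t" "depth C \<le> h" and t: "2 \<le> t" "even t"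
  shows "satisfies S C \<longleftrightarrow> certified k (num_gap_choices h I) (leaf_gaps_bound h I) (formula_range h I) (t - 1)
    (leaf_gaps_check h I) (\<lambda>gs e y. formula h I (leaf_holds I y) gs) U"
proof -
  have "(\<exists>e<num_gap_choices h I. formula h I (leaf_holds I (y e)) gs) \<longleftrightarrow>
      formula h I (\<lambda>b v p. (v \<in> S) = b) gs"
    if "certificates_valid k (num_gap_choices h I) (leaf_gaps_bound h I) (leaf_gaps_check h I) U y"
      for y gs
    using formula_of_leaf_gaps[OF that] ex_leaf_gaps_of_formula[OF that] by blast
  then have "certified k (num_gap_choices h I) (leaf_gaps_bound h I) (formula_range h I) (t - 1)
      (leaf_gaps_check h I) (\<lambda>gs e y. formula h I (leaf_holds I y) gs) U \<longleftrightarrow>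
    (\<exists>g<formula_range h I. alt_quant (formula_range h I) False (t - 1) (\<lambda>gs.
      formula h I (\<lambda>b v p. (v \<in> S) = b) (g # gs)))"
    unfolding certified_def using ex_valid_leaf_gaps by (simp cong: conj_cong)
  then show ?thesis using formula_correct[OF C t] unfolding I_def by simp
qed

end

lemma feasible_formula_base: "feasible a (\<lambda>I _. formula_base I)"
  unfolding formula_base_def by (intro feasible_add feasible_num_gates feasible_const)

lemma feasible_formula_range: "feasible a (\<lambda>I _. formula_range h I)"
  unfolding formula_range_def by (intro feasible_power feasible_formula_base)

lemma feasible_gap_codes: "feasible a (\<lambda>I _. gap_codes I)"
  unfolding gap_codes_def by (intro feasible_mult feasible_gap_bound)

lemma feasible_digit: "feasible a f \<Longrightarrow> feasible a g \<Longrightarrow> feasible a (\<lambda>I \<rho>. digit (f I \<rho>) (g I \<rho>) p)"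
  unfolding digit_def by (intro feasible_intros)

lemma feasible_pred_formula:
  assumes gs: "\<forall>g\<in>set gs. feasible a g"
    and leaf: "\<And>pol v p b. a \<le> b \<Longrightarrow> feasible b v \<Longrightarrow> feasible_pred b (\<lambda>I \<rho>. leaf I \<rho> pol (v I \<rho>) p)"
  shows "feasible_pred a (\<lambda>I \<rho>. formula h I (leaf I \<rho>) (map (\<lambda>g. g I \<rho>) gs))"
  unfolding formula_def
proof (rule feasible_pred_ex[OF feasible_formula_range])
  fix u b assume b: "a \<le> b" "feasible b u"
  have "feasible_pred b (\<lambda>I \<rho>. prenex (fst I) (formula_base I) (leaf I \<rho>) h True True (num_gates (fst I) - 1)
      (map (\<lambda>g. g I \<rho>) (gs @ [u])) 0)"
  proof (rule feasible_pred_prenex[OF feasible_formula_base leaf[OF b(1)]])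
    show "feasible b (\<lambda>I \<rho>. num_gates (fst I) - 1)"
      by (intro feasible_diff feasible_num_gates feasible_const)
    show "\<forall>g\<in>set (gs @ [u]). feasible b g" using gs b feasible_mono by auto
  qed
  then show "feasible_pred b
      (\<lambda>I \<rho>. prenex (fst I) (formula_base I) (leaf I \<rho>) h True True (num_gates (fst I) - 1)
      (map (\<lambda>g. g I \<rho>) gs @ [u I \<rho>]) 0)" by simp
qed

lemma gap_reduction_leaf_gaps:
  assumes "2 \<le> t" "even t" "genus_padding g a0 d"
  shows "gap_reduction t g a0 d (2 ^ h) (num_gap_choices h) (leaf_gaps_bound h) (formula_range h) (leaf_gaps_check h)
    (\<lambda>I gs e y. formula h I (leaf_holds I y) gs)"
proof
  show "feasible 0 (\<lambda>I _. num_gap_choices h I)"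
    unfolding num_gap_choices_def by (intro feasible_intros)
  show "feasible 0 (\<lambda>I _. leaf_gaps_bound h I)"
    unfolding leaf_gaps_bound_def
    by (intro feasible_intros feasible_gap_codes feasible_formula_range)
  show "feasible 0 (\<lambda>I _. formula_range h I)" by (rule feasible_formula_range)
  show "feasible_pred b (\<lambda>I \<rho>. leaf_gaps_check h I (i I \<rho>) (u I \<rho>) (w I \<rho>) (e I \<rho>) (y I \<rho>))"
    if "feasible b i" "feasible b u" "feasible b w" "feasible b e" "feasible b y" for i u w e y b
    unfolding leaf_gaps_check_def using that
    by (intro feasible_pred_all_const feasible_intros feasible_digit feasible_gap_codes
      feasible_gap_bound)
  show "feasible_pred b (\<lambda>I \<rho>. formula h I (leaf_holds I (y I \<rho>)) (map (\<lambda>g. g I \<rho>) gs))"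
    if gs: "\<forall>g\<in>set gs. feasible b g" and y: "feasible b y" for gs and e y :: "nat input_fun" and b
  proof (rule feasible_pred_formula[OF gs])
    show "feasible_pred c (\<lambda>I \<rho>. leaf_holds I (y I \<rho>) pol (v I \<rho>) p)" if "b \<le> c" "feasible c v"
      for pol v p c
      unfolding leaf_holds_def literal_gap_def using that(2) feasible_mono[OF y that(1)]
      by (intro feasible_pred_if feasible_intros feasible_digit feasible_gap_codes
        feasible_gap_bound)
  qed
  show "num_gap_choices h (x, k) \<le> 2 ^ (2 ^ h * (k + 1))" for x k
  proof -
    have "k + 1 \<le> 2 ^ (k + 1)" by (induction k) auto
    then have "(k + 1) ^ (2 ^ h) \<le> (2 ^ (k + 1)) ^ (2 ^ h)" by (rule power_mono) simp
    then show ?thesis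
      by (simp only: num_gap_choices_def snd_conv power_mult[symmetric] mult.commute[of "2 ^ h"])
  qed
qed (simp_all add: assms leaf_gaps_bound_def gap_codes_def formula_range_def formula_base_def)

theorem WSAT_mono_hard:
  assumes t: "2 \<le> t" "even t" and g: "genus_padding g a0 d" and P: "P \<in> W t"
  shows "fpt_reducible P (WSAT_mono t g)"
proof -
  interpret gap_reduction t g a0 d "2 ^ h" "num_gap_choices h" "leaf_gaps_bound h" "formula_range h"
    "leaf_gaps_check h"
    "\<lambda>I gs e y. formula h I (leaf_holds I y) gs" for h
    using t g by (rule gap_reduction_leaf_gaps)
  obtain h where "fpt_reducible P (weighted_sat (\<lambda>C. wf_circuit C \<and> weft C \<le> t \<and> depth C \<le> h))"
    using P by (auto simp: W_def)
  then show ?thesis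
    by (rule reduction) (elim conjE, rule certified_leaf_gaps_iff[OF _ _ _ _ t])
qed

subsection \<open>Odd depth\<close>

text \<open>Follows the path of inputs \<open>gs\<close> from vertex \<open>i\<close>, which is a disjunction iff \<open>b\<close>, but stays at literals.\<close>

primrec walk :: "bool list \<Rightarrow> (nat \<Rightarrow> bool) \<Rightarrow> nat list \<Rightarrow> bool \<Rightarrow> nat \<Rightarrow> bool" where
  "walk x P [] b i = P i"
| "walk x P (g # gs) b i =
    (if gate_kind x i \<le> 1 then walk x P gs (\<not> b) i
     else guard b (g < num_args x i) (walk x P gs (\<not> b) (gate_arg x i g)))"

lemma walk_mono: "walk x P gs b i \<Longrightarrow> (\<And>j. P j \<Longrightarrow> P' j) \<Longrightarrow> walk x P' gs b i"
  by (induction gs arbitrary: b i) (auto simp: guard_def split: if_splits)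

lemma walk_ex: "0 < E \<Longrightarrow> walk x (\<lambda>j. \<exists>e<E. P e j) gs b i \<longleftrightarrow> (\<exists>e<E. walk x (P e) gs b i)" for E :: nat
  by (induction gs arbitrary: b i) (auto simp: guard_def)

definition conjunction_gate :: "circuit \<Rightarrow> nat \<Rightarrow> bool" where
  "conjunction_gate C j \<longleftrightarrow>
     is_LIT (C ! j) \<or> (is_AND (C ! j) \<and> (\<forall>c\<in>set (fan_in (C ! j)). is_LIT (C ! c)))"

lemma Pi_circuit_cases:
  assumes "Pi_circuit t C" "i < length C"
  obtains (LIT) "is_LIT (C ! i)" | (connective) any js where "C ! i = connective any js"
proof -
  have "\<not> is_NOT (C ! i)" using assms by (simp add: Pi_circuit_def)
  then show ?thesis using that by (cases "C ! i" rule: gate_cases) auto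
qed

lemma Pi_circuit_depth_1:
  assumes "Pi_circuit t C" "i < length C" "path_value (\<lambda>G. \<not> is_LIT G) C i \<le> 1" "\<not> is_OR (C ! i)"
  shows "conjunction_gate C i"
  using assms(1,2)
proof (cases rule: Pi_circuit_cases)
  case (connective any js)
  have wf: "wf_circuit C" using assms(1) by (simp add: Pi_circuit_def)
  have "is_LIT (C ! c)" if c: "c \<in> set (fan_in (C ! i))" for c
  proof -
    have "c < length C" using fan_in_less[OF wf assms(2) c] assms(2) by simp
    then show ?thesis
      using path_value_fan_in[OF wf assms(2) c, of "\<lambda>G. \<not> is_LIT G"]
        path_value_ge[OF wf, of c "\<lambda>G. \<not> is_LIT G"]
        assms(3) connective by (cases "is_LIT (C ! c)") auto
  qed
  then show ?thesis using connective assms(4) by (auto simp: conjunction_gate_def)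
qed (simp add: conjunction_gate_def)

lemma walk_connective:
  assumes wf: "wf_circuit C" and R: "length C < R" and i: "i < length C"
    and G: "C ! i = connective any js"
    and inputs: "\<And>j. j \<in> set js \<Longrightarrow> alt_quant R (\<not> any) n (\<lambda>gs. walk (encode C) P gs (\<not> any) j) \<longleftrightarrow>
        gate_value S C j"
  shows "alt_quant R any (Suc n) (\<lambda>gs. walk (encode C) P gs any i) \<longleftrightarrow> gate_value S C i"
proof -
  have "0 < R" "length js \<le> R" using length_fan_in_le[OF wf i] G R by simp_all
  have "\<not> gate_kind (encode C) i \<le> 1" using gate_kind_le_1_iff[OF i] G by simp
  then have "alt_quant R any (Suc n) (\<lambda>gs. walk (encode C) P gs any i) \<longleftrightarrow>
      quant any R (\<lambda>g. guard any (g < length js)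
        (alt_quant R (\<not> any) n (\<lambda>gs. walk (encode C) P gs (\<not> any) (gate_arg (encode C) i g))))"
    by (simp add: alt_quant_guard[OF \<open>0 < R\<close>] gate_parse_connective(2)[OF i G])
  also have "\<dots> \<longleftrightarrow> quant any (length js)
      (\<lambda>g. alt_quant R (\<not> any) n (\<lambda>gs. walk (encode C) P gs (\<not> any) (gate_arg (encode C) i g)))"
    using \<open>length js \<le> R\<close> by (rule quant_guard)
  also have "\<dots> \<longleftrightarrow> quant any (length js) (\<lambda>a. gate_value S C (js ! a))"
    by (intro quant_cong) (simp add: gate_parse_connective(3)[OF i G] inputs)
  finally show ?thesis unfolding gate_value_quant[OF wf i G] .
qed

lemma walk_correct:
  assumes Pi: "Pi_circuit t C" and R: "length C < R"
    and P: "\<And>j. j < length C \<Longrightarrow> conjunction_gate C j \<Longrightarrow> P j = gate_value S C j"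
    and "i < length C" "path_value (\<lambda>G. \<not> is_LIT G) C i \<le> n + 1"
      "is_LIT (C ! i) \<or> is_OR (C ! i) = odd n"
  shows "alt_quant R (odd n) n (\<lambda>gs. walk (encode C) P gs (odd n) i) \<longleftrightarrow> gate_value S C i"
  using assms(4-6)
proof (induction n arbitrary: i)
  have wf: "wf_circuit C" using Pi by (simp add: Pi_circuit_def)
  {
    case 0
    then have "\<not> is_OR (C ! i)" by (cases "C ! i") auto
    then have "conjunction_gate C i" using Pi_circuit_depth_1[OF Pi 0(1)] 0(2) by simp
    then show ?case using P 0(1) by simp
  next
    case (Suc n)
    note i = \<open>i < length C\<close>
    from Pi i show ?case
    proof (cases rule: Pi_circuit_cases)
      case LIT
      then have "alt_quant R (odd n) n (\<lambda>gs. walk (encode C) P gs (odd n) i) \<longleftrightarrow> gate_value S C i"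
        using Suc.IH[of i] i path_value_LIT[OF wf i] by simp
      moreover have "gate_kind (encode C) i \<le> 1" using gate_kind_le_1_iff[OF i] LIT by simp
      ultimately show ?thesis using R by (simp add: quant_const)
    next
      case (connective any js)
      then have any: "any = odd (Suc n)" using Suc.prems(3) by simp
      have "alt_quant R (\<not> any) n (\<lambda>gs. walk (encode C) P gs (\<not> any) j) \<longleftrightarrow> gate_value S C j"
        if "j \<in> set js" for j
      proof -
        have j: "j \<in> set (fan_in (C ! i))" using that connective by simp
        then have "j < length C" using fan_in_less[OF wf i] i by fastforce
        moreover have "path_value (\<lambda>G. \<not> is_LIT G) C j \<le> n + 1"
          using path_value_fan_in[OF wf i j, of "\<lambda>G. \<not> is_LIT G"] Suc.prems(2) connective by simp
        moreover have "\<not> (is_AND (C ! i) \<and> is_AND (C ! j)) \<and> \<not> (is_OR (C ! i) \<and> is_OR (C ! j))"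
          using Pi i j unfolding Pi_circuit_def by blast
        with Pi \<open>j < length C\<close> have "is_LIT (C ! j) \<or> is_OR (C ! j) = odd n"
          by (cases rule: Pi_circuit_cases) (auto simp: connective any)
        ultimately show ?thesis using Suc.IH any by simp
      qed
      then show ?thesis unfolding any[symmetric] by (rule walk_connective[OF wf R i connective])
    qed
  }
qed

definition occurs :: "bool list \<Rightarrow> nat \<Rightarrow> nat \<Rightarrow> bool" where
  "occurs x i v \<longleftrightarrow> (gate_kind x i \<le> 1 \<and> gate_arg x i 0 = v) \<or>
     (gate_kind x i = 3 \<and> (\<exists>p<num_args x i. gate_arg x (gate_arg x i p) 0 = v))"

lemma occurs_le_length: "occurs x i v \<Longrightarrow> v \<le> length x"
  unfolding occurs_def using gate_arg_le_length by blast

lemma gate_value_literal: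
  assumes "wf_circuit C" "monotone_circuit C" "i < length C" "is_LIT (C ! i)"
  shows "gate_value S C i \<longleftrightarrow> gate_arg (encode C) i 0 \<in> S"
proof -
  obtain b v where G: "C ! i = LIT b v" using assms(4) by (cases "C ! i") auto
  have b using assms(2) nth_mem[OF assms(3)] G by (auto simp: monotone_circuit_def)
  then show ?thesis using gate_value_simps(1)[OF assms(1,3) G, of S] gate_parse(1)[OF assms(3) G]
    by simp
qed

lemma gate_value_occurs:
  assumes wf: "wf_circuit C" and mono: "monotone_circuit C"
    and j: "j < length C" "conjunction_gate C j"
  shows "gate_value S C j \<longleftrightarrow> Collect (occurs (encode C) j) \<subseteq> S"
proof (cases "is_LIT (C ! j)")
  case True
  then have "gate_kind (encode C) j \<le> 1" using gate_kind_le_1_iff[OF j(1)] by simp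
  then have "Collect (occurs (encode C) j) = {gate_arg (encode C) j 0}" unfolding occurs_def
    by fastforce
  then show ?thesis unfolding gate_value_literal[OF wf mono j(1) True] by simp
next
  case False
  then obtain js where G: "C ! j = AND js" using j(2)
    by (cases "C ! j") (auto simp: conjunction_gate_def)
  have "c < length C" "is_LIT (C ! c)" if "c \<in> set js" for c
    using fan_in_less[OF wf j(1), of c] j that by (auto simp: G conjunction_gate_def)
  then have "gate_value S C j \<longleftrightarrow> (\<forall>c\<in>set js. gate_arg (encode C) c 0 \<in> S)"
    using gate_value_simps(3)[OF wf j(1) G, of S] gate_value_literal[OF wf mono] by simp
  moreover have "Collect (occurs (encode C) j) = (\<lambda>c. gate_arg (encode C) c 0) ` set js"
    using gate_parse(3)[OF j(1) G] unfolding occurs_def set_conv_nth by auto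
  ultimately show ?thesis by auto
qed

text \<open>
  A conjunction of positive literals is true iff its variables form one of the \<open>2 ^ k\<close> subsets of
  \<open>S\<close>. Every certificate names a conjunction with variables in \<open>S\<close>, or no conjunction.
\<close>

definition num_subsets :: "input \<Rightarrow> nat" where
  "num_subsets I = 2 ^ snd I"

definition gate_range :: "input \<Rightarrow> nat" where
  "gate_range I = num_gates (fst I) + 1"

definition gate_bound :: "input \<Rightarrow> nat" where
  "gate_bound I = gap_bound I * gap_bound I + gate_range I"

definition avoids_gap :: "input \<Rightarrow> nat \<Rightarrow> nat \<Rightarrow> nat \<Rightarrow> nat \<Rightarrow> nat \<Rightarrow> bool" where
  "avoids_gap I i u w e y \<longleftrightarrow> (y < num_gates (fst I) \<longrightarrow>
     \<not> (\<exists>v<length (fst I) + 1. u < v + 1 \<and> v + 1 < w \<and> occurs (fst I) y v))"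

definition same_variables :: "input \<Rightarrow> nat \<Rightarrow> nat \<Rightarrow> bool" where
  "same_variables I y j \<longleftrightarrow> y < num_gates (fst I) \<and>
     (\<forall>v<length (fst I) + 1. occurs (fst I) j v = occurs (fst I) y v)"

definition walk_formula :: "input \<Rightarrow> (nat \<Rightarrow> bool) \<Rightarrow> nat list \<Rightarrow> bool" where
  "walk_formula I P gs \<longleftrightarrow> (\<exists>a<gate_range I. walk (fst I) P (gs @ [a]) False (num_gates (fst I) - 1))"

lemma same_variables_iff:
  "same_variables (encode C, k) y j \<longleftrightarrow>
     y < length C \<and> Collect (occurs (encode C) j) = Collect (occurs (encode C) y)"
  unfolding same_variables_def using occurs_le_length[of "encode C"]
  by (auto simp: num_gates_encode less_Suc_eq_le)

lemma walk_formula_mono: "walk_formula I P gs \<Longrightarrow> (\<And>j. P j \<Longrightarrow> P' j) \<Longrightarrow> walk_formula I P' gs"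
  unfolding walk_formula_def using walk_mono by blast

lemma walk_formula_ex:
  "0 < E \<Longrightarrow> walk_formula I (\<lambda>j. \<exists>e<E. P e j) gs \<longleftrightarrow> (\<exists>e<E. walk_formula I (P e) gs)" for E :: nat
  by (auto simp: walk_formula_def walk_ex)

lemma walk_formula_correct:
  assumes Pi: "Pi_circuit t C" and t: "3 \<le> t" "odd t"
    and P: "\<And>j. j < length C \<Longrightarrow> conjunction_gate C j \<Longrightarrow> P j = gate_value S C j"
  shows "alt_quant (gate_range (encode C, k)) False (t - 1 - 1) (walk_formula (encode C, k) P) \<longleftrightarrow>
      satisfies S C"
proof -
  let ?R = "gate_range (encode C, k)"
  have "C \<noteq> []" using Pi by (simp add: Pi_circuit_def wf_circuit_def)
  have "is_AND (last C)" using Pi by (simp add: Pi_circuit_def)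
  then have "\<not> is_OR (C ! (length C - 1))" using \<open>C \<noteq> []\<close>
    by (cases "last C") (simp_all add: last_conv_nth)
  have "alt_quant ?R (odd (t - 1)) (t - 1)
      (\<lambda>gs. walk (encode C) P gs (odd (t - 1)) (length C - 1)) \<longleftrightarrow>
      gate_value S C (length C - 1)"
  proof (rule walk_correct[OF Pi _ P])
    have "depth C \<le> t" using Pi by (simp add: Pi_circuit_def)
    then show "path_value (\<lambda>G. \<not> is_LIT G) C (length C - 1) \<le> t - 1 + 1"
      using t by (simp add: depth_def max_on_path_path_value[OF \<open>C \<noteq> []\<close>])
  qed (use \<open>C \<noteq> []\<close> \<open>\<not> is_OR _\<close> t in \<open>simp_all add: gate_range_def num_gates_encode\<close>)
  moreover have "odd (t - 1) = False" "t - 1 = Suc (t - 1 - 1)" "even (t - 1 - 1) = False" using t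
    by auto
  ultimately have "alt_quant ?R False (Suc (t - 1 - 1))
      (\<lambda>gs. walk (encode C) P gs False (length C - 1)) \<longleftrightarrow>
      gate_value S C (length C - 1)" by metis
  then show ?thesis
    unfolding alt_quant_snoc \<open>even (t - 1 - 1) = False\<close> satisfies_gate_value[OF \<open>C \<noteq> []\<close>]
    by (simp add: walk_formula_def[abs_def] num_gates_encode)
qed

context
  fixes k :: nat and C :: circuit and S :: "nat set" and U :: "nat \<Rightarrow> nat" and I :: input
  defines "I \<equiv> (encode C, k)"
  assumes gaps: "gaps k (gap_bound I) S U"
begin

lemma avoids_gaps_iff:
  assumes "y < length C"
  shows "(\<forall>i\<le>k. avoids_gap I i (U i) (U (i + 1)) e y) \<longleftrightarrow> Collect (occurs (encode C) y) \<subseteq> S"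
proof -
  have "(\<forall>i\<le>k. avoids_gap I i (U i) (U (i + 1)) e y) \<longleftrightarrow>
      (\<forall>v. occurs (encode C) y v \<longrightarrow> \<not> (\<exists>i\<le>k. U i < v + 1 \<and> v + 1 < U (i + 1)))"
    using assms occurs_le_length[of "encode C" y]
    by (auto simp: avoids_gap_def I_def num_gates_encode less_Suc_eq_le)
  moreover have "\<not> (\<exists>i\<le>k. U i < v + 1 \<and> v + 1 < U (i + 1)) \<longleftrightarrow> v \<in> S" if "occurs (encode C) y v" for v
  proof -
    have "v + 1 < gap_bound I - 1" using occurs_le_length[OF that]
      by (simp add: gap_bound_def I_def)
    from gaps_not_mem[OF gaps this] show ?thesis by blast
  qed
  ultimately show ?thesis by blast
qed

lemma ex_valid_gates:
  "\<exists>y. certificates_valid k (num_subsets I) (gate_bound I) (avoids_gap I) U y \<and>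
      (\<forall>j<length C. Collect (occurs (encode C) j) \<subseteq> S \<longrightarrow>
        (\<exists>e<num_subsets I. same_variables I (y e) j))"
proof -
  have "finite S" using gaps by (simp add: gaps_def)
  then have "card (Pow S) = num_subsets I" using gaps_card[OF gaps]
    by (simp add: num_subsets_def I_def card_Pow)
  then obtain f where "bij_betw f {0..<num_subsets I} (Pow S)"
    using ex_bij_betw_nat_finite[of "Pow S"] \<open>finite S\<close> by auto
  then have f: "f ` {0..<num_subsets I} = Pow S" by (simp add: bij_betw_def)
  have "\<exists>y\<le>length C. (y < length C \<longrightarrow> Collect (occurs (encode C) y) = f e) \<and>
      ((\<exists>j<length C. Collect (occurs (encode C) j) = f e) \<longrightarrow> y < length C)" for e
  proof (cases "\<exists>j<length C. Collect (occurs (encode C) j) = f e")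
    case True
    then show ?thesis using less_imp_le by blast
  next
    case False
    then show ?thesis by (intro exI[of _ "length C"]) simp
  qed
  then obtain y where y: "\<And>e. y e \<le> length C" "\<And>e. y e < length C \<Longrightarrow>
      Collect (occurs (encode C) (y e)) = f e"
    "\<And>e j. j < length C \<Longrightarrow> Collect (occurs (encode C) j) = f e \<Longrightarrow> y e < length C" by metis
  have "avoids_gap I i (U i) (U (i + 1)) e (y e)" if "e < num_subsets I" "i \<le> k" for e i
  proof (cases "y e < length C")
    case True
    have "f e \<subseteq> S" using f that(1) by auto
    then show ?thesis using y(2)[OF True] avoids_gaps_iff[OF True] that(2) by blast
  qed (simp add: avoids_gap_def I_def num_gates_encode)
  then have "certificates_valid k (num_subsets I) (gate_bound I) (avoids_gap I) U y"
    using y(1) by (auto simp: certificates_valid_def gate_bound_def gate_range_def I_def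
      num_gates_encode less_Suc_eq_le trans_le_add2)
  moreover have "\<exists>e<num_subsets I. same_variables I (y e) j"
    if j: "j < length C" "Collect (occurs (encode C) j) \<subseteq> S" for j
  proof -
    have "Collect (occurs (encode C) j) \<in> f ` {0..<num_subsets I}" using j(2) unfolding f by blast
    then obtain e where e: "e < num_subsets I" "Collect (occurs (encode C) j) = f e" by auto
    then have "same_variables I (y e) j" using y(2,3) j(1) unfolding I_def same_variables_iff
      by simp
    then show ?thesis using e(1) by blast
  qed
  ultimately show ?thesis by blast
qed

lemma gate_value_of_valid_gates:
  assumes C: "wf_circuit C" "monotone_circuit C"
    and y: "certificates_valid k (num_subsets I) (gate_bound I) (avoids_gap I) U y"
    and j: "j < length C" "conjunction_gate C j"
      and e: "e < num_subsets I" "same_variables I (y e) j"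
  shows "gate_value S C j"
proof -
  have same: "y e < length C" "Collect (occurs (encode C) j) = Collect (occurs (encode C) (y e))"
    using e(2) unfolding I_def same_variables_iff by blast+
  have "\<forall>i\<le>k. avoids_gap I i (U i) (U (i + 1)) e (y e)"
    using y e(1) by (simp add: certificates_valid_def I_def)
  then show ?thesis
    unfolding gate_value_occurs[OF C j] same(2) avoids_gaps_iff[OF same(1)] .
qed

lemma certified_walk_iff:
  assumes C: "Pi_circuit t C" "monotone_circuit C" and t: "3 \<le> t" "odd t"
  shows "satisfies S C \<longleftrightarrow> certified k (num_subsets I) (gate_bound I) (gate_range I) (t - 1 - 1) (avoids_gap I)
    (\<lambda>gs e y. walk_formula I (same_variables I y) (tl gs)) U" (is "_ \<longleftrightarrow> ?certified")
proof
  have wf: "wf_circuit C" using C(1) by (simp add: Pi_circuit_def)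
  have E: "0 < num_subsets I" by (simp add: num_subsets_def)
  let ?P = "\<lambda>y j. \<exists>e<num_subsets I. same_variables I (y e) j"
  {
    assume "satisfies S C"
    obtain y where y: "certificates_valid k (num_subsets I) (gate_bound I) (avoids_gap I) U y"
      "\<And>j. j < length C \<Longrightarrow> Collect (occurs (encode C) j) \<subseteq> S \<Longrightarrow> ?P y j"
      using ex_valid_gates by blast
    have "?P y j = gate_value S C j" if "j < length C" "conjunction_gate C j" for j
      using y(2) gate_value_of_valid_gates[OF wf C(2) y(1) that] gate_value_occurs[OF wf C(2) that]
        that by blast
    from walk_formula_correct[OF C(1) t this]
    have "alt_quant (gate_range I) False (t - 1 - 1) (walk_formula I (?P y))"
      using \<open>satisfies S C\<close> unfolding I_def by blast
    moreover have "0 < gate_range I" by (simp add: gate_range_def)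
    ultimately show ?certified
      using y(1) unfolding certified_def list.sel(3) walk_formula_ex[OF E, symmetric] by blast
  next
    assume ?certified
    then obtain y where y: "certificates_valid k (num_subsets I) (gate_bound I) (avoids_gap I) U y"
      and walk: "alt_quant (gate_range I) False (t - 1 - 1) (walk_formula I (?P y))"
      unfolding certified_def list.sel(3) walk_formula_ex[OF E, symmetric] by blast
    let ?P' = "\<lambda>j. ?P y j \<or> gate_value S C j"
    have "?P' j = gate_value S C j" if "j < length C" "conjunction_gate C j" for j
      using gate_value_of_valid_gates[OF wf C(2) y that] by blast
    from walk_formula_correct[OF C(1) t this]
    have "alt_quant (gate_range I) False (t - 1 - 1) (walk_formula I ?P') \<longleftrightarrow> satisfies S C"
      unfolding I_def .
    moreover have "alt_quant (gate_range I) False (t - 1 - 1) (walk_formula I ?P')"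
      using walk by (rule alt_quant_mono) (erule walk_formula_mono, blast)
    ultimately show "satisfies S C" by blast
  }
qed

end

lemma feasible_pred_walk:
  assumes P: "\<And>v. feasible a v \<Longrightarrow> feasible_pred a (\<lambda>I \<rho>. P I \<rho> (v I \<rho>))"
    and "feasible a i" "\<forall>g\<in>set gs. feasible a g"
  shows "feasible_pred a (\<lambda>I \<rho>. walk (fst I) (P I \<rho>) (map (\<lambda>g. g I \<rho>) gs) b (i I \<rho>))"
  using assms(2,3)
proof (induction gs arbitrary: b i)
  case (Cons g gs)
  have walk: "feasible_pred a (\<lambda>I \<rho>. walk (fst I) (P I \<rho>) (map (\<lambda>g. g I \<rho>) gs) (\<not> b) (j I \<rho>))"
    if "feasible a j" for j
    using that Cons.prems(2) by (intro Cons.IH) auto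
  have "feasible a g" using Cons.prems(2) by simp
  then show ?case
    using Cons.prems(1) unfolding list.map walk.simps
    by (intro feasible_pred_if feasible_pred_guard feasible_pred_le feasible_pred_less walk
      feasible_gate_kind feasible_num_args feasible_gate_arg feasible_const)
qed (simp add: P)

lemma feasible_pred_occurs:
  assumes v: "feasible a v" and w: "feasible a w"
  shows "feasible_pred a (\<lambda>I \<rho>. occurs (fst I) (v I \<rho>) (w I \<rho>))"
proof -
  have "feasible_pred b (\<lambda>I \<rho>. gate_arg (fst I) (gate_arg (fst I) (v I \<rho>) (u I \<rho>)) 0 = w I \<rho>)"
    if "a \<le> b" "feasible b u" for u b
    using that(2) feasible_mono[OF v that(1)] feasible_mono[OF w that(1)]
    by (intro feasible_pred_eq feasible_gate_arg feasible_const)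
  from feasible_pred_ex[OF feasible_num_args[OF v] this] show ?thesis
    unfolding occurs_def using v w
    by (intro feasible_pred_disj feasible_pred_conj feasible_pred_le feasible_pred_eq
      feasible_gate_kind feasible_gate_arg feasible_const)
qed

lemma feasible_pred_avoids_gap:
  assumes u: "feasible a u" and w: "feasible a w" and y: "feasible a y"
  shows "feasible_pred a (\<lambda>I \<rho>. avoids_gap I (i I \<rho>) (u I \<rho>) (w I \<rho>) (e I \<rho>) (y I \<rho>))"
proof -
  have "feasible_pred a (\<lambda>I \<rho>. \<exists>v<length (fst I) + 1. u I \<rho> < v + 1 \<and> v + 1 < w I \<rho> \<and>
      occurs (fst I) (y I \<rho>) v)"
  proof (rule feasible_pred_ex)
    show "feasible_pred b (\<lambda>I \<rho>. u I \<rho> < v I \<rho> + 1 \<and> v I \<rho> + 1 < w I \<rho> \<and>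
        occurs (fst I) (y I \<rho>) (v I \<rho>))"
      if "a \<le> b" "feasible b v" for v b
      using that(2) assms[THEN feasible_mono, OF that(1)]
      by (intro feasible_pred_conj feasible_pred_less feasible_add feasible_const
        feasible_pred_occurs)
  qed (intro feasible_add feasible_length feasible_const)
  then show ?thesis
    unfolding avoids_gap_def using y
    by (intro feasible_pred_imp feasible_pred_not feasible_pred_less feasible_num_gates)
qed

lemma feasible_pred_same_variables:
  assumes y: "feasible a y" and j: "feasible a j"
  shows "feasible_pred a (\<lambda>I \<rho>. same_variables I (y I \<rho>) (j I \<rho>))"
proof -
  have "feasible_pred a (\<lambda>I \<rho>. \<forall>v<length (fst I) + 1. occurs (fst I) (j I \<rho>) v =
      occurs (fst I) (y I \<rho>) v)"
  proof (rule feasible_pred_all)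
    show "feasible_pred b (\<lambda>I \<rho>. occurs (fst I) (j I \<rho>) (v I \<rho>) = occurs (fst I) (y I \<rho>) (v I \<rho>))"
      if "a \<le> b" "feasible b v" for v b
      using that(2) assms[THEN feasible_mono, OF that(1)]
      by (intro feasible_pred_iff feasible_pred_occurs)
  qed (intro feasible_add feasible_length feasible_const)
  then show ?thesis
    unfolding same_variables_def using y
    by (intro feasible_pred_conj feasible_pred_less feasible_num_gates)
qed

lemma feasible_gate_range: "feasible a (\<lambda>I _. gate_range I)"
  unfolding gate_range_def by (intro feasible_add feasible_num_gates feasible_const)

lemma feasible_pred_walk_formula:
  assumes gs: "\<forall>g\<in>set gs. feasible a g"
    and P: "\<And>v b. a \<le> b \<Longrightarrow> feasible b v \<Longrightarrow> feasible_pred b (\<lambda>I \<rho>. P I \<rho> (v I \<rho>))"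
  shows "feasible_pred a (\<lambda>I \<rho>. walk_formula I (P I \<rho>) (map (\<lambda>g. g I \<rho>) gs))"
  unfolding walk_formula_def
proof (rule feasible_pred_ex[OF feasible_gate_range])
  fix u b assume b: "a \<le> b" "feasible b u"
  have "feasible_pred b (\<lambda>I \<rho>. walk (fst I) (P I \<rho>) (map (\<lambda>g. g I \<rho>) (gs @ [u])) False (num_gates (fst I) - 1))"
  proof (rule feasible_pred_walk[OF P[OF b(1)]])
    show "feasible b (\<lambda>I \<rho>. num_gates (fst I) - 1)"
      by (intro feasible_diff feasible_num_gates feasible_const)
    show "\<forall>g\<in>set (gs @ [u]). feasible b g" using gs b feasible_mono by auto
  qed
  then show "feasible_pred b
      (\<lambda>I \<rho>. walk (fst I) (P I \<rho>) (map (\<lambda>g. g I \<rho>) gs @ [u I \<rho>]) False (num_gates (fst I) - 1))"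
    by simp
qed

lemma gap_reduction_walk:
  assumes "2 \<le> t" "even t" "genus_padding g a0 d"
  shows "gap_reduction t g a0 d 1 num_subsets gate_bound gate_range avoids_gap
    (\<lambda>I gs e y. walk_formula I (same_variables I y) (tl gs))"
proof
  show "feasible 0 (\<lambda>I _. num_subsets I)" unfolding num_subsets_def by (rule feasible_two_power)
  show "feasible 0 (\<lambda>I _. gate_range I)" by (rule feasible_gate_range)
  then show "feasible 0 (\<lambda>I _. gate_bound I)"
    unfolding gate_bound_def by (intro feasible_add feasible_mult feasible_gap_bound)
  show "feasible_pred b (\<lambda>I \<rho>. walk_formula I (same_variables I (y I \<rho>)) (tl (map (\<lambda>g. g I \<rho>) gs)))"
    if gs: "\<forall>g\<in>set gs. feasible b g" and y: "feasible b y" for gs and e y :: "nat input_fun" and b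
  proof -
    have "\<forall>g\<in>set (tl gs). feasible b g" using gs by (cases gs) auto
    then have "feasible_pred b
        (\<lambda>I \<rho>. walk_formula I (same_variables I (y I \<rho>)) (map (\<lambda>g. g I \<rho>) (tl gs)))"
      by (rule feasible_pred_walk_formula)
        (rule feasible_pred_same_variables[OF feasible_mono[OF y]])
    then show ?thesis by (simp add: map_tl)
  qed
qed (simp_all add: assms feasible_pred_avoids_gap num_subsets_def gate_bound_def gate_range_def)

theorem WSAT_mono_odd_reduction:
  assumes t: "3 \<le> t" "odd t" and g: "genus_padding g a0 d"
  shows "fpt_reducible (WSAT_mono t g) (WSAT_mono (t - 1) g)"
proof -
  interpret gap_reduction "t - 1" g a0 d 1 num_subsets gate_bound gate_range avoids_gap
    "\<lambda>I gs e y. walk_formula I (same_variables I y) (tl gs)"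
    using t g by (intro gap_reduction_walk) simp_all
  show ?thesis
    unfolding WSAT_mono_def[of t]
    by (rule reduction[OF fpt_reducible_refl]) (elim conjE, rule certified_walk_iff[OF _ _ _ t])
qed

subsection \<open>Completeness\<close>

lemma WSAT_mono_in_W:
  assumes "fpt_reducible P (WSAT_mono t g)"
  shows "P \<in> W t"
proof -
  have "fpt_reducible P (weighted_sat (\<lambda>C. wf_circuit C \<and> weft C \<le> t \<and> depth C \<le> t))"
    using assms unfolding WSAT_mono_def
    by (rule fpt_reducible_weighted_sat_mono)
      (use weft_le_depth in \<open>auto simp: Pi_circuit_def intro: order_trans\<close>)
  then show ?thesis unfolding W_def by blast
qed

lemma Pi_circuit_mono: "Pi_circuit t C \<Longrightarrow> t \<le> t' \<Longrightarrow> Pi_circuit t' C"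
  by (auto simp: Pi_circuit_def)

lemma fpt_reducible_WSAT_mono_mono:
  assumes "fpt_reducible P (WSAT_mono t g)" "t \<le> t'"
  shows "fpt_reducible P (WSAT_mono t' g)"
  using assms(1) unfolding WSAT_mono_def
  by (rule fpt_reducible_weighted_sat_mono) (use Pi_circuit_mono assms(2) in blast)

theorem theorem4:
  fixes c :: real and g :: "nat \<Rightarrow> nat" and t :: nat
  assumes "c > 0"
    and "(\<lambda>n. real (g n)) \<in> \<Omega>(\<lambda>n. real n powr c)"
    and "t \<ge> 2"
  shows "(even t \<longrightarrow> W_complete t (WSAT_mono t g)) \<and>
         (odd t \<longrightarrow> W_complete (t - 1) (WSAT_mono t g))"
proof (intro conjI impI)
  obtain a0 d where padding: "genus_padding g a0 d" using ex_genus_padding[OF assms(1,2)] by blast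
  show "W_complete t (WSAT_mono t g)" if "even t"
    unfolding W_complete_def
    using WSAT_mono_in_W[OF fpt_reducible_refl] WSAT_mono_hard[OF assms(3) that padding] by blast
  show "W_complete (t - 1) (WSAT_mono t g)" if "odd t"
  proof -
    have t: "3 \<le> t" "2 \<le> t - 1" "even (t - 1)" using assms(3) that by presburger+
    have "WSAT_mono t g \<in> W (t - 1)"
      using WSAT_mono_odd_reduction[OF t(1) that padding] by (rule WSAT_mono_in_W)
    moreover have "fpt_reducible P (WSAT_mono t g)" if "P \<in> W (t - 1)" for P
      using WSAT_mono_hard[OF t(2,3) padding that] diff_le_self
      by (rule fpt_reducible_WSAT_mono_mono)
    ultimately show ?thesis unfolding W_complete_def by blast
  qed
qed

end
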